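(* Let $d\geq 3$. Then $g_d(m)\geq 2^{\frac{(d-2)^2}{8d}m^2+o(m^2)}$ as $m\to\infty$. Moreover, the number of isomorphism classes of Cayley graphs $\Gamma=\mathrm{Cay}(G,S)$ of order $2^m$, where $S$ consists of $d$ involutions and where $N_{\mathrm{Aut}(\Gamma)}(G)=G$, is also at least $2^{\frac{(d-2)^2}{8d}m^2+o(m^2)}$ as $m\to\infty$.
   Context: $g_d(m)$ denotes the number of isomorphism classes of groups of order $2^m$ which admit a generating set consisting of $d$ involutions. For a group $G$ and an inverse-closed, identity-free generating set $S$, $\mathrm{Cay}(G,S)$ is the graph with vertex-set $G$ in which $u,v$ are adjacent iff $uv^{-1}\in S$; $G$ is regarded as a subgroup of $\mathrm{Aut}(\mathrm{Cay}(G,S))$ via its regular action by right multiplication. $N_X(Y)$ denotes the normaliser of $Y$ in $X$. *)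

theory Defs
  imports
    Complex_Main
    "HOL-Library.Landau_Symbols"
    "HOL-Algebra.Generated_Groups"
    "HOL-Algebra.Group_Action"
    "Graph_Theory.Pair_Digraph"
    "Graph_Theory.Digraph_Isomorphism"
begin

definition involution :: "('a, 'b) monoid_scheme \<Rightarrow> 'a \<Rightarrow> bool" where
  "involution G x \<longleftrightarrow> x \<in> carrier G \<and> x \<noteq> \<one>\<^bsub>G\<^esub> \<and> x \<otimes>\<^bsub>G\<^esub> x = \<one>\<^bsub>G\<^esub>"

definition involution_generating_set ::
    "('a, 'b) monoid_scheme \<Rightarrow> nat \<Rightarrow> 'a set \<Rightarrow> bool" where
  "involution_generating_set G d S \<longleftrightarrow>
     finite S \<and> card S = d \<and> (\<forall>x\<in>S. involution G x) \<and> generate G S = carrier G"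

definition num_classes :: "('a \<Rightarrow> 'a \<Rightarrow> bool) \<Rightarrow> 'a set \<Rightarrow> nat" where
  "num_classes R X = card (X // {(x, y). x \<in> X \<and> y \<in> X \<and> R x y})"

text \<open>
  Every finite group is isomorphic to one whose elements are natural numbers, so counting
  over the type \<open>nat monoid\<close> meets every isomorphism class. An isomorphism class
  contains infinitely many records, but for fixed order there are only finitely many classes.
\<close>

definition num_involution_generated_groups :: "nat \<Rightarrow> nat \<Rightarrow> nat" where
  "num_involution_generated_groups d m =
     num_classes (\<cong>)
       {G :: nat monoid. group G \<and> order G = 2 ^ m \<and> (\<exists>S. involution_generating_set G d S)}"

text \<open>
  An undirected graph is encoded by its symmetric set of arcs: the edge joining \<open>u\<close> and
  \<open>v\<close> is the pair of arcs \<open>(u, v)\<close> and \<open>(v, u)\<close>.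
\<close>

definition Cay :: "('a, 'b) monoid_scheme \<Rightarrow> 'a set \<Rightarrow> 'a pair_pre_digraph" where
  "Cay G S =
     \<lparr>pverts = carrier G,
      parcs = {(u, v). u \<in> carrier G \<and> v \<in> carrier G \<and> u \<otimes>\<^bsub>G\<^esub> inv\<^bsub>G\<^esub> v \<in> S}\<rparr>"

definition graph_automorphisms :: "'a pair_pre_digraph \<Rightarrow> ('a \<Rightarrow> 'a) set" where
  "graph_automorphisms \<Gamma> =
     {p \<in> Bij (pverts \<Gamma>). \<forall>u\<in>pverts \<Gamma>. \<forall>v\<in>pverts \<Gamma>. (p u, p v) \<in> parcs \<Gamma> \<longleftrightarrow> (u, v) \<in> parcs \<Gamma>}"

definition Aut :: "'a pair_pre_digraph \<Rightarrow> ('a \<Rightarrow> 'a) monoid" where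
  "Aut \<Gamma> = BijGroup (pverts \<Gamma>) \<lparr>carrier := graph_automorphisms \<Gamma>\<rparr>"

text \<open>
  The image of \<open>G\<close> under its action on itself by right multiplication. \<^const>\<open>BijGroup\<close>
  composes from right to left, so sending \<open>g\<close> to right multiplication by \<open>g\<close> is an
  anti-homomorphism; its image is nevertheless the regular subgroup identified with \<open>G\<close>.
\<close>

definition right_regular :: "('a, 'b) monoid_scheme \<Rightarrow> ('a \<Rightarrow> 'a) set" where
  "right_regular G = (\<lambda>g. \<lambda>x\<in>carrier G. x \<otimes>\<^bsub>G\<^esub> g) ` carrier G"

text \<open>
  As a graph may be a Cayley graph in several ways, the graph is counted as soon as one
  presentation as a Cayley graph has the required property.
\<close>

definition num_involution_Cayley_graphs :: "nat \<Rightarrow> nat \<Rightarrow> nat" where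
  "num_involution_Cayley_graphs d m =
     num_classes (\<lambda>\<Gamma> \<Delta>. digraph_iso (with_proj \<Gamma>) (with_proj \<Delta>))
       {\<Gamma> :: nat pair_pre_digraph. \<exists>(G :: nat monoid) S.
          group G \<and> order G = 2 ^ m \<and> involution_generating_set G d S \<and> \<Gamma> = Cay G S \<and>
          normalizer (Aut \<Gamma>) (right_regular G) = right_regular G}"

end

theory Submission
  imports
    "HOL-Computational_Algebra.Polynomial"
    "HOL-Computational_Algebra.Primes"
    "HOL-Library.Function_Algebras"
    "HOL-Library.Z2"
    "HOL-Real_Asymp.Real_Asymp"
    "HOL-Algebra.Elementary_Groups"
    Defs
begin

text \<open>
  Let \<open>e = d - 2\<close> and \<open>R = F_2[t]/(t + 1)^n\<close>. On \<open>B = R^e \<times> R^e\<close> a dihedral group acts: the rotation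
  multiplies by \<open>t\<close> and \<open>t\<inverse>\<close> on the two factors and the reflection \<open>s\<close> swaps them. Invariant bilinear
  forms on \<open>B\<close> with values in \<open>V = F_2^x\<close> depend on about \<open>e^2 n\<close> vectors of \<open>V\<close> that can be chosen
  freely, and each form gives a central extension \<open>V.B\<close>, hence a group \<open>(V.B) \<rtimes> Dih\<close> generated by
  \<open>s\<close>, \<open>ts\<close> and \<open>e\<close> involutions \<open>a_1, \<dots>, a_e\<close> of \<open>V.B\<close>. The chosen vectors are the values of the
  commutators of \<open>a_i\<close> with the conjugates of \<open>a_j\<close>. Letting \<open>x\<close> of them form a fixed basis of \<open>V\<close>
  leaves about \<open>2^(x (e^2 n - x))\<close> groups, no two of which are isomorphic by an isomorphism that
  matches the generators. Prescribing finitely many further vectors makes every isomorphism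
  that preserves the set of generators preserve each of them.

  A group of order \<open>2^m\<close> has at most \<open>2^(m d)\<close> tuples of \<open>d\<close> generators, which is negligible. For Cayley
  graphs nothing is lost: the condition on the normaliser makes \<open>G\<close> a self-normalising
  \<open>2\<close>-subgroup of the automorphism group, all such subgroups of the same order are conjugate,
  and so the graph determines the pair \<open>(G, S)\<close>.
\<close>

section \<open>Self-normalising \<open>p\<close>-subgroups\<close>

text \<open>The quadratic exponent comes from a central extension whose quotient \<open>B\<close>
  has rank linear in \<open>m\<close>, although only \<open>d\<close> generators are allowed. The
  dihedral group reconciles the two: modulo \<open>V\<close>, the conjugates of each
  \<open>a_i\<close> under it span a copy of \<open>R \<times> R\<close>, of dimension 2n, while the
  dihedral group itself adds only about log m to the exponent of the order. Truncating at a power of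
  t + 1 keeps everything a 2-group: over F_2, t^(2^J) + 1 = (t + 1)^(2^J), so t has 2-power order in
  \<open>R\<close> for every n up to 2^J, and n need not be a power of two. The constant is an
  optimum. Up to a logarithmic term m = x + 2 e n, and the exponent of the count is x (e^2 n - x) up
  to lower order. Eliminating n gives x (e m - (e + 2) x) / 2, maximal at x = e m / (2 (e + 2)) with
  value e^2 m^2 / (8 (e + 2)); the corresponding n is m (e + 4) / (4 e (e + 2)).\<close>

lemma (in group_action) card_mod_fixed_points:
  assumes p: "prime p" and ord: "order G = p ^ k"
    and D: "finite D" "D \<subseteq> E" "\<And>x. x \<in> D \<Longrightarrow> orbit G \<phi> x \<subseteq> D"
  shows "card D mod p = card {x \<in> D. orbit G \<phi> x = {x}} mod p"
proof -
  define F where "F = {x \<in> D. orbit G \<phi> x = {x}}"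
  let ?C = "orbit G \<phi> ` (D - F)"
  have disj: "orbit G \<phi> x = orbit G \<phi> y" if "x \<in> D" "y \<in> D" "z \<in> orbit G \<phi> x" "z \<in> orbit G \<phi> y" for x y z
    using disjoint_union[of "orbit G \<phi> x" "orbit G \<phi> y"] that D(2) unfolding orbits_def by blast
  have refl: "x \<in> orbit G \<phi> x" if "x \<in> D" for x
    using that D(2) orbit_refl by blast
  have U: "\<Union> ?C = D - F"
  proof
    show "\<Union> ?C \<subseteq> D - F"
    proof
      fix z assume "z \<in> \<Union> ?C"
      then obtain x where x: "x \<in> D" "x \<notin> F" "z \<in> orbit G \<phi> x" by blast
      have z: "z \<in> D" using x D(3) by blast
      have "orbit G \<phi> z = orbit G \<phi> x" using disj[OF z x(1) refl[OF z] x(3)] .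
      moreover have "z \<in> F \<Longrightarrow> orbit G \<phi> z = {z}" unfolding F_def by blast
      ultimately have "z \<notin> F" using x refl[OF x(1)] by fastforce
      with z show "z \<in> D - F" by blast
    qed
    show "D - F \<subseteq> \<Union> ?C" using refl by blast
  qed
  \<comment> \<open>The size of an orbit divides the group order, hence is a power of
    \<open>p\<close>; it is not 1, for then the orbit would consist of a fixed point.\<close>
  have dv: "p dvd card c" if c: "c \<in> ?C" for c
  proof -
    obtain x where x: "x \<in> D" "x \<notin> F" "c = orbit G \<phi> x" using c by auto
    have "card c * card (stabilizer G \<phi> x) = p ^ k"
      using orbit_stabilizer_theorem[of x] x D(2) ord by auto
    then have "card c dvd p ^ k" by (metis dvd_triv_left)
    then obtain i where i: "card c = p ^ i" using divides_primepow_nat[OF p] by blast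
    have "card c \<noteq> 1"
    proof
      assume "card c = 1"
      then obtain y where "c = {y}" using card_1_singletonE by blast
      then have "c = {x}" using refl[OF x(1)] x(3) by simp
      then show False using x unfolding F_def by blast
    qed
    then have "i \<noteq> 0" using i by (metis power_0)
    then show ?thesis using i by (simp add: dvd_power)
  qed
  have "p dvd card (\<Union> ?C)"
  proof (rule dvd_partition)
    show "finite (\<Union> ?C)" unfolding U using D(1) by simp
    show "\<forall>c\<in>?C. p dvd card c" using dv by blast
    show "\<forall>c1\<in>?C. \<forall>c2\<in>?C. c1 \<noteq> c2 \<longrightarrow> c1 \<inter> c2 = {}" using disj by blast
  qed
  then have "p dvd card (D - F)" unfolding U .
  moreover have "F \<subseteq> D" unfolding F_def by blast
  then have "card D = card (D - F) + card F"
    using card_Diff_subset[of F D] card_mono[of D F] finite_subset[of F D] D(1) by simp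
  ultimately show ?thesis unfolding F_def[symmetric] by (auto elim!: dvdE)
qed

lemma (in group) mem_normalizer_iff:
  "H \<subseteq> carrier G \<Longrightarrow> g \<in> normalizer G H \<longleftrightarrow> g \<in> carrier G \<and> g <# H #> inv g = H"
  by (auto simp: normalizer_def stabilizer_def)

lemma (in group) conj_conj:
  assumes "g \<in> carrier G" "h \<in> carrier G" "H \<subseteq> carrier G"
  shows "g <# (h <# H #> inv h) #> inv g = (g \<otimes> h) <# H #> inv (g \<otimes> h)"
  using group_action.composition_rule[OF action_by_conjugation_on_power_set, of H g h] assms
    subset_conjugation_is_bij[of h] 
  by (auto simp: bij_betw_def image_subset_iff dest!: equalityD1)

lemma (in group) card_conj:
  assumes "g \<in> carrier G" "H \<subseteq> carrier G"
  shows "card (g <# H #> inv g) = card H"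
proof -
  have "g <# H #> inv g = (\<lambda>h \<in> carrier G. g \<otimes> h \<otimes> inv g) ` H"
    using assms by (force simp: l_coset_def r_coset_def)
  then show ?thesis
    using conjugation_is_bij[OF assms(1)] assms(2) by (metis bij_betw_def card_image inj_on_subset)
qed

text \<open>
  A self-normalising \<open>p\<close>-subgroup \<open>H\<close> is the only fixed point of \<open>H\<close> acting by conjugation on
  the conjugates of \<open>H\<close>, so their number is prime to \<open>p\<close> and any other \<open>p\<close>-subgroup
  has a fixed point among them, too.
\<close>

lemma (in group) self_normalizing_conjugate:
  assumes fin: "finite (carrier G)" and p: "prime p"
    and H: "subgroup H G" "card H = p ^ k" "normalizer G H = H"
    and K: "subgroup K G" "card K = p ^ k"
  shows "\<exists>g \<in> carrier G. K = g <# H #> inv g"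
proof -
  define D where "D = {g <# H #> inv g | g. g \<in> carrier G}"
  let ?\<phi> = "\<lambda>g. \<lambda>H \<in> {H. H \<subseteq> carrier G}. g <# H #> inv g"
  let ?E = "{H. H \<subseteq> carrier G}"
  have Hs: "H \<subseteq> carrier G" and Ks: "K \<subseteq> carrier G" using H K subgroup.subset by blast+
  have DE: "D \<subseteq> ?E" unfolding D_def using subgroup_conjugation_is_surj2[OF _ H(1)] subgroup.subset by blast
  have finD: "finite D" by (rule finite_subset[OF DE]) (use fin in auto)
  \<comment> \<open>Every conjugate of \<open>H\<close> is self-normalising as well: if
    \<open>g\<close> normalises \<open>L = h H h^-1\<close>, then \<open>h^-1 g h\<close> normalises
    \<open>H\<close>.\<close>
  have self: "g \<in> L" if L: "L \<in> D" and g: "g \<in> carrier G" "g <# L #> inv g = L" for L g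
  proof -
    obtain h where h: "h \<in> carrier G" "L = h <# H #> inv h" using L unfolding D_def by blast
    have "(inv h \<otimes> (g \<otimes> h)) <# H #> inv (inv h \<otimes> (g \<otimes> h)) = inv h <# (g <# L #> inv g) #> inv (inv h)"
      using conj_conj[of "inv h" "g \<otimes> h" H] conj_conj[of g h H] g h Hs by simp
    also have "\<dots> = (inv h \<otimes> h) <# H #> inv (inv h \<otimes> h)"
      unfolding g(2) unfolding h(2) using h Hs by (intro conj_conj) auto
    also have "\<dots> = H" using h Hs by (simp add: lcos_mult_one)
    finally have "inv h \<otimes> (g \<otimes> h) \<in> normalizer G H" using mem_normalizer_iff[OF Hs] g h by simp
    then have *: "inv h \<otimes> (g \<otimes> h) \<in> H" unfolding H(3) .
    have "g = h \<otimes> (inv h \<otimes> (g \<otimes> h)) \<otimes> inv h"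
      using g h by (simp add: m_assoc) (simp flip: m_assoc)
    then show ?thesis unfolding h(2) l_coset_def r_coset_def using * by blast
  qed
  have cardL: "card L = p ^ k" if "L \<in> D" for L
    using that card_conj[OF _ Hs] H(2) unfolding D_def by auto
  \<comment> \<open>A conjugate fixed by \<open>P\<close> contains \<open>P\<close> by
    \<open>self\<close> and equals it by order. So the only possible fixed point is
    \<open>P\<close>, and it occurs exactly when \<open>P\<close> lies in \<open>D\<close>. The
    congruence is used for \<open>P = H\<close> and for \<open>P = K\<close>.\<close>
  have cong: "card D mod p = card ({P} \<inter> D) mod p" if P: "subgroup P G" "card P = p ^ k" for P
  proof -
    have Ps: "P \<subseteq> carrier G" using P subgroup.subset by blast
    \<comment> \<open>Conjugation is an action on all subsets of the carrier; the conjugacy class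
      \<open>D\<close> enters as an invariant part of that power set, which is why the fixed point
      count is relative to a set.\<close>
    interpret act: group_action "G\<lparr>carrier := P\<rparr>" ?E ?\<phi>
      by (rule group_action.induced_action[OF action_by_conjugation_on_power_set P(1)])
    have orb: "orbit (G\<lparr>carrier := P\<rparr>) ?\<phi> L = {g <# L #> inv g | g. g \<in> P}" (is "_ = ?O L") if "L \<in> D" for L
      using that DE unfolding orbit_def by auto
    have eq: "{L \<in> D. orbit (G\<lparr>carrier := P\<rparr>) ?\<phi> L = {L}} = {P} \<inter> D"
    proof (intro equalityI subsetI)
      fix L assume "L \<in> {L \<in> D. orbit (G\<lparr>carrier := P\<rparr>) ?\<phi> L = {L}}"
      then have L: "L \<in> D" and eqL: "{g <# L #> inv g | g. g \<in> P} = {L}" using orb by auto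
      have "P \<subseteq> L"
      proof
        fix g assume "g \<in> P"
        then have "g \<in> carrier G" "g <# L #> inv g = L" using eqL Ps by auto
        then show "g \<in> L" by (rule self[OF L])
      qed
      moreover have "finite L" using L DE fin finite_subset by blast
      ultimately have "P = L" using cardL[OF L] P(2) card_subset_eq by metis
      then show "L \<in> {P} \<inter> D" using L by simp
    next
      fix L assume "L \<in> {P} \<inter> D"
      then have L: "L \<in> D" and [simp]: "L = P" by auto
      have "g <# P #> inv g = P" if "g \<in> P" for g
        using coset_join3[of g P] coset_join2[of "inv g" P] that P(1) Ps subgroup.m_inv_closed[OF P(1)]
        by auto
      moreover have "\<one> \<in> P" using P(1) subgroup.one_closed by blast
      ultimately have "{g <# L #> inv g | g. g \<in> P} = {L}" by auto
      then show "L \<in> {L \<in> D. orbit (G\<lparr>carrier := P\<rparr>) ?\<phi> L = {L}}" using L orb by auto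
    qed
    have "orbit (G\<lparr>carrier := P\<rparr>) ?\<phi> L \<subseteq> D" if "L \<in> D" for L
    proof -
      have "g <# L #> inv g \<in> D" if "g \<in> P" for g
      proof -
        obtain h where "h \<in> carrier G" "L = h <# H #> inv h" using \<open>L \<in> D\<close> unfolding D_def by blast
        then show ?thesis using conj_conj[of g h H] that Ps Hs unfolding D_def by blast
      qed
      then show ?thesis unfolding orb[OF that] by blast
    qed
    then have "card D mod p = card {L \<in> D. orbit (G\<lparr>carrier := P\<rparr>) ?\<phi> L = {L}} mod p"
      by (intro act.card_mod_fixed_points[where k = k] p finD DE) (use P(2) in \<open>auto simp: order_def\<close>)
    then show "card D mod p = card ({P} \<inter> D) mod p" unfolding eq .
  qed
  have "\<one> <# H #> inv \<one> = H" using Hs by (simp add: lcos_mult_one)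
  then have "H \<in> D" unfolding D_def using one_closed by blast
  then have "card D mod p = 1" using cong[OF H(1,2)] prime_gt_1_nat[OF p] by simp
  then have "card ({K} \<inter> D) mod p = 1" using cong[OF K] by simp
  then have "K \<in> D" by (cases "K \<in> D") auto
  then show ?thesis unfolding D_def by blast
qed

section \<open>Cayley graphs and their automorphisms\<close>

lemma carrier_Aut [simp]: "carrier (Aut \<Gamma>) = graph_automorphisms \<Gamma>"
  by (simp add: Aut_def)

lemma one_Aut: "\<one>\<^bsub>Aut \<Gamma>\<^esub> = (\<lambda>x\<in>pverts \<Gamma>. x)"
  by (simp add: Aut_def BijGroup_def)

lemma mult_Aut:
  "p \<in> graph_automorphisms \<Gamma> \<Longrightarrow> q \<in> graph_automorphisms \<Gamma> \<Longrightarrow> p \<otimes>\<^bsub>Aut \<Gamma>\<^esub> q = compose (pverts \<Gamma>) p q"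
  by (simp add: Aut_def BijGroup_def graph_automorphisms_def)

lemma subgroup_graph_automorphisms: "subgroup (graph_automorphisms \<Gamma>) (BijGroup (pverts \<Gamma>))"
proof (rule group.subgroupI[OF group_BijGroup])
  show "graph_automorphisms \<Gamma> \<subseteq> carrier (BijGroup (pverts \<Gamma>))"
    by (auto simp: graph_automorphisms_def BijGroup_def)
  have "(\<lambda>x\<in>pverts \<Gamma>. x) \<in> graph_automorphisms \<Gamma>"
    by (auto simp: graph_automorphisms_def id_Bij)
  then show "graph_automorphisms \<Gamma> \<noteq> {}" by blast
next
  fix p assume p: "p \<in> graph_automorphisms \<Gamma>"
  let ?q = "inv_into (pverts \<Gamma>) p"
  have b: "bij_betw p (pverts \<Gamma>) (pverts \<Gamma>)" and B: "p \<in> Bij (pverts \<Gamma>)"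
    using p by (auto simp: graph_automorphisms_def Bij_def)
  have arc: "(p u, p v) \<in> parcs \<Gamma> \<longleftrightarrow> (u, v) \<in> parcs \<Gamma>" if "u \<in> pverts \<Gamma>" "v \<in> pverts \<Gamma>" for u v
    using p that by (auto simp: graph_automorphisms_def)
  have q: "?q u \<in> pverts \<Gamma>" "p (?q u) = u" if "u \<in> pverts \<Gamma>" for u
    using b that bij_betw_inv_into_right Bij_inv_into_mem B by fastforce+
  have "(?q u, ?q v) \<in> parcs \<Gamma> \<longleftrightarrow> (u, v) \<in> parcs \<Gamma>" if "u \<in> pverts \<Gamma>" "v \<in> pverts \<Gamma>" for u v
    using arc[of "?q u" "?q v"] that q by simp
  then show "inv\<^bsub>BijGroup (pverts \<Gamma>)\<^esub> p \<in> graph_automorphisms \<Gamma>"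
    using B by (simp add: inv_BijGroup graph_automorphisms_def restrict_inv_into_Bij)
next
  fix p q assume "p \<in> graph_automorphisms \<Gamma>" "q \<in> graph_automorphisms \<Gamma>"
  moreover from this have "q x \<in> pverts \<Gamma>" if "x \<in> pverts \<Gamma>" for x
    using that by (auto simp: graph_automorphisms_def Bij_def bij_betw_def)
  ultimately show "p \<otimes>\<^bsub>BijGroup (pverts \<Gamma>)\<^esub> q \<in> graph_automorphisms \<Gamma>"
    by (simp add: BijGroup_def graph_automorphisms_def compose_Bij compose_eq)
qed

lemma group_Aut: "group (Aut \<Gamma>)"
  unfolding Aut_def
  by (rule group.subgroup_imp_group[OF group_BijGroup subgroup_graph_automorphisms])

lemma finite_Aut: "finite (pverts \<Gamma>) \<Longrightarrow> finite (carrier (Aut \<Gamma>))"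
  by (rule finite_subset[of _ "PiE (pverts \<Gamma>) (\<lambda>_. pverts \<Gamma>)"])
    (auto simp: graph_automorphisms_def Bij_def PiE_def bij_betw_def intro!: finite_PiE[unfolded PiE_def])

lemma pverts_Cay [simp]: "pverts (Cay G S) = carrier G"
  by (simp add: Cay_def)

lemma parcs_Cay: "(u, v) \<in> parcs (Cay G S) \<longleftrightarrow> u \<in> carrier G \<and> v \<in> carrier G \<and> u \<otimes>\<^bsub>G\<^esub> inv\<^bsub>G\<^esub> v \<in> S"
  by (simp add: Cay_def)

text \<open>The right regular action of \<open>G\<close>, carried over to \<open>V\<close> along a
  bijection \<open>h\<close> with inverse \<open>h'\<close>. When the bijection comes from an
  isomorphism of Cayley graphs, this places the group of one graph inside the automorphism group of
  the other.\<close>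

definition transported_regular ::
    "'b set \<Rightarrow> ('b \<Rightarrow> 'a) \<Rightarrow> ('a \<Rightarrow> 'b) \<Rightarrow> ('a, 'c) monoid_scheme \<Rightarrow> ('b \<Rightarrow> 'b) set" where
  "transported_regular V h h' G = (\<lambda>g. \<lambda>x\<in>V. h' (h x \<otimes>\<^bsub>G\<^esub> g)) ` carrier G"

lemma right_regular_eq: "right_regular G = transported_regular (carrier G) (\<lambda>x. x) (\<lambda>x. x) G"
  by (simp add: right_regular_def transported_regular_def)

text \<open>A right translation leaves the quotient \<open>u v^-1\<close> of two vertices unchanged,
  and that quotient decides adjacency. Since functions compose from right to left, \<open>k\<close>
  reverses products, but its image is still a subgroup.\<close>

lemma transported_regular_subgroup:
  fixes G :: "('a, 'c) monoid_scheme" and \<Gamma> :: "'b pair_pre_digraph"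
  assumes G: "group G" and V: "pverts \<Gamma> = V"
    and h: "\<And>x. x \<in> V \<Longrightarrow> h x \<in> carrier G" "\<And>x. x \<in> V \<Longrightarrow> h' (h x) = x"
    and h': "\<And>y. y \<in> carrier G \<Longrightarrow> h' y \<in> V" "\<And>y. y \<in> carrier G \<Longrightarrow> h (h' y) = y"
    and arcs: "\<And>u v. u \<in> V \<Longrightarrow> v \<in> V \<Longrightarrow> (u, v) \<in> parcs \<Gamma> \<longleftrightarrow> (h u, h v) \<in> parcs (Cay G S)"
  shows "subgroup (transported_regular V h h' G) (Aut \<Gamma>)"
    and "card (transported_regular V h h' G) = order G"
proof -
  interpret G: group G by (rule G)
  interpret A: group "Aut \<Gamma>" by (rule group_Aut)
  define k where "k g = (\<lambda>x\<in>V. h' (h x \<otimes>\<^bsub>G\<^esub> g))" for g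
  have K: "transported_regular V h h' G = k ` carrier G"
    by (simp add: transported_regular_def k_def)
  have kV: "k g x \<in> V" if "x \<in> V" "g \<in> carrier G" for g x
    using that h h' by (simp add: k_def)
  have hk: "h (k g x) = h x \<otimes>\<^bsub>G\<^esub> g" if "x \<in> V" "g \<in> carrier G" for g x
    using that h h' by (simp add: k_def)
  have comp: "compose V (k g1) (k g2) = k (g2 \<otimes>\<^bsub>G\<^esub> g1)" if "g1 \<in> carrier G" "g2 \<in> carrier G" for g1 g2
    using that h h' by (auto simp: k_def compose_def G.m_assoc fun_eq_iff)
  have k1: "k \<one>\<^bsub>G\<^esub> = (\<lambda>x\<in>V. x)" using h by (auto simp: k_def fun_eq_iff)
  have inv: "k (inv\<^bsub>G\<^esub> g) (k g x) = x" "k g (k (inv\<^bsub>G\<^esub> g) x) = x" if "g \<in> carrier G" "x \<in> V" for g x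
    using that h h' by (auto simp: k_def G.m_assoc)
  have bij: "bij_betw (k g) V V" if "g \<in> carrier G" for g
    by (rule bij_betw_byWitness[where f' = "k (inv\<^bsub>G\<^esub> g)"]) (use that kV inv in auto)
  have kA: "k g \<in> graph_automorphisms \<Gamma>" if g: "g \<in> carrier G" for g
  proof -
    have "(k g u, k g v) \<in> parcs \<Gamma> \<longleftrightarrow> (u, v) \<in> parcs \<Gamma>" if u: "u \<in> V" and v: "v \<in> V" for u v
    proof -
      have "g \<otimes>\<^bsub>G\<^esub> (inv\<^bsub>G\<^esub> g \<otimes>\<^bsub>G\<^esub> inv\<^bsub>G\<^esub> h v) = inv\<^bsub>G\<^esub> h v"
        using g h v by (simp flip: G.m_assoc)
      then have "h u \<otimes>\<^bsub>G\<^esub> g \<otimes>\<^bsub>G\<^esub> inv\<^bsub>G\<^esub> (h v \<otimes>\<^bsub>G\<^esub> g) = h u \<otimes>\<^bsub>G\<^esub> inv\<^bsub>G\<^esub> (h v)"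
        using g h u v by (simp add: G.inv_mult_group G.m_assoc)
      then show ?thesis
        using g h u v by (simp add: arcs kV hk parcs_Cay)
    qed
    moreover have "k g \<in> extensional V" by (simp add: k_def)
    ultimately show ?thesis using bij[OF g] by (simp add: graph_automorphisms_def Bij_def V)
  qed
  show "subgroup (transported_regular V h h' G) (Aut \<Gamma>)"
    unfolding K
  proof (rule A.subgroupI)
    show "k ` carrier G \<subseteq> carrier (Aut \<Gamma>)" using kA by auto
    show "k ` carrier G \<noteq> {}" using G.one_closed by blast
  next
    fix a assume "a \<in> k ` carrier G"
    then obtain g where g: "g \<in> carrier G" "a = k g" by blast
    have "k (inv\<^bsub>G\<^esub> g) \<otimes>\<^bsub>Aut \<Gamma>\<^esub> k g = \<one>\<^bsub>Aut \<Gamma>\<^esub>"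
      using g kA comp k1 by (simp add: mult_Aut V one_Aut)
    then have "inv\<^bsub>Aut \<Gamma>\<^esub> (k g) = k (inv\<^bsub>G\<^esub> g)" using A.inv_equality g kA by simp
    then show "inv\<^bsub>Aut \<Gamma>\<^esub> a \<in> k ` carrier G" using g by simp
  next
    fix a b assume "a \<in> k ` carrier G" "b \<in> k ` carrier G"
    then show "a \<otimes>\<^bsub>Aut \<Gamma>\<^esub> b \<in> k ` carrier G" using kA comp by (auto simp: mult_Aut V)
  qed
  have "inj_on k (carrier G)"
  proof (rule inj_onI)
    fix g1 g2 assume g: "g1 \<in> carrier G" "g2 \<in> carrier G" and "k g1 = k g2"
    then have "h (k g1 (h' \<one>\<^bsub>G\<^esub>)) = h (k g2 (h' \<one>\<^bsub>G\<^esub>))" by simp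
    then show "g1 = g2" using g h' by (simp add: hk)
  qed
  then show "card (transported_regular V h h' G) = order G"
    unfolding K by (simp add: card_image order_def)
qed

lemma right_regular_subgroup:
  assumes "group G"
  shows "subgroup (right_regular G) (Aut (Cay G S))" and "card (right_regular G) = order G"
  unfolding right_regular_eq using assms by (auto intro!: transported_regular_subgroup)

text \<open>A bijection that carries right translations to right translations is a group isomorphism
  followed by a right translation; dividing by the image of the identity removes the latter. Arcs
  into the identity then recover the connection set, because \<open>S\<close> is the neighbourhood
  of the identity.\<close>

lemma Cay_equivariant_iso:
  assumes G: "group G" and G': "group G'" and S: "S \<subseteq> carrier G" "S' \<subseteq> carrier G'"
    and h: "bij_betw h (carrier G) (carrier G')"
    and arcs: "\<And>u v. u \<in> carrier G \<Longrightarrow> v \<in> carrier G \<Longrightarrow>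
      (h u, h v) \<in> parcs (Cay G' S') \<longleftrightarrow> (u, v) \<in> parcs (Cay G S)"
    and equiv: "\<And>g. g \<in> carrier G \<Longrightarrow>
      \<exists>g'\<in>carrier G'. \<forall>x\<in>carrier G. h (x \<otimes>\<^bsub>G\<^esub> g) = h x \<otimes>\<^bsub>G'\<^esub> g'"
  defines "\<alpha> \<equiv> \<lambda>x. h x \<otimes>\<^bsub>G'\<^esub> inv\<^bsub>G'\<^esub> (h \<one>\<^bsub>G\<^esub>)"
  shows "\<alpha> \<in> iso G G'" and "\<alpha> ` S = S'"
proof -
  interpret G: group G by (rule G)
  interpret G': group G' by (rule G')
  have hc: "h x \<in> carrier G'" if "x \<in> carrier G" for x
    using h that by (auto simp: bij_betw_def)
  have "\<alpha> (x \<otimes>\<^bsub>G\<^esub> g) = \<alpha> x \<otimes>\<^bsub>G'\<^esub> \<alpha> g" if x: "x \<in> carrier G" and g: "g \<in> carrier G" for x g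
  proof -
    obtain g' where g': "g' \<in> carrier G'" "\<And>x. x \<in> carrier G \<Longrightarrow> h (x \<otimes>\<^bsub>G\<^esub> g) = h x \<otimes>\<^bsub>G'\<^esub> g'"
      using equiv[OF g] by blast
    have hg: "h g = h \<one>\<^bsub>G\<^esub> \<otimes>\<^bsub>G'\<^esub> g'" using g'(2)[of "\<one>\<^bsub>G\<^esub>"] g by simp
    have "inv\<^bsub>G'\<^esub> (h \<one>\<^bsub>G\<^esub>) \<otimes>\<^bsub>G'\<^esub> (h \<one>\<^bsub>G\<^esub> \<otimes>\<^bsub>G'\<^esub> g') = g'"
      using hc g'(1) by (simp flip: G'.m_assoc)
    then show ?thesis
      unfolding \<alpha>_def g'(2)[OF x] hg using x g g'(1) hc by (simp add: G'.m_assoc)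
        (simp flip: G'.m_assoc)
  qed
  moreover have "\<alpha> x \<in> carrier G'" if "x \<in> carrier G" for x using that hc by (simp add: \<alpha>_def)
  ultimately have hom: "\<alpha> \<in> hom G G'" by (auto simp: hom_def)
  have "bij_betw ((\<lambda>y. y \<otimes>\<^bsub>G'\<^esub> inv\<^bsub>G'\<^esub> (h \<one>\<^bsub>G\<^esub>)) \<circ> h) (carrier G) (carrier G')"
  proof (rule bij_betw_trans[OF h])
    show "bij_betw (\<lambda>y. y \<otimes>\<^bsub>G'\<^esub> inv\<^bsub>G'\<^esub> (h \<one>\<^bsub>G\<^esub>)) (carrier G') (carrier G')"
      by (rule bij_betw_byWitness[where f' = "\<lambda>y. y \<otimes>\<^bsub>G'\<^esub> h \<one>\<^bsub>G\<^esub>"])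
        (use hc in \<open>auto simp: G'.m_assoc\<close>)
  qed
  then have bij: "bij_betw \<alpha> (carrier G) (carrier G')" by (simp add: \<alpha>_def o_def)
  then show "\<alpha> \<in> iso G G'" using hom by (simp add: iso_def)
  have "\<alpha> u \<in> S' \<longleftrightarrow> u \<in> S" if "u \<in> carrier G" for u
    using arcs[of u "\<one>\<^bsub>G\<^esub>"] that hc by (simp add: parcs_Cay \<alpha>_def)
  moreover have "S' \<subseteq> \<alpha> ` carrier G" using bij S(2) by (simp add: bij_betw_def)
  ultimately show "\<alpha> ` S = S'" using S(1) by blast
qed

section \<open>Normalisers of regular subgroups, and recovering the group from the graph\<close>

lemma hom_eq_on_generate:
  assumes "group G" "group H" "f \<in> hom G H" "g \<in> hom G H" "S \<subseteq> carrier G"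
    and "\<And>x. x \<in> S \<Longrightarrow> f x = g x" and "x \<in> generate G S"
  shows "f x = g x"
proof -
  interpret f: group_hom G H f using assms by (simp add: group_hom_def group_hom_axioms_def)
  interpret g: group_hom G H g using assms by (simp add: group_hom_def group_hom_axioms_def)
  show ?thesis using assms(7)
  proof (induction x rule: generate.induct)
    case (eng h1 h2)
    then show ?case using f.G.generate_in_carrier[OF assms(5)] by simp
  qed (use assms(5,6) in auto)
qed

lemma (in group) subgroup_conj_self:
  assumes "subgroup P G" "g \<in> P"
  shows "g <# P #> inv g = P"
  using coset_join3[of g P] coset_join2[of "inv g" P] assms subgroup.m_inv_closed[OF assms]
    subgroup.mem_carrier[OF assms] by auto

lemma (in group) conj_eqD:
  assumes "p <# H #> inv p = K" "p \<in> carrier G" "H \<subseteq> carrier G" "h \<in> H"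
  shows "\<exists>k\<in>K. p \<otimes> h = k \<otimes> p"
proof
  show "p \<otimes> h \<otimes> inv p \<in> K" using assms by (auto simp: l_coset_def r_coset_def)
  show "p \<otimes> h = p \<otimes> h \<otimes> inv p \<otimes> p" using assms by (auto simp: m_assoc subsetD)
qed

text \<open>An automorphism of the graph that normalises the translations is, by the equivariance
  argument, a group automorphism preserving \<open>S\<close> followed by a translation. Rigidity
  makes the former trivial on the generators, so only the translation is left.\<close>

lemma normalizer_right_regular:
  assumes G: "group G" and S: "S \<subseteq> carrier G" "generate G S = carrier G"
    and rigid: "\<And>\<alpha> x. \<alpha> \<in> iso G G \<Longrightarrow> \<alpha> ` S = S \<Longrightarrow> x \<in> S \<Longrightarrow> \<alpha> x = x"
  shows "normalizer (Aut (Cay G S)) (right_regular G) = right_regular G"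
proof -
  let ?A = "Aut (Cay G S)"
  interpret G: group G by (rule G)
  interpret A: group ?A by (rule group_Aut)
  note sub = right_regular_subgroup(1)[OF G, of S]
  have subs: "right_regular G \<subseteq> carrier ?A" using sub subgroup.subset by blast
  show ?thesis
  proof
    show "right_regular G \<subseteq> normalizer ?A (right_regular G)"
      using A.mem_normalizer_iff[OF subs] A.subgroup_conj_self[OF sub] subs by blast
  next
    show "normalizer ?A (right_regular G) \<subseteq> right_regular G"
    proof
      fix p assume "p \<in> normalizer ?A (right_regular G)"
      then have p: "p \<in> carrier ?A" and n: "p <#\<^bsub>?A\<^esub> right_regular G #>\<^bsub>?A\<^esub> inv\<^bsub>?A\<^esub> p = right_regular G"
        using A.mem_normalizer_iff[OF subs] by auto
      have bij: "bij_betw p (carrier G) (carrier G)" and ext: "p \<in> extensional (carrier G)"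
        and arcs: "\<And>u v. u \<in> carrier G \<Longrightarrow> v \<in> carrier G \<Longrightarrow>
            (p u, p v) \<in> parcs (Cay G S) \<longleftrightarrow> (u, v) \<in> parcs (Cay G S)"
        using p by (auto simp: graph_automorphisms_def Bij_def)
      have pc: "p x \<in> carrier G" if "x \<in> carrier G" for x
        using bij that by (auto simp: bij_betw_def)
      have equiv: "\<exists>g'\<in>carrier G. \<forall>x\<in>carrier G. p (x \<otimes>\<^bsub>G\<^esub> g) = p x \<otimes>\<^bsub>G\<^esub> g'" if g: "g \<in> carrier G" for g
      proof -
        let ?r = "\<lambda>g. \<lambda>x\<in>carrier G. x \<otimes>\<^bsub>G\<^esub> g"
        have r: "?r g \<in> right_regular G" using g by (simp add: right_regular_def)
        then obtain k where k: "k \<in> right_regular G" "p \<otimes>\<^bsub>?A\<^esub> ?r g = k \<otimes>\<^bsub>?A\<^esub> p"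
          using A.conj_eqD[OF n p subs] by blast
        then obtain g' where g': "g' \<in> carrier G" "k = ?r g'" unfolding right_regular_def by blast
        have "compose (carrier G) p (?r g) = compose (carrier G) k p"
          using k r p subs by (simp add: mult_Aut subset_iff)
        then have *: "compose (carrier G) p (?r g) x = compose (carrier G) k p x" for x by simp
        have "p (x \<otimes>\<^bsub>G\<^esub> g) = p x \<otimes>\<^bsub>G\<^esub> g'" if "x \<in> carrier G" for x
          using *[of x] that pc by (simp add: compose_def g'(2))
        then show ?thesis using g'(1) by blast
      qed
      define \<alpha> where "\<alpha> = (\<lambda>x. p x \<otimes>\<^bsub>G\<^esub> inv\<^bsub>G\<^esub> (p \<one>\<^bsub>G\<^esub>))"
      have \<alpha>: "\<alpha> \<in> iso G G" "\<alpha> ` S = S"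
        using Cay_equivariant_iso[OF G G S(1) S(1) bij arcs equiv] by (auto simp: \<alpha>_def)
      have idh: "(\<lambda>x. x) \<in> hom G G" and ah: "\<alpha> \<in> hom G G"
        using \<alpha>(1) by (auto simp: iso_def hom_def)
      have \<alpha>x: "\<alpha> x = x" if "x \<in> carrier G" for x
        by (rule hom_eq_on_generate[OF G G ah idh S(1) rigid[OF \<alpha>]]) (use that S(2) in auto)
      have "p x = x \<otimes>\<^bsub>G\<^esub> p \<one>\<^bsub>G\<^esub>" if "x \<in> carrier G" for x
      proof -
        have "\<alpha> x \<otimes>\<^bsub>G\<^esub> p \<one>\<^bsub>G\<^esub> = p x" using that pc by (simp add: \<alpha>_def G.m_assoc)
        then show ?thesis using \<alpha>x[OF that] by simp
      qed
      then have "p = (\<lambda>x\<in>carrier G. x \<otimes>\<^bsub>G\<^esub> p \<one>\<^bsub>G\<^esub>)"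
        by (intro extensionalityI[OF ext restrict_extensional]) (metis restrict_apply')
      then show "p \<in> right_regular G" unfolding right_regular_def using pc by blast
    qed
  qed
qed

text \<open>A digraph isomorphism also moves arcs and prescribes new head and tail maps. The target
  being of the form \<open>with_proj\<close>, those maps are the two projections, so the arc map is
  determined by the vertex map.\<close>

lemma digraph_iso_with_projD:
  assumes "digraph_iso (with_proj \<Gamma>) (with_proj \<Delta>)"
  obtains h where "bij_betw h (pverts \<Gamma>) (pverts \<Delta>)"
    and "\<And>u v. u \<in> pverts \<Gamma> \<Longrightarrow> v \<in> pverts \<Gamma> \<Longrightarrow> (h u, h v) \<in> parcs \<Delta> \<longleftrightarrow> (u, v) \<in> parcs \<Gamma>"
proof -
  obtain f where f: "pre_digraph.digraph_isomorphism (with_proj \<Gamma>) f"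
    and eq: "with_proj \<Delta> = app_iso f (with_proj \<Gamma>)"
    using assms unfolding digraph_iso_def by blast
  have wf: "wf_digraph (with_proj \<Gamma>)" and inj: "inj_on (iso_verts f) (pverts \<Gamma>)"
    using f by (auto simp: pre_digraph.digraph_isomorphism_def)
  have v: "pverts \<Delta> = iso_verts f ` pverts \<Gamma>" and a: "parcs \<Delta> = iso_arcs f ` parcs \<Gamma>"
    and t: "iso_tail f = fst" "iso_head f = snd"
    using arg_cong[OF eq, of verts] arg_cong[OF eq, of arcs] arg_cong[OF eq, of tail]
      arg_cong[OF eq, of head] by auto
  have ends: "iso_arcs f e = (iso_verts f (fst e), iso_verts f (snd e))" if "e \<in> parcs \<Gamma>" for e
    using f that unfolding pre_digraph.digraph_isomorphism_def t
    by (metis prod.collapse with_proj_simps(2,4,5))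
  have ver: "fst e \<in> pverts \<Gamma>" "snd e \<in> pverts \<Gamma>" if "e \<in> parcs \<Gamma>" for e
    using wf_digraph.tail_in_verts[OF wf] wf_digraph.head_in_verts[OF wf] that by auto
  show ?thesis
  proof (rule that)
    show "bij_betw (iso_verts f) (pverts \<Gamma>) (pverts \<Delta>)" using inj v by (simp add: bij_betw_def)
    fix u v assume uv: "u \<in> pverts \<Gamma>" "v \<in> pverts \<Gamma>"
    show "(iso_verts f u, iso_verts f v) \<in> parcs \<Delta> \<longleftrightarrow> (u, v) \<in> parcs \<Gamma>"
    proof
      assume "(iso_verts f u, iso_verts f v) \<in> parcs \<Delta>"
      then obtain e where e: "e \<in> parcs \<Gamma>" "(iso_verts f u, iso_verts f v) = iso_arcs f e" unfolding a by blast
      then have "iso_verts f u = iso_verts f (fst e)" "iso_verts f v = iso_verts f (snd e)" 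
        using ends by auto
      then have "u = fst e" "v = snd e" using inj uv ver[OF e(1)] by (auto dest: inj_onD)
      then show "(u, v) \<in> parcs \<Gamma>" using e by simp
    next
      assume "(u, v) \<in> parcs \<Gamma>"
      then show "(iso_verts f u, iso_verts f v) \<in> parcs \<Delta>" unfolding a using ends by force
    qed
  qed
qed

lemma digraph_iso_with_projI:
  assumes h: "bij_betw h (pverts \<Gamma>) (pverts \<Delta>)"
    and arcs: "\<And>u v. u \<in> pverts \<Gamma> \<Longrightarrow> v \<in> pverts \<Gamma> \<Longrightarrow> (h u, h v) \<in> parcs \<Delta> \<longleftrightarrow> (u, v) \<in> parcs \<Gamma>"
    and sub: "parcs \<Gamma> \<subseteq> pverts \<Gamma> \<times> pverts \<Gamma>" "parcs \<Delta> \<subseteq> pverts \<Delta> \<times> pverts \<Delta>"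
  shows "digraph_iso (with_proj \<Gamma>) (with_proj \<Delta>)"
proof -
  let ?f = "\<lparr>iso_verts = h, iso_arcs = map_prod h h, iso_head = snd, iso_tail = fst\<rparr>"
  have inj: "inj_on h (pverts \<Gamma>)" and img: "h ` pverts \<Gamma> = pverts \<Delta>" using h by (auto simp: bij_betw_def)
  have inj2: "inj_on (map_prod h h) (parcs \<Gamma>)"
    using inj sub(1) by (auto simp: inj_on_def) (metis SigmaD1 SigmaD2 subsetD)+
  have "wf_digraph (with_proj \<Gamma>)" by unfold_locales (use sub(1) in auto)
  then have 1: "pre_digraph.digraph_isomorphism (with_proj \<Gamma>) ?f"
    using inj inj2 by (simp add: pre_digraph.digraph_isomorphism_def)
  have "parcs \<Delta> = map_prod h h ` parcs \<Gamma>"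
  proof (intro equalityI subsetI)
    fix e assume e: "e \<in> parcs \<Delta>"
    then have "fst e \<in> h ` pverts \<Gamma>" "snd e \<in> h ` pverts \<Gamma>" using sub(2) unfolding img by auto
    then obtain u v where "u \<in> pverts \<Gamma>" "v \<in> pverts \<Gamma>" "e = (h u, h v)" by (metis imageE prod.collapse)
    then show "e \<in> map_prod h h ` parcs \<Gamma>" using arcs e by force
  next
    fix e assume "e \<in> map_prod h h ` parcs \<Gamma>"
    then show "e \<in> parcs \<Delta>" using arcs sub(1) by auto
  qed
  then have "with_proj \<Delta> = app_iso ?f (with_proj \<Gamma>)"
    using img by (simp add: with_proj_def app_iso_def)
  then show ?thesis using 1 unfolding digraph_iso_def by blast
qed

text \<open>Through \<open>h\<close> the group \<open>G\<close> acts on the second graph as a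
  subgroup \<open>K\<close> of the same order as \<open>right_regular G'\<close>. The latter is
  self-normalising, so the two are conjugate, and correcting \<open>h\<close> by the conjugating
  automorphism makes it carry translations to translations.\<close>

lemma Cay_iso_imp_group_iso:
  assumes p: "prime p" and G: "group G" "order G = p ^ k" "S \<subseteq> carrier G"
    and G': "group G'" "order G' = p ^ k" "S' \<subseteq> carrier G'"
    and norm: "normalizer (Aut (Cay G' S')) (right_regular G') = right_regular G'"
    and iso: "digraph_iso (with_proj (Cay G S)) (with_proj (Cay G' S'))"
  shows "\<exists>\<alpha> \<in> iso G G'. \<alpha> ` S = S'"
proof -
  let ?A = "Aut (Cay G' S')" and ?V = "carrier G'"
  interpret A: group ?A by (rule group_Aut)
  interpret G: group G by (rule G)
  interpret G': group G' by (rule G')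
  obtain h where h: "bij_betw h (carrier G) ?V"
    and arcs: "\<And>u v. u \<in> carrier G \<Longrightarrow> v \<in> carrier G \<Longrightarrow>
        (h u, h v) \<in> parcs (Cay G' S') \<longleftrightarrow> (u, v) \<in> parcs (Cay G S)"
    using digraph_iso_with_projD[OF iso] by auto
  define h' where "h' = inv_into (carrier G) h"
  have hh: "h u \<in> ?V" "h' (h u) = u" if "u \<in> carrier G" for u
    using h that bij_betw_inv_into_left unfolding h'_def bij_betw_def by fastforce+
  have hh': "h' u \<in> carrier G" "h (h' u) = u" if "u \<in> ?V" for u
    using h that bij_betw_inv_into_right[OF h] bij_betw_inv_into[OF h]
    unfolding h'_def by (auto simp: bij_betw_def)
  have arcs': "(u, v) \<in> parcs (Cay G' S') \<longleftrightarrow> (h' u, h' v) \<in> parcs (Cay G S)"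
    if "u \<in> ?V" "v \<in> ?V" for u v
    using arcs[of "h' u" "h' v"] that hh' by simp
  define K where "K = transported_regular ?V h' h G"
  have K: "subgroup K ?A" "card K = p ^ k"
    unfolding K_def using transported_regular_subgroup[OF G(1), of "Cay G' S'" ?V h' h S]
      hh hh' arcs' G(2) by auto
  have finV: "finite ?V" using G'(2) prime_gt_0_nat[OF p] by (intro card_ge_0_finite) (simp add: order_def)
  obtain a where a: "a \<in> carrier ?A" 
    and Ka: "K = a <#\<^bsub>?A\<^esub> right_regular G' #>\<^bsub>?A\<^esub> inv\<^bsub>?A\<^esub> a"
    using A.self_normalizing_conjugate[OF finite_Aut p _ _ norm K] right_regular_subgroup[OF G'(1)]
      finV G'(2) by auto
  define b where "b = inv\<^bsub>?A\<^esub> a"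
  have b: "b \<in> carrier ?A" using A.inv_closed[OF a] by (simp add: b_def)
  note subR = subgroup.subset[OF right_regular_subgroup(1)[OF G'(1), of S']]
  have Kb: "b <#\<^bsub>?A\<^esub> K #>\<^bsub>?A\<^esub> inv\<^bsub>?A\<^esub> b = right_regular G'"
    unfolding Ka b_def using A.conj_conj[of "inv\<^bsub>?A\<^esub> a" a "right_regular G'"] A.inv_closed[OF a] a subR
    by (simp add: A.lcos_mult_one)
  have bij: "bij_betw b ?V ?V" 
    and arcsb: "\<And>u v. u \<in> ?V \<Longrightarrow> v \<in> ?V \<Longrightarrow>
        (b u, b v) \<in> parcs (Cay G' S') \<longleftrightarrow> (u, v) \<in> parcs (Cay G' S')"
    using b by (auto simp: graph_automorphisms_def Bij_def)
  have bc: "b x \<in> ?V" if "x \<in> ?V" for x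
    using bij that by (auto simp: bij_betw_def)
  have equiv: "\<exists>g'\<in>?V. \<forall>x\<in>carrier G. (b \<circ> h) (x \<otimes>\<^bsub>G\<^esub> g) = (b \<circ> h) x \<otimes>\<^bsub>G'\<^esub> g'" if g: "g \<in> carrier G" for g
  proof -
    let ?k = "\<lambda>x\<in>?V. h (h' x \<otimes>\<^bsub>G\<^esub> g)"
    have kK: "?k \<in> K" using g by (auto simp: K_def transported_regular_def)
    then obtain r where r: "r \<in> right_regular G'" "b \<otimes>\<^bsub>?A\<^esub> ?k = r \<otimes>\<^bsub>?A\<^esub> b"
      using A.conj_eqD[OF Kb b subgroup.subset[OF K(1)]] by blast
    then obtain g' where g': "g' \<in> ?V" "r = (\<lambda>x\<in>?V. x \<otimes>\<^bsub>G'\<^esub> g')" unfolding right_regular_def by blast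
    have "compose ?V b ?k = compose ?V r b"
      using kK r b subR subgroup.subset[OF K(1)] by (simp add: mult_Aut subset_iff)
    then have *: "compose ?V b ?k x = compose ?V r b x" for x by simp
    have "b (h (x \<otimes>\<^bsub>G\<^esub> g)) = b (h x) \<otimes>\<^bsub>G'\<^esub> g'" if "x \<in> carrier G" for x
      using *[of "h x"] that hh bc by (simp add: compose_def g'(2))
    then show ?thesis using g'(1) by auto
  qed
  have "bij_betw (b \<circ> h) (carrier G) ?V" by (rule bij_betw_trans[OF h bij])
  then show ?thesis
    using Cay_equivariant_iso[OF G(1) G'(1) G(3) G'(3) _ _ equiv] arcs arcsb hh by fastforce
qed


section \<open>Counting isomorphism classes\<close>

text \<open>Each \<open>f\<close> belongs to the class of its own image \<open>g f\<close>, and each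
  class receives at most \<open>K\<close> of them. Finiteness of the quotient matters because
  \<open>card\<close> of an infinite set is 0.\<close>

lemma card_le_num_classes:
  assumes Q: "finite (X // {(x, y). x \<in> X \<and> y \<in> X \<and> R x y})" and F: "finite F"
    and g: "\<And>f. f \<in> F \<Longrightarrow> g f \<in> X \<and> R (g f) (g f)"
    and K: "\<And>x. x \<in> X \<Longrightarrow> card {f \<in> F. R x (g f)} \<le> K"
  shows "card F \<le> num_classes R X * K"
proof -
  let ?Q = "X // {(x, y). x \<in> X \<and> y \<in> X \<and> R x y}"
  have "F \<subseteq> (\<Union>c\<in>?Q. {f \<in> F. g f \<in> c})"
  proof
    fix f assume f: "f \<in> F"
    then have "{(x, y). x \<in> X \<and> y \<in> X \<and> R x y} `` {g f} \<in> ?Q"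
      using g by (intro quotientI) auto
    moreover have "g f \<in> {(x, y). x \<in> X \<and> y \<in> X \<and> R x y} `` {g f}" using f g by auto
    ultimately show "f \<in> (\<Union>c\<in>?Q. {f \<in> F. g f \<in> c})" using f by blast
  qed
  then have "card F \<le> card (\<Union>c\<in>?Q. {f \<in> F. g f \<in> c})"
    by (intro card_mono) (use Q F in auto)
  also have "\<dots> \<le> (\<Sum>c\<in>?Q. card {f \<in> F. g f \<in> c})" by (rule card_UN_le[OF Q])
  also have "\<dots> \<le> (\<Sum>c\<in>?Q. K)"
  proof (rule sum_mono)
    fix c assume "c \<in> ?Q"
    then obtain x where x: "x \<in> X" "c = {(x, y). x \<in> X \<and> y \<in> X \<and> R x y} `` {x}"
      by (auto elim: quotientE)
    then have "{f \<in> F. g f \<in> c} = {f \<in> F. R x (g f)}" using g by auto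
    then show "card {f \<in> F. g f \<in> c} \<le> K" using K[OF x(1)] by simp
  qed
  finally show ?thesis by (simp add: num_classes_def)
qed

text \<open>Supplies that finiteness: the class of \<open>x\<close> is determined by
  \<open>h x\<close>, where \<open>h\<close> may be any labelling with finitely many values whose
  fibres lie inside classes. It may depend on choices and need not be constant on classes.\<close>

lemma finite_classes:
  assumes sym: "\<And>x y. x \<in> X \<Longrightarrow> y \<in> X \<Longrightarrow> R x y \<Longrightarrow> R y x"
    and trans: "\<And>x y z. x \<in> X \<Longrightarrow> y \<in> X \<Longrightarrow> z \<in> X \<Longrightarrow> R x y \<Longrightarrow> R y z \<Longrightarrow> R x z"
    and fin: "finite (h ` X)" and inv: "\<And>x y. x \<in> X \<Longrightarrow> y \<in> X \<Longrightarrow> h x = h y \<Longrightarrow> R x y"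
  shows "finite (X // {(x, y). x \<in> X \<and> y \<in> X \<and> R x y})"
proof -
  let ?E = "{(x, y). x \<in> X \<and> y \<in> X \<and> R x y}"
  have eq: "?E `` {x} = ?E `` {inv_into X h (h x)}" if x: "x \<in> X" for x
  proof -
    define y where "y = inv_into X h (h x)"
    have y: "y \<in> X" "h y = h x" using x by (auto simp: y_def inv_into_into f_inv_into_f)
    have "R x y" "R y x" using inv x y by simp_all
    have "R x z \<longleftrightarrow> R y z" if "z \<in> X" for z
      using trans[of x y z] trans[of y x z] \<open>R x y\<close> \<open>R y x\<close> x y(1) that by blast
    then have "?E `` {x} = ?E `` {y}" using x y(1) by auto
    then show ?thesis by (simp add: y_def)
  qed
  have "X // ?E \<subseteq> (\<lambda>z. ?E `` {inv_into X h z}) ` (h ` X)"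
  proof
    fix c assume "c \<in> X // ?E"
    then obtain x where "x \<in> X" "c = ?E `` {x}" by (auto elim: quotientE)
    then show "c \<in> (\<lambda>z. ?E `` {inv_into X h z}) ` (h ` X)" using eq by blast
  qed
  then show ?thesis using fin by (rule finite_surj[rotated])
qed

text \<open>The label \<open>h\<close> is the multiplication table read through an arbitrarily
  chosen numbering of the carrier. There are finitely many tables, and equal tables give isomorphic
  groups.\<close>

lemma finite_group_classes:
  assumes "n > 0"
  shows "finite ({G :: 'a monoid. group G \<and> order G = n \<and> P G} //
    {(G, H). G \<in> {G. group G \<and> order G = n \<and> P G} \<and> H \<in> {G. group G \<and> order G = n \<and> P G} \<and> G \<cong> H})"
proof -
  let ?X = "{G :: 'a monoid. group G \<and> order G = n \<and> P G}"
  have "\<exists>b. bij_betw b (carrier G) {..<n}" if "G \<in> ?X" for G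
  proof -
    have "finite (carrier G)" "card (carrier G) = n" using that assms
      by (auto simp: order_def intro: card_ge_0_finite)
    then show ?thesis using finite_same_card_bij[of "carrier G" "{..<n}"] by simp
  qed
  then have "\<exists>b. \<forall>G\<in>?X. bij_betw (b G) (carrier G) {..<n}" by (intro bchoice ballI)
  then obtain b where b: "\<And>G. G \<in> ?X \<Longrightarrow> bij_betw (b G) (carrier G) {..<n}" by blast
  define h where "h G = {(b G x, b G y, b G (x \<otimes>\<^bsub>G\<^esub> y)) | x y. x \<in> carrier G \<and> y \<in> carrier G}" for G
  show ?thesis
  proof (rule finite_classes[where h = h])
    show "H \<cong> G" if "G \<in> ?X" "H \<in> ?X" "G \<cong> H" for G H using that group.iso_sym by blast
    show "G \<cong> K" if "G \<in> ?X" "H \<in> ?X" "K \<in> ?X" "G \<cong> H" "H \<cong> K" for G H K using that iso_trans by blast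
    have "h G \<subseteq> {..<n} \<times> {..<n} \<times> {..<n}" if G: "G \<in> ?X" for G
    proof -
      interpret G: group G using G by simp
      show ?thesis unfolding h_def using bij_betwE[OF b[OF G]] by auto
    qed
    then have "h ` ?X \<subseteq> Pow ({..<n} \<times> {..<n} \<times> {..<n})" by blast
    then show "finite (h ` ?X)" by (rule finite_subset) simp
  next
    fix G H assume G: "G \<in> ?X" and H: "H \<in> ?X" and eq: "h G = h H"
    define \<alpha> where "\<alpha> = inv_into (carrier H) (b H) \<circ> b G"
    have bij: "bij_betw \<alpha> (carrier G) (carrier H)"
      unfolding \<alpha>_def by (rule bij_betw_trans[OF b[OF G] bij_betw_inv_into[OF b[OF H]]])
    have "\<alpha> (x \<otimes>\<^bsub>G\<^esub> y) = \<alpha> x \<otimes>\<^bsub>H\<^esub> \<alpha> y" if "x \<in> carrier G" "y \<in> carrier G" for x y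
    proof -
      interpret H: group H using H by simp
      have "(b G x, b G y, b G (x \<otimes>\<^bsub>G\<^esub> y)) \<in> h H"
        unfolding eq[symmetric] unfolding h_def using that by blast
      then obtain x' y' where "x' \<in> carrier H" "y' \<in> carrier H" "b G x = b H x'" "b G y = b H y'"
        "b G (x \<otimes>\<^bsub>G\<^esub> y) = b H (x' \<otimes>\<^bsub>H\<^esub> y')" unfolding h_def by blast
      then show ?thesis using bij_betw_inv_into_left[OF b[OF H]] by (simp add: \<alpha>_def)
    qed
    then have "\<alpha> \<in> iso G H" using bij by (auto simp: iso_def hom_def bij_betw_def)
    then show "G \<cong> H" by (rule is_isoI)
  qed
qed

lemma digraph_iso_with_proj_sym:
  assumes "digraph_iso (with_proj \<Gamma>) (with_proj \<Delta>)"
    and "parcs \<Gamma> \<subseteq> pverts \<Gamma> \<times> pverts \<Gamma>" "parcs \<Delta> \<subseteq> pverts \<Delta> \<times> pverts \<Delta>"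
  shows "digraph_iso (with_proj \<Delta>) (with_proj \<Gamma>)"
proof -
  obtain h where h: "bij_betw h (pverts \<Gamma>) (pverts \<Delta>)"
    and arcs: "\<And>u v. u \<in> pverts \<Gamma> \<Longrightarrow> v \<in> pverts \<Gamma> \<Longrightarrow> (h u, h v) \<in> parcs \<Delta> \<longleftrightarrow> (u, v) \<in> parcs \<Gamma>"
    using digraph_iso_with_projD[OF assms(1)] by blast
  let ?h = "inv_into (pverts \<Gamma>) h"
  note h' = bij_betw_inv_into[OF h]
  show ?thesis
  proof (rule digraph_iso_with_projI[OF h' _ assms(3,2)])
    fix u v assume "u \<in> pverts \<Delta>" "v \<in> pverts \<Delta>"
    then show "(?h u, ?h v) \<in> parcs \<Gamma> \<longleftrightarrow> (u, v) \<in> parcs \<Delta>"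
      using arcs[of "?h u" "?h v"] bij_betwE[OF h'] bij_betw_inv_into_right[OF h] by simp
  qed
qed

lemma digraph_iso_with_proj_trans:
  assumes "digraph_iso (with_proj \<Gamma>) (with_proj \<Delta>)" "digraph_iso (with_proj \<Delta>) (with_proj \<Theta>)"
    and "parcs \<Gamma> \<subseteq> pverts \<Gamma> \<times> pverts \<Gamma>" "parcs \<Theta> \<subseteq> pverts \<Theta> \<times> pverts \<Theta>"
  shows "digraph_iso (with_proj \<Gamma>) (with_proj \<Theta>)"
proof -
  obtain h where h: "bij_betw h (pverts \<Gamma>) (pverts \<Delta>)"
    and arcs: "\<And>u v. u \<in> pverts \<Gamma> \<Longrightarrow> v \<in> pverts \<Gamma> \<Longrightarrow> (h u, h v) \<in> parcs \<Delta> \<longleftrightarrow> (u, v) \<in> parcs \<Gamma>"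
    using digraph_iso_with_projD[OF assms(1)] by blast
  obtain k where k: "bij_betw k (pverts \<Delta>) (pverts \<Theta>)"
    and arcs': "\<And>u v. u \<in> pverts \<Delta> \<Longrightarrow> v \<in> pverts \<Delta> \<Longrightarrow> (k u, k v) \<in> parcs \<Theta> \<longleftrightarrow> (u, v) \<in> parcs \<Delta>"
    using digraph_iso_with_projD[OF assms(2)] by blast
  show ?thesis
    by (rule digraph_iso_with_projI[OF bij_betw_trans[OF h k] _ assms(3,4)])
      (use arcs arcs' bij_betwE[OF h] in simp)
qed

lemma finite_graph_classes:
  fixes X :: "'a pair_pre_digraph set"
  assumes X: "\<And>\<Gamma>. \<Gamma> \<in> X \<Longrightarrow> finite (pverts \<Gamma>) \<and> card (pverts \<Gamma>) = n \<and> parcs \<Gamma> \<subseteq> pverts \<Gamma> \<times> pverts \<Gamma>"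
  shows "finite (X // {(\<Gamma>, \<Delta>). \<Gamma> \<in> X \<and> \<Delta> \<in> X \<and> digraph_iso (with_proj \<Gamma>) (with_proj \<Delta>)})"
proof -
  have "\<exists>b. bij_betw b (pverts \<Gamma>) {..<n}" if "\<Gamma> \<in> X" for \<Gamma>
    using X[OF that] finite_same_card_bij[of "pverts \<Gamma>" "{..<n}"] by simp
  then have "\<exists>b. \<forall>\<Gamma>\<in>X. bij_betw (b \<Gamma>) (pverts \<Gamma>) {..<n}" by (intro bchoice ballI)
  then obtain b where b: "\<And>\<Gamma>. \<Gamma> \<in> X \<Longrightarrow> bij_betw (b \<Gamma>) (pverts \<Gamma>) {..<n}" by blast
  \<comment> \<open>The adjacency relation after numbering the vertices plays the part of the
    multiplication table.\<close>
  define h where "h \<Gamma> = {(b \<Gamma> u, b \<Gamma> v) | u v. (u, v) \<in> parcs \<Gamma>}" for \<Gamma>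
  show ?thesis
  proof (rule finite_classes[where h = h])
    show "digraph_iso (with_proj \<Delta>) (with_proj \<Gamma>)"
      if "\<Gamma> \<in> X" "\<Delta> \<in> X" "digraph_iso (with_proj \<Gamma>) (with_proj \<Delta>)" for \<Gamma> \<Delta>
      using that X digraph_iso_with_proj_sym by blast
    show "digraph_iso (with_proj \<Gamma>) (with_proj \<Theta>)"
      if "\<Gamma> \<in> X" "\<Delta> \<in> X" "\<Theta> \<in> X" "digraph_iso (with_proj \<Gamma>) (with_proj \<Delta>)"
        "digraph_iso (with_proj \<Delta>) (with_proj \<Theta>)" for \<Gamma> \<Delta> \<Theta>
      using that X digraph_iso_with_proj_trans by blast
    have "h \<Gamma> \<subseteq> {..<n} \<times> {..<n}" if "\<Gamma> \<in> X" for \<Gamma>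
      unfolding h_def using bij_betwE[OF b[OF that]] X[OF that] by blast
    then have "h ` X \<subseteq> Pow ({..<n} \<times> {..<n})" by blast
    then show "finite (h ` X)" by (rule finite_subset) simp
  next
    fix \<Gamma> \<Delta> assume G: "\<Gamma> \<in> X" and D: "\<Delta> \<in> X" and eq: "h \<Gamma> = h \<Delta>"
    have inv: "(b \<Gamma> u, b \<Gamma> v) \<in> h \<Gamma> \<longleftrightarrow> (u, v) \<in> parcs \<Gamma>"
      if "\<Gamma> \<in> X" "u \<in> pverts \<Gamma>" "v \<in> pverts \<Gamma>" for \<Gamma> u v
    proof -
      have *: "x = y" if "x \<in> pverts \<Gamma>" "y \<in> pverts \<Gamma>" "b \<Gamma> x = b \<Gamma> y" for x y
        using b[OF \<open>\<Gamma> \<in> X\<close>] that by (auto simp: bij_betw_def dest: inj_onD)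
      show ?thesis
      proof
        assume "(b \<Gamma> u, b \<Gamma> v) \<in> h \<Gamma>"
        then obtain u' v' where e: "(u', v') \<in> parcs \<Gamma>" "b \<Gamma> u = b \<Gamma> u'" "b \<Gamma> v = b \<Gamma> v'"
          unfolding h_def by blast
        then have "u' \<in> pverts \<Gamma>" "v' \<in> pverts \<Gamma>" using X[OF that(1)] by auto
        then show "(u, v) \<in> parcs \<Gamma>" using e * that by metis
      qed (auto simp: h_def)
    qed
    let ?\<alpha> = "inv_into (pverts \<Delta>) (b \<Delta>) \<circ> b \<Gamma>"
    have bij: "bij_betw ?\<alpha> (pverts \<Gamma>) (pverts \<Delta>)"
      by (rule bij_betw_trans[OF b[OF G] bij_betw_inv_into[OF b[OF D]]])
    have \<alpha>: "b \<Delta> (?\<alpha> u) = b \<Gamma> u" if "u \<in> pverts \<Gamma>" for u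
      using bij_betw_inv_into_right[OF b[OF D]] bij_betwE[OF b[OF G]] that by simp
    show "digraph_iso (with_proj \<Gamma>) (with_proj \<Delta>)"
    proof (rule digraph_iso_with_projI[OF bij])
      fix u v assume uv: "u \<in> pverts \<Gamma>" "v \<in> pverts \<Gamma>"
      have "(?\<alpha> u, ?\<alpha> v) \<in> parcs \<Delta> \<longleftrightarrow> (b \<Gamma> u, b \<Gamma> v) \<in> h \<Delta>"
        using inv[OF D, of "?\<alpha> u" "?\<alpha> v"] bij_betwE[OF bij] \<alpha> uv by metis
      then show "(?\<alpha> u, ?\<alpha> v) \<in> parcs \<Delta> \<longleftrightarrow> (u, v) \<in> parcs \<Gamma>"
        using inv[OF G uv] eq by simp
    qed (use X G D in auto)
  qed
qed

text \<open>Since all members share the set \<open>S\<close>, its elements label the generators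
  uniformly. A member isomorphic to \<open>K\<close> is then recovered from a map from
  \<open>S\<close> to \<open>K\<close>, which leaves at most \<open>2 ^ (m * d)\<close> members per
  class. A graph remembers its generating set, so there each class contains at most one
  member.\<close>

lemma rigid_family_bounds:
  fixes H :: "'f \<Rightarrow> nat monoid"
  assumes F: "finite F" and G: "\<And>f. f \<in> F \<Longrightarrow> group (H f)"
    and C: "\<And>f. f \<in> F \<Longrightarrow> carrier (H f) = C" "card C = 2 ^ m"
    and S: "\<And>f. f \<in> F \<Longrightarrow> involution_generating_set (H f) d S"
    and rigid: "\<And>f f' \<alpha>. f \<in> F \<Longrightarrow> f' \<in> F \<Longrightarrow> \<alpha> \<in> iso (H f) (H f') \<Longrightarrow> \<alpha> ` S = S \<Longrightarrow>
      f = f' \<and> (\<forall>x\<in>S. \<alpha> x = x)"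
  shows "card F \<le> num_involution_generated_groups d m * 2 ^ (m * d)"
    and "card F \<le> num_involution_Cayley_graphs d m"
proof -
  have SC: "S \<subseteq> C" "finite S" "card S = d" if "f \<in> F" for f
    using S[OF that] C(1)[OF that] by (auto simp: involution_generating_set_def involution_def)
  have ord: "order (H f) = 2 ^ m" if "f \<in> F" for f using C that by (simp add: order_def)
  show "card F \<le> num_involution_generated_groups d m * 2 ^ (m * d)"
    unfolding num_involution_generated_groups_def
  proof (rule card_le_num_classes[OF finite_group_classes F, where g = H])
    fix f assume "f \<in> F"
    then show "H f \<in> {G. group G \<and> order G = 2 ^ m \<and> (\<exists>S. involution_generating_set G d S)} \<and> H f \<cong> H f"
      using G S ord iso_refl by auto
  next
    fix K :: "nat monoid"
    assume "K \<in> {G. group G \<and> order G = 2 ^ m \<and> (\<exists>S. involution_generating_set G d S)}"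
    then have K: "group K" "card (carrier K) = 2 ^ m" by (auto simp: order_def)
    let ?F = "{f \<in> F. K \<cong> H f}"
    define a where "a f = (SOME a. a \<in> iso K (H f))" for f
    have a: "a f \<in> iso K (H f)" if "f \<in> ?F" for f
    proof -
      have "\<exists>a. a \<in> iso K (H f)" using that unfolding is_iso_def by blast
      then show ?thesis unfolding a_def by (rule someI_ex)
    qed
    \<comment> \<open>The generators of \<open>H f\<close> pulled back to \<open>K\<close>. If two
      members give the same pull-back, the composite isomorphism between them fixes \<open>S\<close>
      pointwise and \<open>rigid\<close> identifies them.\<close>
    define \<tau> where "\<tau> f = (\<lambda>s\<in>S. inv_into (carrier K) (a f) s)" for f
    have finK: "finite (carrier K)" using K(2) by (intro card_ge_0_finite) simp
    have img: "\<tau> f \<in> S \<rightarrow>\<^sub>E carrier K" if f: "f \<in> ?F" for f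
    proof -
      have "a f ` carrier K = C" using a[OF f] f C by (auto simp: iso_def bij_betw_def)
      then show ?thesis using SC[of f] f by (auto simp: \<tau>_def intro!: inv_into_into)
    qed
    have inj: "inj_on \<tau> ?F"
    proof (rule inj_onI)
      fix f f' assume f: "f \<in> ?F" and f': "f' \<in> ?F" and eq: "\<tau> f = \<tau> f'"
      let ?b = "inv_into (carrier K) (a f)"
      have \<gamma>: "a f' \<circ> ?b \<in> iso (H f) (H f')"
        using group.iso_set_sym[OF K(1) a[OF f]] a[OF f'] iso_set_trans by blast
      have "(a f' \<circ> ?b) s = s" if s: "s \<in> S" for s
      proof -
        have "?b s = inv_into (carrier K) (a f') s" using fun_cong[OF eq, of s] s by (simp add: \<tau>_def)
        moreover have "s \<in> a f' ` carrier K" using a[OF f'] f' C SC[of f'] s by (auto simp: iso_def bij_betw_def)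
        ultimately show ?thesis by (simp add: f_inv_into_f)
      qed
      then have "(a f' \<circ> ?b) ` S = S" by force
      then show "f = f'" using rigid[OF _ _ \<gamma>] f f' by blast
    qed
    show "card ?F \<le> 2 ^ (m * d)"
    proof (cases "?F = {}")
      case False
      then have "finite S" "card S = d" using SC by auto
      have "card ?F = card (\<tau> ` ?F)" using inj by (simp add: card_image)
      also have "\<dots> \<le> card (S \<rightarrow>\<^sub>E carrier K)"
        using img \<open>finite S\<close> finK by (intro card_mono finite_PiE) auto
      also have "\<dots> = 2 ^ (m * d)" using \<open>finite S\<close> \<open>card S = d\<close> K(2) by (simp add: card_PiE power_mult)
      finally show ?thesis .
    qed (simp only: card.empty)
  qed simp
  have "card F \<le> num_involution_Cayley_graphs d m * 1"
    unfolding num_involution_Cayley_graphs_def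
  proof (rule card_le_num_classes[OF _ F, where g = "\<lambda>f. Cay (H f) S"])
    let ?X = "{\<Gamma> :: nat pair_pre_digraph. \<exists>(G :: nat monoid) S.
          group G \<and> order G = 2 ^ m \<and> involution_generating_set G d S \<and> \<Gamma> = Cay G S \<and>
          normalizer (Aut \<Gamma>) (right_regular G) = right_regular G}"
    have arcs: "parcs (Cay G S) \<subseteq> pverts (Cay G S) \<times> pverts (Cay G S)" for G :: "nat monoid" and S
      by (auto simp: parcs_Cay)
    have "finite (carrier G)" if "order G = 2 ^ m" for G :: "nat monoid"
      using that by (intro card_ge_0_finite) (simp add: order_def)
    then show "finite (?X // {(\<Gamma>, \<Delta>). \<Gamma> \<in> ?X \<and> \<Delta> \<in> ?X \<and> digraph_iso (with_proj \<Gamma>) (with_proj \<Delta>)})"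
      using arcs by (intro finite_graph_classes[where n = "2 ^ m"]) (fastforce simp: order_def)
    have norm: "normalizer (Aut (Cay (H f) S)) (right_regular (H f)) = right_regular (H f)" if f: "f \<in> F" for f
      by (rule normalizer_right_regular[OF G[OF f]])
        (use rigid[OF f f] S[OF f] SC[OF f] C(1)[OF f] in \<open>auto simp: involution_generating_set_def\<close>)
    show "Cay (H f) S \<in> ?X \<and> digraph_iso (with_proj (Cay (H f) S)) (with_proj (Cay (H f) S))"
      if f: "f \<in> F" for f
      using G[OF f] ord[OF f] S[OF f] norm[OF f] digraph_iso_with_projI[of "\<lambda>x. x" "Cay (H f) S" "Cay (H f) S"] arcs
      by (auto simp: bij_betw_def)
    fix \<Gamma> assume "\<Gamma> \<in> ?X"
    then have \<Gamma>: "parcs \<Gamma> \<subseteq> pverts \<Gamma> \<times> pverts \<Gamma>" using arcs by blast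
    have "f = f'" if f: "f \<in> F" "digraph_iso (with_proj \<Gamma>) (with_proj (Cay (H f) S))"
      and f': "f' \<in> F" "digraph_iso (with_proj \<Gamma>) (with_proj (Cay (H f') S))" for f f'
    proof -
      have "digraph_iso (with_proj (Cay (H f) S)) (with_proj (Cay (H f') S))"
        by (rule digraph_iso_with_proj_trans[OF digraph_iso_with_proj_sym[OF f(2) \<Gamma> arcs] f'(2) arcs arcs])
      moreover have "S \<subseteq> carrier (H f)" "S \<subseteq> carrier (H f')" using SC(1)[OF f(1)] C(1) f(1) f'(1) by auto
      ultimately obtain \<alpha> where "\<alpha> \<in> iso (H f) (H f')" "\<alpha> ` S = S"
        using Cay_iso_imp_group_iso[OF two_is_prime_nat G[OF f(1)] ord[OF f(1)] _ G[OF f'(1)] ord[OF f'(1)] _ norm[OF f'(1)]]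
        by metis
      then show ?thesis using rigid f f' by blast
    qed
    then have "\<exists>g. {f \<in> F. digraph_iso (with_proj \<Gamma>) (with_proj (Cay (H f) S))} \<subseteq> {g}" by blast
    then obtain g where "{f \<in> F. digraph_iso (with_proj \<Gamma>) (with_proj (Cay (H f) S))} \<subseteq> {g}" ..
    then have "card {f \<in> F. digraph_iso (with_proj \<Gamma>) (with_proj (Cay (H f) S))} \<le> card {g}"
      by (intro card_mono) auto
    then show "card {f \<in> F. digraph_iso (with_proj \<Gamma>) (with_proj (Cay (H f) S))} \<le> 1" by simp
  qed
  then show "card F \<le> num_involution_Cayley_graphs d m" by simp
qed

text \<open>The counting functions speak of groups on natural numbers, whereas the groups
  constructed below live on a product type. A single numbering of the common carrier transports the
  whole family, so the copies again share carrier and generating set.\<close>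

lemma rigid_family_bounds':
  fixes H :: "'f \<Rightarrow> 'a monoid"
  assumes F: "finite F" and G: "\<And>f. f \<in> F \<Longrightarrow> group (H f)"
    and C: "\<And>f. f \<in> F \<Longrightarrow> carrier (H f) = C" "card C = 2 ^ m"
    and S: "\<And>f. f \<in> F \<Longrightarrow> involution_generating_set (H f) d S"
    and rigid: "\<And>f f' \<alpha>. f \<in> F \<Longrightarrow> f' \<in> F \<Longrightarrow> \<alpha> \<in> iso (H f) (H f') \<Longrightarrow> \<alpha> ` S = S \<Longrightarrow>
      f = f' \<and> (\<forall>x\<in>S. \<alpha> x = x)"
  shows "card F \<le> num_involution_generated_groups d m * 2 ^ (m * d)"
    and "card F \<le> num_involution_Cayley_graphs d m"
proof -
  have finC: "finite C" using C(2) by (intro card_ge_0_finite) simp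
  obtain i where i: "bij_betw i C {..<(2::nat) ^ m}"
    using finite_same_card_bij[OF finC, of "{..<(2::nat) ^ m}"] C(2) by auto
  define j where "j = inv_into C i"
  have ij: "i x \<in> {..<2 ^ m}" "j (i x) = x" if "x \<in> C" for x
    using bij_betwE[OF i] bij_betw_inv_into_left[OF i] that by (auto simp: j_def)
  define H' where "H' f = \<lparr>carrier = {..<(2::nat) ^ m}, 
    monoid.mult = \<lambda>x y. i (j x \<otimes>\<^bsub>H f\<^esub> j y), one = i \<one>\<^bsub>H f\<^esub>\<rparr>" for f
  have iso: "i \<in> iso (H f) (H' f)" if f: "f \<in> F" for f
    using i ij C(1)[OF f] by (auto simp: iso_def hom_def H'_def)
  have G': "group (H' f)" if f: "f \<in> F" for f
    using group.iso_imp_img_group[OF G[OF f] iso[OF f]] by (simp add: H'_def)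
  have hom: "group_hom (H f) (H' f) i" if f: "f \<in> F" for f
    using G[OF f] G'[OF f] iso[OF f] by (simp add: group_hom_def group_hom_axioms_def iso_def)
  have SC: "S \<subseteq> C" if "f \<in> F" for f
    using S[OF that] C(1)[OF that] by (auto simp: involution_generating_set_def involution_def)
  have inj: "inj_on i C" using i by (simp add: bij_betw_def)
  have carH': "carrier (H' f) = i ` C" for f
    using bij_betw_imp_surj_on[OF i] by (simp add: H'_def)
  have S': "involution_generating_set (H' f) d (i ` S)" if f: "f \<in> F" for f
    unfolding involution_generating_set_def
  proof (intro conjI ballI)
    interpret i: group_hom "H f" "H' f" i by (rule hom[OF f])
    have S: "finite S" "card S = d" "\<And>x. x \<in> S \<Longrightarrow> involution (H f) x" "generate (H f) S = carrier (H f)"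
      using S[OF f] by (auto simp: involution_generating_set_def)
    show "finite (i ` S)" using S by simp
    show "card (i ` S) = d" using S inj SC[OF f] by (metis card_image inj_on_subset)
    have "generate (H' f) (i ` S) = i ` C"
      using i.generate_img[of S] SC[OF f] unfolding S(4) C(1)[OF f] by simp
    then show "generate (H' f) (i ` S) = carrier (H' f)" unfolding carH' .
    fix y assume "y \<in> i ` S"
    then obtain x where x: "x \<in> S" "y = i x" by blast
    have xG: "x \<in> carrier (H f)" and xx: "x \<otimes>\<^bsub>H f\<^esub> x = \<one>\<^bsub>H f\<^esub>" and x1: "x \<noteq> \<one>\<^bsub>H f\<^esub>"
      using S(3)[OF x(1)] unfolding involution_def by blast+
    have "i x \<otimes>\<^bsub>H' f\<^esub> i x = \<one>\<^bsub>H' f\<^esub>"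
      using i.hom_mult[OF xG xG] i.hom_one unfolding xx by metis
    moreover have "i x \<noteq> \<one>\<^bsub>H' f\<^esub>"
      using inj_onD[OF inj, of x "\<one>\<^bsub>H f\<^esub>"] i.hom_one i.G.one_closed xG x1
      unfolding C(1)[OF f] by metis
    ultimately show "involution (H' f) y"
      unfolding involution_def x(2) using i.hom_closed[OF xG] by blast
  qed
  have "f = f' \<and> (\<forall>x\<in>i ` S. \<alpha> x = x)"
    if f: "f \<in> F" "f' \<in> F" and \<alpha>: "\<alpha> \<in> iso (H' f) (H' f')" "\<alpha> ` i ` S = i ` S" for f f' \<alpha>
  proof -
    have j: "j \<in> iso (H' f') (H f')"
      using group.iso_set_sym[OF G[OF f(2)] iso[OF f(2)]] C(1)[OF f(2)] by (simp add: j_def)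
    have "j \<circ> (\<alpha> \<circ> i) \<in> iso (H f) (H f')"
      using iso_set_trans[OF iso_set_trans[OF iso[OF f(1)] \<alpha>(1)] j] .
    moreover have "j ` i ` S = S" using SC[OF f(1)] ij by force
    then have "(j \<circ> (\<alpha> \<circ> i)) ` S = S" using \<alpha>(2) by (metis image_comp)
    ultimately have "f = f' \<and> (\<forall>x\<in>S. (j \<circ> (\<alpha> \<circ> i)) x = x)" by (rule rigid[OF f])
    then have *: "f = f'" "\<And>x. x \<in> S \<Longrightarrow> j (\<alpha> (i x)) = x" by auto
    have "\<alpha> (i x) = i x" if "x \<in> S" for x
    proof -
      have "\<alpha> (i x) \<in> i ` S" using that \<alpha>(2) by blast
      then obtain y where "y \<in> S" "\<alpha> (i x) = i y" by blast
      then show ?thesis using *(2)[OF that] ij(2)[of y] SC[OF f(1)] by auto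
    qed
    then show ?thesis using *(1) by blast
  qed
  note rigid' = this
  have C': "carrier (H' f) = {..<2 ^ m}" for f by (simp add: H'_def)
  note bounds = rigid_family_bounds[OF F G' C' card_lessThan S' rigid']
  show "card F \<le> num_involution_generated_groups d m * 2 ^ (m * d)" by (rule bounds(1))
  show "card F \<le> num_involution_Cayley_graphs d m" by (rule bounds(2))
qed

section \<open>Dihedral extensions of groups of class two\<close>

definition semidirect ::
    "('a, 'c) monoid_scheme \<Rightarrow> ('b, 'd) monoid_scheme \<Rightarrow> ('b \<Rightarrow> 'a \<Rightarrow> 'a) \<Rightarrow> ('a \<times> 'b) monoid" where
  "semidirect H Q \<theta> = \<lparr>carrier = carrier H \<times> carrier Q,
     monoid.mult = \<lambda>(x, p) (y, q). (x \<otimes>\<^bsub>H\<^esub> \<theta> p y, p \<otimes>\<^bsub>Q\<^esub> q), one = (\<one>\<^bsub>H\<^esub>, \<one>\<^bsub>Q\<^esub>)\<rparr>"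

lemma semidirect_simps [simp]:
  "carrier (semidirect H Q \<theta>) = carrier H \<times> carrier Q"
  "(x, p) \<otimes>\<^bsub>semidirect H Q \<theta>\<^esub> (y, q) = (x \<otimes>\<^bsub>H\<^esub> \<theta> p y, p \<otimes>\<^bsub>Q\<^esub> q)"
  "\<one>\<^bsub>semidirect H Q \<theta>\<^esub> = (\<one>\<^bsub>H\<^esub>, \<one>\<^bsub>Q\<^esub>)"
  by (simp_all add: semidirect_def)

lemma group_semidirect:
  assumes "group H" "group Q"
    and \<theta>: "\<And>p. p \<in> carrier Q \<Longrightarrow> \<theta> p \<in> hom H H"
    and one: "\<And>x. x \<in> carrier H \<Longrightarrow> \<theta> \<one>\<^bsub>Q\<^esub> x = x"
    and mult: "\<And>p q x. p \<in> carrier Q \<Longrightarrow> q \<in> carrier Q \<Longrightarrow> x \<in> carrier H \<Longrightarrow> \<theta> (p \<otimes>\<^bsub>Q\<^esub> q) x = \<theta> p (\<theta> q x)"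
  shows "group (semidirect H Q \<theta>)"
proof -
  interpret H: group H by fact
  interpret Q: group Q by fact
  have cl: "\<theta> p x \<in> carrier H" if "p \<in> carrier Q" "x \<in> carrier H" for p x
    using \<theta>[OF that(1)] that(2) by (auto simp: hom_def)
  have hm: "\<theta> p (x \<otimes>\<^bsub>H\<^esub> y) = \<theta> p x \<otimes>\<^bsub>H\<^esub> \<theta> p y" if "p \<in> carrier Q" "x \<in> carrier H" "y \<in> carrier H" for p x y
    using \<theta>[OF that(1)] that(2,3) by (auto simp: hom_def)
  show ?thesis
  proof (rule groupI)
    fix g assume "g \<in> carrier (semidirect H Q \<theta>)"
    then obtain x p where g: "g = (x, p)" "x \<in> carrier H" "p \<in> carrier Q" by auto
    have "\<theta> (inv\<^bsub>Q\<^esub> p) (inv\<^bsub>H\<^esub> x) \<otimes>\<^bsub>H\<^esub> \<theta> (inv\<^bsub>Q\<^esub> p) x = \<theta> (inv\<^bsub>Q\<^esub> p) (inv\<^bsub>H\<^esub> x \<otimes>\<^bsub>H\<^esub> x)"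
      using g by (intro hm[symmetric]) auto
    also have "\<dots> = \<one>\<^bsub>H\<^esub>"
      using group_hom.hom_one[of H H "\<theta> (inv\<^bsub>Q\<^esub> p)"] g \<theta>
      by (simp add: group_hom_def group_hom_axioms_def H.is_group)
    finally have "(\<theta> (inv\<^bsub>Q\<^esub> p) (inv\<^bsub>H\<^esub> x), inv\<^bsub>Q\<^esub> p) \<otimes>\<^bsub>semidirect H Q \<theta>\<^esub> g = \<one>\<^bsub>semidirect H Q \<theta>\<^esub>"
      using g by simp
    moreover have "(\<theta> (inv\<^bsub>Q\<^esub> p) (inv\<^bsub>H\<^esub> x), inv\<^bsub>Q\<^esub> p) \<in> carrier (semidirect H Q \<theta>)"
      using g cl by simp
    ultimately show "\<exists>h\<in>carrier (semidirect H Q \<theta>). h \<otimes>\<^bsub>semidirect H Q \<theta>\<^esub> g = \<one>\<^bsub>semidirect H Q \<theta>\<^esub>" by blast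
  qed (auto simp: cl hm one mult H.m_assoc Q.m_assoc)
qed

text \<open>
  \<open>E\<close> is the central extension of \<open>X \<times> X\<close> by \<open>V\<close> in which \<open>\<phi>\<close> pairs the two copies of \<open>X\<close> with each other
  and \<open>\<psi>\<close> pairs each copy with itself. The correction term in \<open>swap\<close> comes from
  reordering the two factors of \<open>(0, b, b') = (0, b, 0) (0, 0, b')\<close> after they have been exchanged.
\<close>

locale twisted_group =
  fixes X :: "'x::ab_group_add set" and V :: "'v::ab_group_add set"
    and \<phi> \<psi> :: "'x \<Rightarrow> 'x \<Rightarrow> 'v" and T :: "int \<Rightarrow> 'x \<Rightarrow> 'x" and N :: nat
  assumes two_x: "\<And>x::'x. x + x = 0" and two_v: "\<And>v::'v. v + v = 0"
    and X0 [simp]: "0 \<in> X" and X_add [simp]: "\<And>x y. x \<in> X \<Longrightarrow> y \<in> X \<Longrightarrow> x + y \<in> X"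
    and V0 [simp]: "0 \<in> V" and V_add [simp]: "\<And>x y. x \<in> V \<Longrightarrow> y \<in> V \<Longrightarrow> x + y \<in> V"
    and \<phi>_cl [simp]: "\<And>x y. x \<in> X \<Longrightarrow> y \<in> X \<Longrightarrow> \<phi> x y \<in> V"
    and \<psi>_cl [simp]: "\<And>x y. x \<in> X \<Longrightarrow> y \<in> X \<Longrightarrow> \<psi> x y \<in> V"
    and \<phi>_sym: "\<And>x y. x \<in> X \<Longrightarrow> y \<in> X \<Longrightarrow> \<phi> x y = \<phi> y x"
    and \<phi>_add: "\<And>x y z. x \<in> X \<Longrightarrow> y \<in> X \<Longrightarrow> z \<in> X \<Longrightarrow> \<phi> (x + y) z = \<phi> x z + \<phi> y z"
    and \<psi>_add: "\<And>x y z. x \<in> X \<Longrightarrow> y \<in> X \<Longrightarrow> z \<in> X \<Longrightarrow> \<psi> (x + y) z = \<psi> x z + \<psi> y z"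
    and \<psi>_add2: "\<And>x y z. x \<in> X \<Longrightarrow> y \<in> X \<Longrightarrow> z \<in> X \<Longrightarrow> \<psi> z (x + y) = \<psi> z x + \<psi> z y"
    and T_cl [simp]: "\<And>r x. x \<in> X \<Longrightarrow> T r x \<in> X"
    and T_add: "\<And>r x y. x \<in> X \<Longrightarrow> y \<in> X \<Longrightarrow> T r (x + y) = T r x + T r y"
    and T_0 [simp]: "\<And>x. x \<in> X \<Longrightarrow> T 0 x = x"
    and T_T [simp]: "\<And>r q x. x \<in> X \<Longrightarrow> T r (T q x) = T (r + q) x"
    and T_mod: "\<And>r q x. x \<in> X \<Longrightarrow> r mod int N = q mod int N \<Longrightarrow> T r x = T q x"
    and \<phi>_T: "\<And>r x y. x \<in> X \<Longrightarrow> y \<in> X \<Longrightarrow> \<phi> (T (- r) x) (T r y) = \<phi> x y"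
    and \<psi>_T: "\<And>r x y. x \<in> X \<Longrightarrow> y \<in> X \<Longrightarrow> \<psi> (T r x) (T r y) = \<psi> x y"
    and N: "N > 8"
begin

text \<open>The term added in the first coordinate is bilinear, hence a cocycle. It contains
  \<open>\<phi> b' c\<close> but not \<open>\<phi> b c'\<close>: with both, the term would be
  symmetric in this part and the two copies of \<open>X\<close> would commute with each
  other.\<close>

definition E :: "('v \<times> 'x \<times> 'x) monoid" where
  "E = \<lparr>carrier = V \<times> X \<times> X, monoid.mult = \<lambda>(v, b, b') (w, c, c').
     (v + w + \<phi> b' c + \<psi> b c + \<psi> b' c', b + c, b' + c'), one = (0, 0, 0)\<rparr>"

definition rot :: "int \<Rightarrow> 'v \<times> 'x \<times> 'x \<Rightarrow> 'v \<times> 'x \<times> 'x" where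
  "rot r = (\<lambda>(v, b, b'). (v, T (- r) b, T r b'))"

definition swap :: "'v \<times> 'x \<times> 'x \<Rightarrow> 'v \<times> 'x \<times> 'x" where
  "swap = (\<lambda>(v, b, b'). (v + \<phi> b b', b', b))"

definition H :: "(('v \<times> 'x \<times> 'x) \<times> int) monoid" where
  "H = semidirect E (integer_mod_group N) rot"

definition reflect :: "int \<Rightarrow> ('v \<times> 'x \<times> 'x) \<times> int \<Rightarrow> ('v \<times> 'x \<times> 'x) \<times> int" where
  "reflect k = (\<lambda>(y, r). if k = 0 then (y, r) else (swap y, (- r) mod int N))"

text \<open>The semidirect product of \<open>E\<close> with the dihedral group of order
  \<open>2 * N\<close>, assembled from one cyclic factor at a time.\<close>

definition G :: "((('v \<times> 'x \<times> 'x) \<times> int) \<times> int) monoid" where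
  "G = semidirect H (integer_mod_group 2) reflect"

definition embed :: "'v \<times> 'x \<times> 'x \<Rightarrow> (('v \<times> 'x \<times> 'x) \<times> int) \<times> int" where
  "embed y = ((y, 0), 0)"

definition gen_s :: "(('v \<times> 'x \<times> 'x) \<times> int) \<times> int" where
  "gen_s = (((0, 0, 0), 0), 1)"

definition gen_t :: "(('v \<times> 'x \<times> 'x) \<times> int) \<times> int" where
  "gen_t = (((0, 0, 0), 1), 0)"

section \<open>Group axioms for the extension and the semidirect products\<close>

lemma E_simps [simp]:
  "carrier E = V \<times> X \<times> X"
  "(v, b, b') \<otimes>\<^bsub>E\<^esub> (w, c, c') = (v + w + \<phi> b' c + \<psi> b c + \<psi> b' c', b + c, b' + c')"
  "\<one>\<^bsub>E\<^esub> = (0, 0, 0)"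
  by (simp_all add: E_def)

lemma \<phi>_add2: "x \<in> X \<Longrightarrow> y \<in> X \<Longrightarrow> z \<in> X \<Longrightarrow> \<phi> z (x + y) = \<phi> z x + \<phi> z y"
  by (metis \<phi>_add \<phi>_sym X_add)

lemma \<phi>_0 [simp]: "x \<in> X \<Longrightarrow> \<phi> 0 x = 0" "x \<in> X \<Longrightarrow> \<phi> x 0 = 0"
  using \<phi>_add[of 0 0 x] \<phi>_add2[of 0 0 x] by simp_all

lemma \<psi>_0 [simp]: "x \<in> X \<Longrightarrow> \<psi> 0 x = 0" "x \<in> X \<Longrightarrow> \<psi> x 0 = 0"
  using \<psi>_add[of 0 0 x] \<psi>_add2[of 0 0 x] by simp_all

lemma T_zero [simp]: "T r 0 = 0"
  using T_add[of 0 0 r] by simp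

lemma two_v' [simp]: "v + (v + w) = (w::'v)"
  using two_v[of v] by (simp flip: add.assoc)

lemma group_E: "group E"
proof (rule groupI)
  fix y assume "y \<in> carrier E"
  then obtain v b b' where y: "y = (v, b, b')" "v \<in> V" "b \<in> X" "b' \<in> X" by auto
  \<comment> \<open>The witness is \<open>y\<close> times its own square: squares lie in
    \<open>V\<close>, which is central of exponent 2, so the fourth power of \<open>y\<close> is
    trivial.\<close>
  have "(v + \<phi> b' b + \<psi> b b + \<psi> b' b', b, b') \<otimes>\<^bsub>E\<^esub> y = \<one>\<^bsub>E\<^esub>"
    using y by (simp add: two_x two_v add_ac)
  moreover have "(v + \<phi> b' b + \<psi> b b + \<psi> b' b', b, b') \<in> carrier E" using y by simp
  ultimately show "\<exists>z\<in>carrier E. z \<otimes>\<^bsub>E\<^esub> y = \<one>\<^bsub>E\<^esub>" by blast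
next
  fix y z w assume "y \<in> carrier E" "z \<in> carrier E" "w \<in> carrier E"
  then show "y \<otimes>\<^bsub>E\<^esub> z \<otimes>\<^bsub>E\<^esub> w = y \<otimes>\<^bsub>E\<^esub> (z \<otimes>\<^bsub>E\<^esub> w)"
    by (cases y; cases z; cases w) (simp add: \<phi>_add \<phi>_add2 \<psi>_add \<psi>_add2 add_ac)
qed auto

lemma rot_simps [simp]: "rot r (v, b, b') = (v, T (- r) b, T r b')"
  by (simp add: rot_def)

lemma swap_simps [simp]: "swap (v, b, b') = (v + \<phi> b b', b', b)"
  by (simp add: swap_def)

lemma rot_closed [simp]: "y \<in> carrier E \<Longrightarrow> rot r y \<in> carrier E"
  by auto

lemma swap_closed [simp]: "y \<in> carrier E \<Longrightarrow> swap y \<in> carrier E"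
  by auto

lemma rot_mod: "y \<in> carrier E \<Longrightarrow> r mod int N = q mod int N \<Longrightarrow> rot r y = rot q y"
proof -
  assume y: "y \<in> carrier E" and eq: "r mod int N = q mod int N"
  obtain v b b' where [simp]: "y = (v, b, b')" by (cases y)
  have "- r mod int N = - q mod int N" using eq by (metis mod_minus_cong)
  then have "T (- r) b = T (- q) b" "T r b' = T q b'" using y eq by (auto intro: T_mod)
  then show ?thesis by simp
qed

lemma rot_rot [simp]: "y \<in> carrier E \<Longrightarrow> rot r (rot q y) = rot (r + q) y"
  by (auto simp: add_ac)

lemma rot_0 [simp]: "y \<in> carrier E \<Longrightarrow> rot 0 y = y"
  by auto

lemma rot_hom: "rot r \<in> hom E E"
  using \<phi>_T[of _ _ "- r"] \<phi>_T[of _ _ r] by (auto simp: hom_def T_add \<psi>_T \<phi>_sym)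

lemma swap_rot: "y \<in> carrier E \<Longrightarrow> swap (rot r y) = rot (- r) (swap y)"
  by (auto simp: \<phi>_T)

lemma swap_mult: "y \<in> carrier E \<Longrightarrow> z \<in> carrier E \<Longrightarrow> swap (y \<otimes>\<^bsub>E\<^esub> z) = swap y \<otimes>\<^bsub>E\<^esub> swap z"
proof -
  assume "y \<in> carrier E" "z \<in> carrier E"
  then obtain v b b' w c c' where y: "y = (v, b, b')" "v \<in> V" "b \<in> X" "b' \<in> X"
    and z: "z = (w, c, c')" "w \<in> V" "c \<in> X" "c' \<in> X" by auto
  show ?thesis
    using y z \<phi>_sym[of b' c] by (simp add: \<phi>_add \<phi>_add2 add_ac)
qed

lemma group_H: "group H"
  unfolding H_def
proof (rule group_semidirect[OF group_E group_integer_mod_group rot_hom])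
  show "rot \<one>\<^bsub>integer_mod_group N\<^esub> y = y" if "y \<in> carrier E" for y
    using that by simp
  show "rot (p \<otimes>\<^bsub>integer_mod_group N\<^esub> q) y = rot p (rot q y)" if "y \<in> carrier E" for p q y
    using that rot_mod[of y "(p + q) mod int N" "p + q"] by simp
qed

lemma H_simps [simp]:
  "carrier H = (V \<times> X \<times> X) \<times> {0..<int N}"
  "(x, p) \<otimes>\<^bsub>H\<^esub> (y, q) = (x \<otimes>\<^bsub>E\<^esub> rot p y, (p + q) mod int N)"
  "\<one>\<^bsub>H\<^esub> = ((0, 0, 0), 0)"
  using N by (simp_all add: H_def carrier_integer_mod_group)

lemma reflect_hom: "reflect k \<in> hom H H"
proof (cases "k = 0")
  case True
  then show ?thesis using group.is_monoid[OF group_H] by (auto simp: hom_def reflect_def monoid.m_closed simp del: H_simps)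
next
  case False
  have "reflect k (h \<otimes>\<^bsub>H\<^esub> h') = reflect k h \<otimes>\<^bsub>H\<^esub> reflect k h'"
    if "h \<in> carrier H" "h' \<in> carrier H" for h h'
  proof -
    obtain y r z q where h: "h = (y, r)" "h' = (z, q)" by (cases h, cases h')
    then have y: "y \<in> carrier E" "z \<in> carrier E" using that by auto
    have "rot (- r mod int N) (swap z) = rot (- r) (swap z)"
      using y by (intro rot_mod) auto
    moreover have "(- ((r + q) mod int N)) mod int N = (- r mod int N + - q mod int N) mod int N"
      by (simp add: mod_simps)
    ultimately show ?thesis
      using False y unfolding h by (simp add: reflect_def swap_mult swap_rot del: E_simps)
  qed
  moreover have "reflect k h \<in> carrier H" if "h \<in> carrier H" for h
    using that False N by (auto simp: reflect_def)
  ultimately show ?thesis by (auto simp: hom_def simp del: H_simps)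
qed

lemma group_G: "group G"
  unfolding G_def
proof (rule group_semidirect[OF group_H group_integer_mod_group reflect_hom])
  show "reflect \<one>\<^bsub>integer_mod_group 2\<^esub> h = h" for h
    by (auto simp: reflect_def)
  fix p q h assume p: "p \<in> carrier (integer_mod_group 2)" and q: "q \<in> carrier (integer_mod_group 2)"
    and h: "h \<in> carrier H"
  have "p = 0 \<or> p = 1" "q = 0 \<or> q = 1" using p q by (auto simp: carrier_integer_mod_group)
  moreover have "reflect 1 (reflect 1 h) = h" using h by (auto simp: reflect_def \<phi>_sym two_v add.assoc mod_minus_eq)
  ultimately show "reflect (p \<otimes>\<^bsub>integer_mod_group 2\<^esub> q) h = reflect p (reflect q h)"
    by (auto simp: reflect_def)
qed

lemma G_simps [simp]:
  "carrier G = ((V \<times> X \<times> X) \<times> {0..<int N}) \<times> {0..<2}"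
  "(h, p) \<otimes>\<^bsub>G\<^esub> (h', q) = (h \<otimes>\<^bsub>H\<^esub> reflect p h', (p + q) mod 2)"
  "\<one>\<^bsub>G\<^esub> = (((0, 0, 0), 0), 0)"
  using N by (simp_all add: G_def carrier_integer_mod_group)

sublocale G: group G
  by (rule group_G)

lemma reflect_simps [simp]: "reflect 0 h = h" "reflect 1 (y, r) = (swap y, (- r) mod int N)"
  by (auto simp: reflect_def)

lemma embed_closed [simp]: "y \<in> carrier E \<Longrightarrow> embed y \<in> carrier G"
  using N by (auto simp: embed_def)

lemma gen_closed [simp]: "gen_s \<in> carrier G" "gen_t \<in> carrier G"
  using N by (auto simp: gen_s_def gen_t_def)

lemma embed_mult: "z \<in> carrier E \<Longrightarrow> embed y \<otimes>\<^bsub>G\<^esub> embed z = embed (y \<otimes>\<^bsub>E\<^esub> z)"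
  by (simp add: embed_def del: E_simps)

lemma embed_one: "embed (0, 0, 0) = \<one>\<^bsub>G\<^esub>"
  by (simp add: embed_def)

lemma embed_eq_iff [simp]: "embed y = embed z \<longleftrightarrow> y = z"
  by (simp add: embed_def)

lemma gen_t_pow: "gen_t [^]\<^bsub>G\<^esub> (k::nat) = (((0, 0, 0), int k mod int N), 0)"
proof (induction k)
  case (Suc k)
  then show ?case by (simp add: gen_t_def mod_simps add.commute)
qed simp

lemma conj_gen_t:
  assumes "y \<in> carrier E"
  shows "gen_t [^]\<^bsub>G\<^esub> (k::nat) \<otimes>\<^bsub>G\<^esub> embed y \<otimes>\<^bsub>G\<^esub> inv\<^bsub>G\<^esub> (gen_t [^]\<^bsub>G\<^esub> k) = embed (rot (int k) y)"
proof -
  have "rot (int k mod int N) y = rot (int k) y" using assms by (intro rot_mod) auto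
  then have "gen_t [^]\<^bsub>G\<^esub> k \<otimes>\<^bsub>G\<^esub> embed y = embed (rot (int k) y) \<otimes>\<^bsub>G\<^esub> gen_t [^]\<^bsub>G\<^esub> k"
    unfolding gen_t_pow embed_def using rot_closed[OF assms, of "int k"] assms 
    by (auto simp del: rot_closed)
  then show ?thesis using assms rot_closed[OF assms, of "int k"]
    by (simp add: G.m_assoc del: G_simps E_simps)
qed

lemma conj_gen_ts:
  assumes "y \<in> carrier E"
  shows "(gen_t [^]\<^bsub>G\<^esub> (k::nat) \<otimes>\<^bsub>G\<^esub> gen_s) \<otimes>\<^bsub>G\<^esub> embed y \<otimes>\<^bsub>G\<^esub> inv\<^bsub>G\<^esub> (gen_t [^]\<^bsub>G\<^esub> k \<otimes>\<^bsub>G\<^esub> gen_s)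
    = embed (rot (int k) (swap y))"
proof -
  have ss: "gen_s \<otimes>\<^bsub>G\<^esub> (inv\<^bsub>G\<^esub> gen_s \<otimes>\<^bsub>G\<^esub> inv\<^bsub>G\<^esub> (gen_t [^]\<^bsub>G\<^esub> k)) = inv\<^bsub>G\<^esub> (gen_t [^]\<^bsub>G\<^esub> k)"
    by (simp flip: G.m_assoc del: G_simps E_simps)
  have "gen_s \<otimes>\<^bsub>G\<^esub> embed y = embed (swap y) \<otimes>\<^bsub>G\<^esub> gen_s"
    unfolding gen_s_def embed_def using assms by auto
  then have "(gen_t [^]\<^bsub>G\<^esub> k \<otimes>\<^bsub>G\<^esub> gen_s) \<otimes>\<^bsub>G\<^esub> embed y \<otimes>\<^bsub>G\<^esub> inv\<^bsub>G\<^esub> (gen_t [^]\<^bsub>G\<^esub> k \<otimes>\<^bsub>G\<^esub> gen_s)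
    = gen_t [^]\<^bsub>G\<^esub> k \<otimes>\<^bsub>G\<^esub> (embed (swap y) \<otimes>\<^bsub>G\<^esub> gen_s) \<otimes>\<^bsub>G\<^esub> (inv\<^bsub>G\<^esub> gen_s \<otimes>\<^bsub>G\<^esub> inv\<^bsub>G\<^esub> (gen_t [^]\<^bsub>G\<^esub> k))"
    using assms by (simp add: G.m_assoc G.inv_mult_group del: G_simps E_simps)
  also have "\<dots> = embed (rot (int k) (swap y))"
    using swap_closed[OF assms] conj_gen_t[of "swap y" k] ss by (simp add: G.m_assoc del: G_simps E_simps)
  finally show ?thesis .
qed


definition gen_a :: "'x \<Rightarrow> (('v \<times> 'x \<times> 'x) \<times> int) \<times> int" where
  "gen_a x = embed (0, x, 0)"

text \<open>For involutions \<open>x\<close> and \<open>y\<close> this is the commutator of \<open>x\<close> and the conjugate of \<open>y\<close> by \<open>g\<close>.\<close>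

definition word where
  "word x g y = (x \<otimes>\<^bsub>G\<^esub> (g \<otimes>\<^bsub>G\<^esub> y \<otimes>\<^bsub>G\<^esub> inv\<^bsub>G\<^esub> g)) [^]\<^bsub>G\<^esub> (2::nat)"

lemma gen_a_closed [simp]: "x \<in> X \<Longrightarrow> gen_a x \<in> carrier G"
  unfolding gen_a_def by (rule embed_closed) simp

lemma embed_square:
  "(v, b, b') \<in> carrier E \<Longrightarrow>
    embed (v, b, b') [^]\<^bsub>G\<^esub> (2::nat) = embed (\<phi> b' b + \<psi> b b + \<psi> b' b', 0, 0)"
  using embed_mult[of "(v, b, b')" "(v, b, b')"]
  by (simp add: numeral_2_eq_2 two_x two_v del: G_simps)

text \<open>Conjugation by \<open>t^k s\<close> moves \<open>y\<close> into the second copy of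
  \<open>X\<close>, where only \<open>\<phi>\<close> pairs it with \<open>x\<close>. Conjugation by
  \<open>t^k\<close>, as in \<open>word_t\<close>, keeps it in the first copy, and the word then
  shows the symmetrisation of \<open>\<psi>\<close>.\<close>

lemma word_ts:
  assumes "x \<in> X" "y \<in> X" "\<psi> x x = 0" "\<psi> y y = 0"
  shows "word (gen_a x) (gen_t [^]\<^bsub>G\<^esub> (k::nat) \<otimes>\<^bsub>G\<^esub> gen_s) (gen_a y) = embed (\<phi> x (T (int k) y), 0, 0)"
  using assms embed_square[of 0 x "T (int k) y"] \<phi>_sym[of x "T (int k) y"]
  by (simp add: word_def gen_a_def conj_gen_ts embed_mult \<psi>_T del: G_simps)

lemma word_t:
  assumes "x \<in> X" "y \<in> X" "\<psi> x x = 0" "\<psi> y y = 0"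
  shows "word (gen_a x) (gen_t [^]\<^bsub>G\<^esub> (k::nat)) (gen_a y) =
    embed (\<psi> x (T (- int k) y) + \<psi> (T (- int k) y) x, 0, 0)"
  using assms embed_square[of "\<psi> x (T (- int k) y)" "x + T (- int k) y" 0]
  by (simp add: word_def gen_a_def conj_gen_t embed_mult \<psi>_add \<psi>_add2 \<psi>_T add_ac del: G_simps)

lemma gen_s_square: "gen_s \<otimes>\<^bsub>G\<^esub> gen_s = \<one>\<^bsub>G\<^esub>"
  using N by (simp add: gen_s_def)

lemma gen_ts_square: "(gen_t \<otimes>\<^bsub>G\<^esub> gen_s) \<otimes>\<^bsub>G\<^esub> (gen_t \<otimes>\<^bsub>G\<^esub> gen_s) = \<one>\<^bsub>G\<^esub>"
  using N by (simp add: gen_s_def gen_t_def mod_simps)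

lemma gen_a_square: "x \<in> X \<Longrightarrow> \<psi> x x = 0 \<Longrightarrow> gen_a x \<otimes>\<^bsub>G\<^esub> gen_a x = \<one>\<^bsub>G\<^esub>"
  using embed_square[of 0 x 0] by (simp add: gen_a_def numeral_2_eq_2 embed_one del: G_simps)

lemma embed_pow_4: "y \<in> carrier E \<Longrightarrow> embed y [^]\<^bsub>G\<^esub> (4::nat) = \<one>\<^bsub>G\<^esub>"
proof -
  assume "y \<in> carrier E"
  then obtain v b b' where y: "y = (v, b, b')" "v \<in> V" "b \<in> X" "b' \<in> X" by auto
  have "embed y [^]\<^bsub>G\<^esub> (4::nat) = (embed y [^]\<^bsub>G\<^esub> (2::nat)) [^]\<^bsub>G\<^esub> (2::nat)"
    using embed_closed[of y] y by (simp add: G.nat_pow_pow del: G_simps)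
  also have "\<dots> = \<one>\<^bsub>G\<^esub>" using y by (simp add: embed_square embed_one del: G_simps)
  finally show ?thesis .
qed

text \<open>The square of \<open>y x\<close> is \<open>y\<close> times its conjugate by the
  involution \<open>x\<close>, an element of \<open>E\<close>, and fourth powers in \<open>E\<close>
  are trivial. This yields an invariant separating the \<open>a_i\<close> from the two reflections:
  the product of an \<open>a_i\<close> with any generator has trivial eighth power.\<close>

lemma pow_8:
  assumes x: "x \<in> carrier G" "x \<otimes>\<^bsub>G\<^esub> x = \<one>\<^bsub>G\<^esub>" and y: "y \<in> carrier E" "y' \<in> carrier E"
    and conj: "x \<otimes>\<^bsub>G\<^esub> embed y \<otimes>\<^bsub>G\<^esub> inv\<^bsub>G\<^esub> x = embed y'"
  shows "(embed y \<otimes>\<^bsub>G\<^esub> x) [^]\<^bsub>G\<^esub> (8::nat) = \<one>\<^bsub>G\<^esub>"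
proof -
  have "inv\<^bsub>G\<^esub> x = x" using x by (simp add: G.inv_equality del: G_simps)
  then have "(embed y \<otimes>\<^bsub>G\<^esub> x) [^]\<^bsub>G\<^esub> (2::nat) = embed y \<otimes>\<^bsub>G\<^esub> (x \<otimes>\<^bsub>G\<^esub> embed y \<otimes>\<^bsub>G\<^esub> inv\<^bsub>G\<^esub> x)"
    using x y embed_closed by (simp add: numeral_2_eq_2 G.m_assoc del: G_simps E_simps)
  then have sq: "(embed y \<otimes>\<^bsub>G\<^esub> x) [^]\<^bsub>G\<^esub> (2::nat) = embed (y \<otimes>\<^bsub>E\<^esub> y')"
    unfolding conj using y by (simp add: embed_mult del: G_simps E_simps)
  have "(embed y \<otimes>\<^bsub>G\<^esub> x) [^]\<^bsub>G\<^esub> (8::nat) = ((embed y \<otimes>\<^bsub>G\<^esub> x) [^]\<^bsub>G\<^esub> (2::nat)) [^]\<^bsub>G\<^esub> (4::nat)"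
    using x y by (simp add: G.nat_pow_pow del: G_simps E_simps)
  also have "\<dots> = \<one>\<^bsub>G\<^esub>"
    unfolding sq using y group.is_monoid[OF group_E]
    by (intro embed_pow_4) (simp add: monoid.m_closed del: E_simps)
  finally show ?thesis .
qed

lemma pow_8_a:
  assumes "x \<in> X" and z: "z = gen_s \<or> z = gen_t \<otimes>\<^bsub>G\<^esub> gen_s \<or> (\<exists>y\<in>X. \<psi> y y = 0 \<and> z = gen_a y)"
  shows "(gen_a x \<otimes>\<^bsub>G\<^esub> z) [^]\<^bsub>G\<^esub> (8::nat) = \<one>\<^bsub>G\<^esub>"
  using z
proof (elim disjE bexE conjE)
  have x: "(0, x, 0) \<in> carrier E" using assms by simp
  show ?thesis if "z = gen_s"
    unfolding gen_a_def that
  proof (rule pow_8[OF gen_closed(1) gen_s_square x])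
    show "gen_s \<otimes>\<^bsub>G\<^esub> embed (0, x, 0) \<otimes>\<^bsub>G\<^esub> inv\<^bsub>G\<^esub> gen_s = embed (rot (int 0) (swap (0, x, 0)))"
      using conj_gen_ts[OF x, of 0] gen_closed by (simp del: G_simps rot_simps swap_simps)
  qed (use x in simp)
  show ?thesis if "z = gen_t \<otimes>\<^bsub>G\<^esub> gen_s"
    unfolding gen_a_def that
  proof (rule pow_8[OF _ gen_ts_square x])
    show "gen_t \<otimes>\<^bsub>G\<^esub> gen_s \<in> carrier G" using gen_closed by (simp del: G_simps)
    show "gen_t \<otimes>\<^bsub>G\<^esub> gen_s \<otimes>\<^bsub>G\<^esub> embed (0, x, 0) \<otimes>\<^bsub>G\<^esub> inv\<^bsub>G\<^esub> (gen_t \<otimes>\<^bsub>G\<^esub> gen_s)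
      = embed (rot (int 1) (swap (0, x, 0)))"
      using conj_gen_ts[OF x, of 1] gen_closed by (simp del: G_simps)
  qed (use x in simp)
  fix y assume y: "y \<in> X" "\<psi> y y = 0" "z = gen_a y"
  show ?thesis
    unfolding gen_a_def[of x] y(3)
  proof (rule pow_8[OF _ gen_a_square x])
    have "inv\<^bsub>G\<^esub> (gen_a y) = gen_a y" using gen_a_square y by (simp add: G.inv_equality del: G_simps)
    then show "gen_a y \<otimes>\<^bsub>G\<^esub> embed (0, x, 0) \<otimes>\<^bsub>G\<^esub> inv\<^bsub>G\<^esub> (gen_a y)
      = embed ((0, y, 0) \<otimes>\<^bsub>E\<^esub> (0, x, 0) \<otimes>\<^bsub>E\<^esub> (0, y, 0))"
      using y x by (simp add: gen_a_def embed_mult del: G_simps)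
  qed (use x y in \<open>auto simp del: G_simps\<close>)
qed

text \<open>The product of the two reflections is \<open>gen_t\<close> or its inverse, an element of
  order \<open>N\<close>; this contrast with \<open>pow_8_a\<close> is the reason for the bound 8 on
  \<open>N\<close>.\<close>

lemma pow_8_s:
  "(gen_s \<otimes>\<^bsub>G\<^esub> (gen_t \<otimes>\<^bsub>G\<^esub> gen_s)) [^]\<^bsub>G\<^esub> (8::nat) \<noteq> \<one>\<^bsub>G\<^esub>"
  "((gen_t \<otimes>\<^bsub>G\<^esub> gen_s) \<otimes>\<^bsub>G\<^esub> gen_s) [^]\<^bsub>G\<^esub> (8::nat) \<noteq> \<one>\<^bsub>G\<^esub>"
proof -
  have t8: "gen_t [^]\<^bsub>G\<^esub> (8::nat) \<noteq> \<one>\<^bsub>G\<^esub>"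
    unfolding gen_t_pow using N by simp
  have 1: "(gen_t \<otimes>\<^bsub>G\<^esub> gen_s) \<otimes>\<^bsub>G\<^esub> gen_s = gen_t"
    using gen_closed by (simp add: G.m_assoc gen_s_square del: G_simps)
  then show "((gen_t \<otimes>\<^bsub>G\<^esub> gen_s) \<otimes>\<^bsub>G\<^esub> gen_s) [^]\<^bsub>G\<^esub> (8::nat) \<noteq> \<one>\<^bsub>G\<^esub>" using t8 by simp
  have "gen_s \<otimes>\<^bsub>G\<^esub> (gen_t \<otimes>\<^bsub>G\<^esub> gen_s) \<otimes>\<^bsub>G\<^esub> gen_t = \<one>\<^bsub>G\<^esub>"
    using gen_ts_square gen_s_square gen_closed
    by (metis G.inv_equality G.l_inv G.m_assoc G.m_closed 1)
  then have "gen_s \<otimes>\<^bsub>G\<^esub> (gen_t \<otimes>\<^bsub>G\<^esub> gen_s) = inv\<^bsub>G\<^esub> gen_t"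
    using gen_closed G.m_closed by (intro G.inv_equality[symmetric]) (simp_all del: G_simps)
  then show "(gen_s \<otimes>\<^bsub>G\<^esub> (gen_t \<otimes>\<^bsub>G\<^esub> gen_s)) [^]\<^bsub>G\<^esub> (8::nat) \<noteq> \<one>\<^bsub>G\<^esub>"
    using t8 gen_closed by (metis G.inv_inv G.inv_one G.nat_pow_closed G.nat_pow_inv)
qed

text \<open>The words produce \<open>V\<close>, the conjugates by \<open>t^k s\<close> then produce
  the second copy of \<open>X\<close>, and conjugation by \<open>s\<close> carries that copy to the
  first. The two span hypotheses speak of sets closed under addition, which over F_2 is the same as
  linear span.\<close>

lemma generate_G:
  assumes S: "S \<subseteq> carrier G" "gen_s \<in> S" "gen_t \<otimes>\<^bsub>G\<^esub> gen_s \<in> S" "gen_a ` D \<subseteq> S"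
    and D: "D \<subseteq> X" "\<And>x. x \<in> D \<Longrightarrow> \<psi> x x = 0"
    and X_span: "\<And>Y. 0 \<in> Y \<Longrightarrow> (\<And>x y. x \<in> Y \<Longrightarrow> y \<in> Y \<Longrightarrow> x + y \<in> Y) \<Longrightarrow>
      (\<And>x k. x \<in> D \<Longrightarrow> T (int k) x \<in> Y) \<Longrightarrow> X \<subseteq> Y"
    and V_span: "\<And>W. 0 \<in> W \<Longrightarrow> (\<And>x y. x \<in> W \<Longrightarrow> y \<in> W \<Longrightarrow> x + y \<in> W) \<Longrightarrow>
      (\<And>x y k. x \<in> D \<Longrightarrow> y \<in> D \<Longrightarrow> \<phi> x (T (int k) y) \<in> W) \<Longrightarrow>
      (\<And>x y k. x \<in> D \<Longrightarrow> y \<in> D \<Longrightarrow> \<psi> x (T (- int k) y) + \<psi> (T (- int k) y) x \<in> W) \<Longrightarrow> V \<subseteq> W"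
  shows "generate G S = carrier G"
proof
  let ?K = "generate G S"
  show "?K \<subseteq> carrier G" using G.generate_incl[OF S(1)] .
  interpret K: subgroup ?K G by (rule G.generate_is_subgroup[OF S(1)])
  have a: "gen_a x \<in> ?K" if "x \<in> D" for x
    using S that by (auto intro: generate.incl simp del: G_simps)
  have s: "gen_s \<in> ?K" and ts: "gen_t \<otimes>\<^bsub>G\<^esub> gen_s \<in> ?K"
    using S by (auto intro: generate.incl simp del: G_simps)
  have "(gen_t \<otimes>\<^bsub>G\<^esub> gen_s) \<otimes>\<^bsub>G\<^esub> gen_s = gen_t"
    using gen_closed by (simp add: G.m_assoc gen_s_square del: G_simps)
  then have t: "gen_t \<in> ?K" using K.m_closed[OF ts s] by simp
  have tk: "gen_t [^]\<^bsub>G\<^esub> k \<in> ?K" for k :: nat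
    by (induction k) (use t K.one_closed in \<open>auto simp del: G_simps\<close>)
  have conj: "g \<otimes>\<^bsub>G\<^esub> y \<otimes>\<^bsub>G\<^esub> inv\<^bsub>G\<^esub> g \<in> ?K" if "g \<in> ?K" "y \<in> ?K" for g y
    using that by (simp del: G_simps)
  have word: "word x g y \<in> ?K" if "x \<in> ?K" "g \<in> ?K" "y \<in> ?K" for x g y
    using that conj[of g y] K.mem_carrier unfolding word_def by (simp add: numeral_2_eq_2 del: G_simps)
  have V: "V \<subseteq> {v \<in> V. embed (v, 0, 0) \<in> ?K}"
  proof (rule V_span)
    show "0 \<in> {v \<in> V. embed (v, 0, 0) \<in> ?K}" using K.one_closed by (simp add: embed_one del: G_simps)
    show "v + w \<in> {v \<in> V. embed (v, 0, 0) \<in> ?K}"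
      if "v \<in> {v \<in> V. embed (v, 0, 0) \<in> ?K}" "w \<in> {v \<in> V. embed (v, 0, 0) \<in> ?K}" for v w
      using that K.m_closed[of "embed (v, 0, 0)" "embed (w, 0, 0)"] by (simp add: embed_mult del: G_simps)
  next
    fix x y k assume xy: "x \<in> D" "y \<in> D"
    have xX: "x \<in> X" "y \<in> X" using xy D by auto
    show "\<phi> x (T (int k) y) \<in> {v \<in> V. embed (v, 0, 0) \<in> ?K}"
      using word[OF a[OF xy(1)] K.m_closed[OF tk s] a[OF xy(2)], of k] word_ts[OF xX, of k] xX D xy by simp
    show "\<psi> x (T (- int k) y) + \<psi> (T (- int k) y) x \<in> {v \<in> V. embed (v, 0, 0) \<in> ?K}"
      using word[OF a[OF xy(1)] tk a[OF xy(2)], of k] word_t[OF xX, of k] xX D xy by simp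
  qed
  \<comment> \<open>With all of \<open>V\<close> in \<open>?K\<close>, the first coordinate can be
    changed at will, so the cocycle terms below do no harm.\<close>
  have Vmul: "embed (v + w, b, b') \<in> ?K" if "embed (v, b, b') \<in> ?K" "w \<in> V" "b \<in> X" "b' \<in> X" for v w b b'
    using K.m_closed[OF that(1), of "embed (w, 0, 0)"] that V by (auto simp: embed_mult simp del: G_simps)
  have Vabs: "embed (0, b, b') \<in> ?K" if "embed (v, b, b') \<in> ?K" "v \<in> V" "b \<in> X" "b' \<in> X" for v b b'
    using Vmul[OF that(1,2,3,4)] by (simp add: two_v)
  have X2: "X \<subseteq> {x \<in> X. embed (0, 0, x) \<in> ?K}"
  proof (rule X_span)
    show "0 \<in> {x \<in> X. embed (0, 0, x) \<in> ?K}" using K.one_closed by (simp add: embed_one del: G_simps)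
    show "x + y \<in> {x \<in> X. embed (0, 0, x) \<in> ?K}"
      if "x \<in> {x \<in> X. embed (0, 0, x) \<in> ?K}" "y \<in> {x \<in> X. embed (0, 0, x) \<in> ?K}" for x y
      using that K.m_closed[of "embed (0, 0, x)" "embed (0, 0, y)"] Vabs[of "\<psi> x y" 0 "x + y"]
      by (simp add: embed_mult del: G_simps)
    fix x k assume x: "x \<in> D"
    then have xX: "x \<in> X" using D by auto
    have "embed (rot (int k) (swap (0, x, 0))) \<in> ?K"
      using conj[OF K.m_closed[OF tk s] a[OF x], of k] conj_gen_ts[of "(0, x, 0)" k] xX
      unfolding gen_a_def by simp
    then show "T (int k) x \<in> {x \<in> X. embed (0, 0, x) \<in> ?K}" using xX by simp
  qed
  have X1: "embed (0, x, 0) \<in> ?K" if x: "x \<in> X" for x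
  proof -
    have "embed (0, 0, x) \<in> ?K" using X2 x by blast
    from conj[OF K.m_closed[OF tk s] this, of 0] show ?thesis
      using conj_gen_ts[of "(0, 0, x)" 0] x gen_closed by (simp del: G_simps)
  qed
  have E: "embed y \<in> ?K" if y: "y \<in> carrier E" for y
  proof -
    obtain v b b' where y: "y = (v, b, b')" "v \<in> V" "b \<in> X" "b' \<in> X" using y by auto
    have "embed (0, 0, b') \<in> ?K" using X2 y(4) by blast
    then have "embed (0, b, b') \<in> ?K"
      using K.m_closed[OF X1[OF y(3)], of "embed (0, 0, b')"] y by (simp add: embed_mult del: G_simps)
    from Vmul[OF this y(2,3,4)] show ?thesis using y by simp
  qed
  show "carrier G \<subseteq> ?K"
  proof
    fix g assume g: "g \<in> carrier G"
    obtain y r \<epsilon> where geq: "g = ((y, r), \<epsilon>)" by (cases g) auto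
    have y: "y \<in> carrier E" and r: "0 \<le> r" "r < int N" and \<epsilon>: "\<epsilon> = 0 \<or> \<epsilon> = 1" using g geq by auto
    have "embed y \<otimes>\<^bsub>G\<^esub> gen_t [^]\<^bsub>G\<^esub> nat r = ((y, r), 0)"
      using y r unfolding gen_t_pow embed_def by auto
    then have yr: "((y, r), 0) \<in> ?K" using K.m_closed[OF E[OF y] tk[of "nat r"]] by simp
    have "((y, r), 0) \<otimes>\<^bsub>G\<^esub> gen_s = ((y, r), 1)" using y r by (auto simp: gen_s_def)
    then have "((y, r), 1) \<in> ?K" using K.m_closed[OF yr s] by simp
    then show "g \<in> ?K" using yr \<epsilon> geq by blast
  qed
qed

end

section \<open>The family of groups\<close>

lemma bit_poly_add_self [simp]: "p + p = (0 :: bit poly)"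
proof (rule poly_eqI)
  have "coeff p i + coeff p i = 0" for i by (cases "coeff p i") simp_all
  then show "coeff (p + p) i = coeff 0 i" for i by (simp only: coeff_add coeff_0)
qed

lemma bit_poly_two [simp]: "(2 :: bit poly) = 0"
  using bit_poly_add_self[of 1] by (simp only: one_add_one)

lemma bit_poly_dvd_power_add_1: "u + 1 dvd u ^ k + (1 :: bit poly)"
proof (induction k)
  case (Suc k)
  have "u ^ Suc k + 1 + (u + u) = u * (u ^ k + 1) + (u + 1)"
    by (simp only: distrib_left mult_1_right power_Suc add_ac)
  then have "u ^ Suc k + 1 = u * (u ^ k + 1) + (u + 1)"
    by (simp only: bit_poly_add_self add_0_right)
  moreover have "u + 1 dvd u * (u ^ k + 1) + (u + 1)" by (rule dvd_add[OF dvd_mult[OF Suc] dvd_refl])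
  ultimately show ?case by (simp only:)
qed simp

lemma bit_poly_two_power: "(p + 1) ^ (2 ^ k) = p ^ (2 ^ k) + (1 :: bit poly)"
proof (induction k)
  case (Suc k)
  have "(p + 1) ^ (2 ^ Suc k) = (p ^ (2 ^ k) + 1) ^ 2"
    by (simp only: power_Suc2 power_mult Suc)
  also have "\<dots> = p ^ (2 ^ Suc k) + 1 + (p ^ (2 ^ k) + p ^ (2 ^ k))"
    by (simp add: power2_eq_square algebra_simps flip: power_add mult_2 del: bit_poly_add_self)
  finally show ?case by simp
qed simp

text \<open>Plays two roles: representatives of the truncated ring \<open>R\<close> for
  \<open>k = n\<close>, and the vector space \<open>V\<close> for \<open>k = x\<close>. It is empty
  for \<open>k = 0\<close>, as even the zero polynomial has degree 0; hence the positivity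
  assumptions.\<close>

definition poly_lt :: "nat \<Rightarrow> bit poly set" where
  "poly_lt k = {p. degree p < k}"

lemma poly_lt_0 [simp]: "k > 0 \<Longrightarrow> 0 \<in> poly_lt k"
  by (simp add: poly_lt_def)

lemma poly_lt_add [simp]: "p \<in> poly_lt k \<Longrightarrow> q \<in> poly_lt k \<Longrightarrow> p + q \<in> poly_lt k"
  by (simp add: poly_lt_def degree_add_less)

lemma poly_lt_sum: "k > 0 \<Longrightarrow> (\<And>i. i \<in> A \<Longrightarrow> p i \<in> poly_lt k) \<Longrightarrow> sum p A \<in> poly_lt k"
  by (induction A rule: infinite_finite_induct) auto

lemma poly_lt_smult [simp]: "p \<in> poly_lt k \<Longrightarrow> smult c p \<in> poly_lt k"
  by (auto simp: poly_lt_def)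

lemma poly_lt_expand:
  assumes "p \<in> poly_lt k"
  shows "p = (\<Sum>r<k. monom (coeff p r) r)"
proof (rule poly_eqI)
  fix i
  have "coeff (\<Sum>r<k. monom (coeff p r) r) i = (\<Sum>r<k. if r = i then coeff p r else 0)"
    by (simp add: coeff_sum)
  then show "coeff p i = coeff (\<Sum>r<k. monom (coeff p r) r) i"
    using assms by (auto simp: poly_lt_def coeff_eq_0)
qed

text \<open>Closure under addition suffices for spanning, the scalars being \<open>0\<close> and \<open>1\<close>.\<close>

lemma poly_lt_span:
  assumes "p \<in> poly_lt k" "h 0 \<in> W" and add: "\<And>x y. x \<in> W \<Longrightarrow> y \<in> W \<Longrightarrow> x + y \<in> W"
    and h: "\<And>p q. h (p + q) = h p + h q" and m: "\<And>r. r < k \<Longrightarrow> h (monom 1 r) \<in> W"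
  shows "h p \<in> W"
proof -
  have "h (\<Sum>r<j. monom (coeff p r) r) \<in> W" if "j \<le> k" for j
    using that
  proof (induction j)
    case (Suc j)
    have "coeff p j = 0 \<or> coeff p j = 1" by (cases "coeff p j") auto
    then show ?case using Suc m[of j] add assms(2) by (auto simp: h)
  qed (use assms(2) in simp)
  then show ?thesis using poly_lt_expand[OF assms(1)] by (metis order_refl)
qed

lemma card_poly_lt: "k > 0 \<Longrightarrow> finite (poly_lt k) \<and> card (poly_lt k) = 2 ^ k"
proof -
  assume k: "k > 0"
  have U: "(UNIV :: bit set) = {0, 1}" by (auto intro: bit.exhaust)
  let ?A = "{..<k} \<rightarrow>\<^sub>E (UNIV :: bit set)"
  have bij: "bij_betw (\<lambda>c. \<Sum>r<k. monom (c r) r) ?A (poly_lt k)"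
  proof (rule bij_betw_byWitness[where f' = "\<lambda>p. restrict (coeff p) {..<k}"])
    have co: "coeff (\<Sum>r<k. monom (c r) r) i = (if i < k then c i else 0)" for c :: "nat \<Rightarrow> bit" and i
      by (simp add: coeff_sum)
    show "\<forall>c\<in>?A. restrict (coeff (\<Sum>r<k. monom (c r) r)) {..<k} = c"
      by (auto simp: co fun_eq_iff PiE_def extensional_def)
    show "\<forall>p\<in>poly_lt k. (\<Sum>r<k. monom (restrict (coeff p) {..<k} r) r) = p"
      using poly_lt_expand by (metis (no_types, lifting) lessThan_iff restrict_apply' sum.cong)
    show "(\<lambda>c. \<Sum>r<k. monom (c r) r) ` ?A \<subseteq> poly_lt k"
    proof (intro image_subsetI poly_lt_sum k)
      fix c :: "nat \<Rightarrow> bit" and r assume "r \<in> {..<k}"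
      then show "monom (c r) r \<in> poly_lt k"
        using degree_monom_le[of "c r" r] by (simp add: poly_lt_def)
    qed
  qed (auto split: if_splits)
  have "finite ?A" unfolding U by (intro finite_PiE) auto
  moreover have "card ?A = 2 ^ k" unfolding U by (simp add: card_PiE numeral_2_eq_2)
  ultimately show ?thesis using bij_betw_finite[OF bij] bij_betw_same_card[OF bij] by simp
qed

text \<open>\<open>2 ^ J\<close> is the order of the rotation. The exponents below
  \<open>e + 2\<close> are reserved for breaking symmetries, so \<open>pos\<close>, which lists the
  places of the basis vectors of \<open>V\<close>, takes its last coordinate from
  \<open>e + 2\<close> on, where the two kinds of prescriptions cannot collide.\<close>

locale construction =
  fixes e n J x :: nat and pos :: "nat \<Rightarrow> nat \<times> nat \<times> nat"
  assumes e: "e > 0" and en: "e + 2 \<le> n" and nJ: "n \<le> 2 ^ J" and J: "8 < (2::nat) ^ J" and x: "x > 0"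
    and pos: "pos ` {..<x} \<subseteq> {..<e} \<times> {..<e} \<times> {e + 2..<n}" and inj_pos: "inj_on pos {..<x}"
begin

abbreviation N :: nat where "N \<equiv> 2 ^ J"
abbreviation t :: "bit poly" where "t \<equiv> [:0, 1:]"

definition M :: "bit poly" where "M = (t + 1) ^ n"

definition X :: "(nat \<Rightarrow> bit poly) set" where
  "X = {b. (\<forall>i<e. b i \<in> poly_lt n) \<and> (\<forall>i\<ge>e. b i = 0)}"

definition T :: "int \<Rightarrow> (nat \<Rightarrow> bit poly) \<Rightarrow> nat \<Rightarrow> bit poly" where
  "T r b = (\<lambda>i. (t ^ nat (r mod int N) * b i) mod M)"

text \<open>
  Modulo \<open>M\<close> this is the substitution of \<open>t\<inverse>\<close> for \<open>t\<close>, since \<open>t ^ N\<close> is congruent to \<open>1\<close>.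
\<close>

definition conjugate :: "bit poly \<Rightarrow> bit poly" where
  "conjugate p = pcompose p (t ^ (N - 1))"

text \<open>The additive map on \<open>F_2[t]/(M)\<close> that sends the basis element \<open>t ^ r\<close> to \<open>g r\<close>.\<close>

definition value_at :: "(nat \<Rightarrow> bit poly) \<Rightarrow> bit poly \<Rightarrow> bit poly" where
  "value_at g p = (\<Sum>r<n. smult (coeff (p mod M) r) (g r))"

text \<open>Uses the parameters \<open>f i j\<close> with \<open>i \<le> j\<close>, while
  \<open>\<psi>\<close> uses those with \<open>j < i\<close>; together they exhaust all
  \<open>e * e\<close> pairs. The reflection exchanges the two copies of \<open>X\<close> and forces
  symmetry, hence \<open>min\<close> and \<open>max\<close>.\<close>

definition \<phi> :: "(nat \<Rightarrow> nat \<Rightarrow> nat \<Rightarrow> bit poly) \<Rightarrow> (nat \<Rightarrow> bit poly) \<Rightarrow> (nat \<Rightarrow> bit poly) \<Rightarrow> bit poly" where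
  "\<phi> f b c = (\<Sum>i<e. \<Sum>j<e. value_at (f (min i j) (max i j)) (b i * c j))"

text \<open>Commutators see only the symmetrisation of \<open>\<psi>\<close>, so one triangle of
  index pairs carries all the information. Without diagonal terms \<open>\<psi>\<close> vanishes on
  each pair \<open>(\<delta> i, \<delta> i)\<close>, which makes the generators \<open>a_i\<close>
  involutions.\<close>

definition \<psi> :: "(nat \<Rightarrow> nat \<Rightarrow> nat \<Rightarrow> bit poly) \<Rightarrow> (nat \<Rightarrow> bit poly) \<Rightarrow> (nat \<Rightarrow> bit poly) \<Rightarrow> bit poly" where
  "\<psi> f b c = (\<Sum>i<e. \<Sum>j<i. value_at (f i j) (b i * conjugate (c j)))"

definition \<delta> :: "nat \<Rightarrow> nat \<Rightarrow> bit poly" where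
  "\<delta> i = (\<lambda>j. if j = i then 1 else 0)"

section \<open>Arithmetic modulo \<open>M\<close> and invariance of the forms\<close>

lemma n: "n > 0" using en by simp

lemma J_pos: "J > 0" using J by (cases J) auto

lemma degree_M: "degree M = n"
proof -
  have "t + 1 = [:1, 1:]" by (simp add: one_pCons)
  then show ?thesis unfolding M_def by (simp add: degree_power_eq)
qed

lemma M_nz: "M \<noteq> 0" using degree_M n by auto

lemma mod_M_lt [simp]: "p mod M \<in> poly_lt n"
  using degree_mod_less[OF M_nz, of p] n by (auto simp: poly_lt_def degree_M)

lemma mod_M_id: "p \<in> poly_lt n \<Longrightarrow> p mod M = p"
  by (simp add: poly_lt_def mod_poly_less degree_M)

text \<open>This is why the modulus is a power of \<open>t + 1\<close>: in characteristic 2 it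
  divides \<open>(t + 1) ^ N = t ^ N + 1\<close>, as \<open>N\<close> is a power of two and
  \<open>n \<le> N\<close>.\<close>

lemma t_pow_N: "t ^ N mod M = 1 mod M"
proof -
  have "M dvd (t + 1) ^ N" unfolding M_def by (rule le_imp_power_dvd[OF nJ])
  then have "M dvd t ^ N + 1" unfolding bit_poly_two_power .
  then have "(t ^ N + 1 + 1) mod M = 1 mod M"
    by (metis mod_add_left_eq dvd_imp_mod_0 add_0)
  then show ?thesis by (simp add: add.assoc)
qed

lemma t_pow_cong: "a mod N = b mod N \<Longrightarrow> t ^ a mod M = t ^ b mod M"
proof -
  have *: "t ^ a mod M = t ^ (a mod N) mod M" for a
  proof -
    have "t ^ a = t ^ (a mod N) * (t ^ N) ^ (a div N)"
      by (simp flip: power_mult power_add)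
    then have "t ^ a mod M = t ^ (a mod N) * (t ^ N mod M) ^ (a div N) mod M"
      by (metis mod_mult_right_eq power_mod)
    also have "\<dots> = t ^ (a mod N) * (1 mod M) ^ (a div N) mod M"
      unfolding t_pow_N ..
    also have "\<dots> = t ^ (a mod N) * 1 ^ (a div N) mod M"
      by (metis mod_mult_right_eq power_mod)
    finally show ?thesis by simp
  qed
  show "a mod N = b mod N \<Longrightarrow> t ^ a mod M = t ^ b mod M" using *[of a] *[of b] by simp
qed

lemma t_pow_mult_cong: "a mod N = b mod N \<Longrightarrow> (t ^ a * p) mod M = (t ^ b * p) mod M"
proof -
  assume "a mod N = b mod N"
  then have "((t ^ a mod M) * p) mod M = ((t ^ b mod M) * p) mod M" using t_pow_cong[of a b] by simp
  then show ?thesis by (simp add: mod_mult_left_eq)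
qed

lemma conjugate_add: "conjugate (p + q) = conjugate p + conjugate q"
  by (simp add: conjugate_def pcompose_add)

lemma conjugate_mult: "conjugate (p * q) = conjugate p * conjugate q"
  by (simp add: conjugate_def pcompose_mult)

lemma conjugate_0 [simp]: "conjugate 0 = 0" and conjugate_1 [simp]: "conjugate 1 = 1"
  by (simp_all add: conjugate_def pcompose_1)

lemma conjugate_pow: "conjugate (p ^ k) = conjugate p ^ k"
  by (induction k) (simp_all add: conjugate_mult)

lemma conjugate_t: "conjugate t = t ^ (N - 1)"
  by (simp add: conjugate_def pcompose_pCons)

text \<open>The substitution is well defined modulo \<open>M\<close>: \<open>t + 1\<close> divides
  its own image \<open>t ^ (N - 1) + 1\<close>, so \<open>M\<close> divides
  \<open>conjugate M\<close>.\<close>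

lemma conjugate_mod: "conjugate (p mod M) mod M = conjugate p mod M"
proof -
  have "t + 1 dvd conjugate (t + 1)"
    by (simp only: conjugate_add conjugate_t conjugate_1 bit_poly_dvd_power_add_1)
  then have "M dvd conjugate M" unfolding M_def conjugate_pow by (rule dvd_power_same)
  then have "conjugate (M * (p div M)) mod M = 0" by (simp add: conjugate_mult dvd_imp_mod_0)
  moreover have "conjugate p = conjugate (M * (p div M)) + conjugate (p mod M)"
    by (simp flip: conjugate_add)
  then have "conjugate p mod M = conjugate (M * (p div M)) mod M + conjugate (p mod M) mod M"
    by (metis poly_mod_add_left)
  ultimately show ?thesis by simp
qed

lemma value_at_add: "value_at g (p + q) = value_at g p + value_at g q"
  by (simp only: value_at_def poly_mod_add_left coeff_add smult_add_left sum.distrib)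

lemma value_at_0 [simp]: "value_at g 0 = 0"
  by (simp add: value_at_def)

lemma value_at_cong: "p mod M = q mod M \<Longrightarrow> value_at g p = value_at g q"
  by (simp add: value_at_def)

lemma value_at_lt: "(\<And>r. r < n \<Longrightarrow> g r \<in> poly_lt x) \<Longrightarrow> value_at g p \<in> poly_lt x"
  unfolding value_at_def using x by (intro poly_lt_sum) auto

lemma t_pow_lt: "r < n \<Longrightarrow> t ^ r \<in> poly_lt n"
  by (simp add: poly_lt_def degree_power_eq)

lemma value_at_t_pow: "r < n \<Longrightarrow> value_at g (t ^ r) = g r"
proof -
  assume r: "r < n"
  have "t ^ r = monom 1 r" by (simp add: monom_altdef)
  then have "value_at g (t ^ r) = (\<Sum>r'<n. smult (if r = r' then 1 else 0) (g r'))"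
    using mod_M_id[OF t_pow_lt[OF r]] by (simp add: value_at_def)
  also have "\<dots> = (\<Sum>r'<n. if r' = r then g r' else 0)" by (intro sum.cong) auto
  also have "\<dots> = g r" using r by simp
  finally show ?thesis .
qed

lemma X_0 [simp]: "0 \<in> X"
  using n by (simp add: X_def)

lemma X_add [simp]: "b \<in> X \<Longrightarrow> c \<in> X \<Longrightarrow> b + c \<in> X"
  by (simp add: X_def)

lemma \<delta>_X [simp]: "i < e \<Longrightarrow> \<delta> i \<in> X"
  using n by (auto simp: X_def \<delta>_def poly_lt_def)

lemma T_X [simp]: "b \<in> X \<Longrightarrow> T r b \<in> X"
  by (auto simp: X_def T_def)

lemma T_compose: "T r (T q b) = T (r + q) b"
proof
  fix i
  have "T r (T q b) i = (t ^ (nat (r mod int N) + nat (q mod int N)) * b i) mod M"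
    by (simp add: T_def mod_mult_right_eq power_add mult.assoc)
  also have "\<dots> = (t ^ nat ((r + q) mod int N) * b i) mod M"
  proof (rule t_pow_mult_cong)
    have "int ((nat (r mod int N) + nat (q mod int N)) mod N) = int (nat ((r + q) mod int N) mod N)"
      by (simp add: zmod_int mod_simps)
    then show "(nat (r mod int N) + nat (q mod int N)) mod N = nat ((r + q) mod int N) mod N"
      by linarith
  qed
  finally show "T r (T q b) i = T (r + q) b i" by (simp add: T_def)
qed

lemma \<phi>_T_aux: "value_at g (T (- r) b i * T r c j) = value_at g (b i * c j)"
proof (rule value_at_cong)
  let ?a = "nat (- r mod int N)" and ?c = "nat (r mod int N)"
  have "(T (- r) b i * T r c j) mod M = ((t ^ ?a * b i) * (t ^ ?c * c j)) mod M"
    by (simp add: T_def mod_mult_eq)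
  also have "\<dots> = (t ^ (?a + ?c) * (b i * c j)) mod M"
    by (simp add: power_add mult_ac)
  also have "\<dots> = (t ^ 0 * (b i * c j)) mod M"
  proof (rule t_pow_mult_cong)
    have "int ((?a + ?c) mod N) = 0" by (simp add: zmod_int mod_simps)
    then show "(?a + ?c) mod N = 0 mod N" by simp
  qed
  finally show "(T (- r) b i * T r c j) mod M = (b i * c j) mod M" by simp
qed

lemma conjugate_T: "conjugate (T r b i) mod M = (t ^ nat (- r mod int N) * conjugate (b i)) mod M"
proof -
  let ?c = "nat (r mod int N)"
  have "conjugate (T r b i) mod M = (t ^ ((N - 1) * ?c) * conjugate (b i)) mod M"
    by (simp add: T_def conjugate_mod conjugate_mult conjugate_pow conjugate_t power_mult)
  also have "\<dots> = (t ^ nat (- r mod int N) * conjugate (b i)) mod M"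
  proof (rule t_pow_mult_cong)
    \<comment> \<open>Substituting \<open>t ^ (N - 1)\<close> multiplies exponents by
      \<open>N - 1\<close>, that is by -1 modulo \<open>N\<close>.\<close>
    have "int (((N - 1) * ?c) mod N) = ((int N - 1) * (r mod int N)) mod int N"
      by (simp add: zmod_int of_nat_diff)
    also have "\<dots> = ((int N - 1) * r) mod int N" by (simp add: mod_simps)
    also have "(int N - 1) * r = - r + int N * r" by (simp add: left_diff_distrib)
    also have "\<dots> mod int N = - r mod int N" by (rule mod_mult_self2)
    finally have "int (((N - 1) * ?c) mod N) = int (nat (- r mod int N) mod N)"
      by (simp add: zmod_int)
    then show "((N - 1) * ?c) mod N = nat (- r mod int N) mod N" by linarith
  qed
  finally show ?thesis .
qed

text \<open>Here both arguments are shifted by the same power of \<open>t\<close>, and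
  \<open>conjugate\<close> inverts the second, so the powers cancel; in \<open>\<phi>_T_aux\<close>
  the shifts are opposite from the start.\<close>

lemma \<psi>_T_aux: "value_at g (T r b i * conjugate (T r c j)) = value_at g (b i * conjugate (c j))"
proof (rule value_at_cong)
  let ?c = "nat (r mod int N)" and ?a = "nat (- r mod int N)"
  have "(T r b i * conjugate (T r c j)) mod M = ((t ^ ?c * b i) * (t ^ ?a * conjugate (c j))) mod M"
  proof -
    have "(T r b i * conjugate (T r c j)) mod M = ((t ^ ?c * b i) * (conjugate (T r c j) mod M)) mod M"
      unfolding T_def[of r b] by (simp add: mod_mult_left_eq mod_mult_right_eq)
    then show ?thesis unfolding conjugate_T by (simp add: mod_mult_right_eq)
  qed
  also have "\<dots> = (t ^ (?a + ?c) * (b i * conjugate (c j))) mod M"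
    by (simp add: power_add mult_ac)
  also have "\<dots> = (t ^ 0 * (b i * conjugate (c j))) mod M"
  proof (rule t_pow_mult_cong)
    have "int ((?a + ?c) mod N) = 0" by (simp add: zmod_int mod_simps)
    then show "(?a + ?c) mod N = 0 mod N" by simp
  qed
  finally show "(T r b i * conjugate (T r c j)) mod M = (b i * conjugate (c j)) mod M" by simp
qed

text \<open>
  The second condition breaks the symmetries of the generating set: the values of \<open>f i i r\<close> for small \<open>r\<close>
  distinguish the two reflections (\<open>r = 0\<close>, \<open>r = 1\<close>) and the indices \<open>i\<close> (\<open>r = i + 2\<close>). The third one
  makes the values at the positions \<open>pos\<close> a basis.
\<close>

definition parameter :: "(nat \<Rightarrow> nat \<Rightarrow> nat \<Rightarrow> bit poly) \<Rightarrow> bool" where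
  "parameter f \<longleftrightarrow>
     (\<forall>i j r. if i < e \<and> j < e \<and> r < n then f i j r \<in> poly_lt x else f i j r = 0) \<and>
     (\<forall>i<e. \<forall>r<e + 2. f i i r \<noteq> 0 \<longleftrightarrow> r = 0 \<or> r = i + 2) \<and>
     (\<forall>k<x. case pos k of (i, j, r) \<Rightarrow> f i j r = monom 1 k)"

lemma
  assumes "parameter f"
  shows parameter_lt: "i < e \<Longrightarrow> j < e \<Longrightarrow> r < n \<Longrightarrow> f i j r \<in> poly_lt x"
    and parameter_0: "\<not> (i < e \<and> j < e \<and> r < n) \<Longrightarrow> f i j r = 0"
    and parameter_diag: "i < e \<Longrightarrow> r < e + 2 \<Longrightarrow> f i i r \<noteq> 0 \<longleftrightarrow> r = 0 \<or> r = i + 2"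
    and parameter_pos: "k < x \<Longrightarrow> case pos k of (i, j, r) \<Rightarrow> f i j r = monom 1 k"
proof -
  have 1: "if i < e \<and> j < e \<and> r < n then f i j r \<in> poly_lt x else f i j r = 0" for i j r
    using assms unfolding parameter_def by blast
  have 2: "\<And>i r. i < e \<Longrightarrow> r < e + 2 \<Longrightarrow> f i i r \<noteq> 0 \<longleftrightarrow> r = 0 \<or> r = i + 2"
    using assms unfolding parameter_def by blast
  have 3: "\<And>k. k < x \<Longrightarrow> case pos k of (i, j, r) \<Rightarrow> f i j r = monom 1 k"
    using assms unfolding parameter_def by simp
  show "i < e \<Longrightarrow> j < e \<Longrightarrow> r < n \<Longrightarrow> f i j r \<in> poly_lt x" using 1[of i j r] by simp
  show "\<not> (i < e \<and> j < e \<and> r < n) \<Longrightarrow> f i j r = 0" using 1[of i j r] by simp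
  show "i < e \<Longrightarrow> r < e + 2 \<Longrightarrow> f i i r \<noteq> 0 \<longleftrightarrow> r = 0 \<or> r = i + 2" by (rule 2)
  show "k < x \<Longrightarrow> case pos k of (i, j, r) \<Rightarrow> f i j r = monom 1 k" by (rule 3)
qed

lemma twisted:
  assumes "parameter f"
  shows "twisted_group X (poly_lt x) (\<phi> f) (\<psi> f) T N"
proof
  note f = parameter_lt[OF assms]
  show "p + p = 0" for p :: "nat \<Rightarrow> bit poly"
    by (rule ext) (simp only: plus_fun_def zero_fun_def bit_poly_add_self)
  show "0 \<in> poly_lt x" using x by simp
  show "\<phi> f b c \<in> poly_lt x" if "b \<in> X" "c \<in> X" for b c
    unfolding \<phi>_def using x f by (intro poly_lt_sum value_at_lt) auto
  show "\<psi> f b c \<in> poly_lt x" if "b \<in> X" "c \<in> X" for b c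
    unfolding \<psi>_def using x f by (intro poly_lt_sum value_at_lt) auto
  show "\<phi> f b c = \<phi> f c b" for b c
    unfolding \<phi>_def by (subst sum.swap) (simp add: min.commute max.commute mult.commute)
  show "\<phi> f (b + c) d = \<phi> f b d + \<phi> f c d" for b c d
    by (simp add: \<phi>_def distrib_right value_at_add sum.distrib)
  show "\<psi> f (b + c) d = \<psi> f b d + \<psi> f c d" for b c d
    by (simp add: \<psi>_def distrib_right value_at_add sum.distrib)
  show "\<psi> f d (b + c) = \<psi> f d b + \<psi> f d c" for b c d
    by (simp add: \<psi>_def distrib_left conjugate_add value_at_add sum.distrib)
  show "T r (b + c) = T r b + T r c" for r b c
    by (simp add: T_def fun_eq_iff distrib_left poly_mod_add_left)
  show "T 0 b = b" if "b \<in> X" for b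
  proof
    fix i
    show "T 0 b i = b i" using that mod_M_id[of "b i"] by (cases "i < e") (auto simp: T_def X_def)
  qed
  show "T r b = T q b" if "r mod int N = q mod int N" for r q b
    using that by (simp add: T_def)
  show "\<phi> f (T (- r) b) (T r c) = \<phi> f b c" for r b c
    by (simp add: \<phi>_def \<phi>_T_aux)
  show "\<psi> f (T r b) (T r c) = \<psi> f b c" for r b c
    by (simp add: \<psi>_def \<psi>_T_aux)
  show "8 < N" by (rule J)
qed (simp_all add: T_compose)

lemma \<delta>_apply: "\<delta> i j = (if j = i then 1 else 0)"
  by (simp add: \<delta>_def)

lemma \<delta>_T: "T r (\<delta> i) = (\<lambda>j. if j = i then t ^ nat (r mod int N) mod M else 0)"
  by (auto simp: T_def \<delta>_apply fun_eq_iff)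

lemma sum_single: "finite A \<Longrightarrow> a \<in> A \<Longrightarrow> (\<And>b. b \<in> A \<Longrightarrow> b \<noteq> a \<Longrightarrow> g b = 0) \<Longrightarrow> sum g A = (g a :: 'z::comm_monoid_add)"
  by (subst sum.remove[of A a]) (auto intro!: sum.neutral)

text \<open>Since \<open>r < n\<close>, the product of the coordinates is the basis element
  \<open>t ^ r\<close> itself, without reduction modulo \<open>M\<close>, and
  \<open>value_at\<close> returns a single parameter.\<close>

lemma \<phi>_\<delta>:
  assumes "i < e" "j < e" "r < n"
  shows "\<phi> f (\<delta> i) (T (int r) (\<delta> j)) = f (min i j) (max i j) r"
proof -
  have r: "nat (int r mod int N) = r" using assms nJ by simp
  have "\<phi> f (\<delta> i) (T (int r) (\<delta> j)) = (\<Sum>j'<e. value_at (f (min i j') (max i j')) (\<delta> i i * T (int r) (\<delta> j) j'))"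
    unfolding \<phi>_def using assms by (intro sum_single) (auto simp: \<delta>_apply)
  also have "\<dots> = value_at (f (min i j) (max i j)) (\<delta> i i * T (int r) (\<delta> j) j)"
    using assms by (intro sum_single) (auto simp: \<delta>_T)
  also have "\<dots> = value_at (f (min i j) (max i j)) (t ^ r)"
    unfolding \<delta>_T r by (rule value_at_cong) (simp add: \<delta>_apply)
  finally show ?thesis using assms by (simp add: value_at_t_pow)
qed

text \<open>The shift by \<open>- r\<close> becomes \<open>t ^ r\<close> after conjugation; it is
  also the shift that occurs in \<open>word_t\<close>.\<close>

lemma \<psi>_\<delta>:
  assumes "j < i" "i < e" "r < n"
  shows "\<psi> f (\<delta> i) (T (- int r) (\<delta> j)) = f i j r"
proof -
  have r: "nat (int r mod int N) = r" using assms nJ by simp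
  have "\<psi> f (\<delta> i) (T (- int r) (\<delta> j)) = (\<Sum>j'<i. value_at (f i j') (\<delta> i i * conjugate (T (- int r) (\<delta> j) j')))"
    unfolding \<psi>_def using assms by (intro sum_single) (auto simp: \<delta>_apply)
  also have "\<dots> = value_at (f i j) (\<delta> i i * conjugate (T (- int r) (\<delta> j) j))"
    using assms by (intro sum_single) (auto simp: \<delta>_T)
  also have "\<dots> = value_at (f i j) (t ^ r)"
    using conjugate_T[of "- int r" "\<delta> j" j] r by (intro value_at_cong) (simp add: \<delta>_apply)
  finally show ?thesis using assms by (simp add: value_at_t_pow)
qed

lemma \<psi>_\<delta>_0: "i \<le> j \<Longrightarrow> \<psi> f (\<delta> i) (T r (\<delta> j)) = 0" "i \<le> j \<Longrightarrow> \<psi> f (T r (\<delta> i)) (\<delta> j) = 0"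
  unfolding \<psi>_def by (auto simp: \<delta>_T \<delta>_apply intro!: sum.neutral)

lemma \<psi>_\<delta>_self: "\<psi> f (\<delta> i) (\<delta> i) = 0"
  unfolding \<psi>_def by (auto simp: \<delta>_apply intro!: sum.neutral)

lemma X_span:
  assumes 0: "0 \<in> Y" and add: "\<And>x y. x \<in> Y \<Longrightarrow> y \<in> Y \<Longrightarrow> x + y \<in> Y"
    and T: "\<And>i k. i < e \<Longrightarrow> T (int k) (\<delta> i) \<in> Y"
  shows "X \<subseteq> Y"
proof
  fix b assume b: "b \<in> X"
  have single: "(\<lambda>j. if j = i then p else 0) \<in> Y" if i: "i < e" and p: "p \<in> poly_lt n" for i p
  proof (rule poly_lt_span[where h = "\<lambda>p j. if j = i then p else 0", OF p])
    show "(\<lambda>j. if j = i then 0 else 0) \<in> Y" using 0 by (simp add: zero_fun_def)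
    fix r assume r: "r < n"
    then have r': "nat (int r mod int N) = r" "t ^ r mod M = monom 1 r"
      using nJ mod_M_id[OF t_pow_lt[OF r]] by (simp_all add: monom_altdef)
    show "(\<lambda>j. if j = i then monom 1 r else 0) \<in> Y"
      using T[OF i, of r] unfolding \<delta>_T r' .
  qed (use add in \<open>auto simp: fun_eq_iff\<close>)
  have "(\<lambda>j. if j < k then b j else 0) \<in> Y" if "k \<le> e" for k
    using that
  proof (induction k)
    case 0
    then show ?case using assms(1) by (simp add: zero_fun_def)
  next
    case (Suc k)
    have "(\<lambda>j. if j < Suc k then b j else 0)
      = (\<lambda>j. if j < k then b j else 0) + (\<lambda>j. if j = k then b k else 0)"
      by (auto simp: fun_eq_iff)
    then show ?case using Suc add single[of k "b k"] b by (simp add: X_def)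
  qed
  from this[of e] have "(\<lambda>j. if j < e then b j else 0) \<in> Y" by simp
  moreover have "(\<lambda>j. if j < e then b j else 0) = b" using b by (auto simp: X_def fun_eq_iff)
  ultimately show "b \<in> Y" by simp
qed

definition group_of where
  "group_of f = twisted_group.G X (poly_lt x) (\<phi> f) (\<psi> f) T N"

text \<open>The product of \<open>gen_t\<close> and \<open>gen_s\<close> written out. That product
  is formed in a group depending on \<open>f\<close>, but its value is not, so one set
  \<open>S\<close> serves all members of the family.\<close>

definition ts :: "((('v::zero \<times> 'w::zero \<times> 'u::zero) \<times> int) \<times> int)" where
  "ts = (((0, 0, 0), 1), 1)"

definition S :: "(((bit poly \<times> (nat \<Rightarrow> bit poly) \<times> (nat \<Rightarrow> bit poly)) \<times> int) \<times> int) set" where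
  "S = {twisted_group.gen_s, ts} \<union> twisted_group.gen_a ` \<delta> ` {..<e}"

lemma inj_\<delta>: "\<delta> i = \<delta> j \<longleftrightarrow> i = j"
  using \<delta>_apply[of i i] \<delta>_apply[of j i] by (auto split: if_splits)

lemma carrier_group_of:
  assumes "parameter f"
  shows "group (group_of f)"
    and "carrier (group_of f) = ((poly_lt x \<times> X \<times> X) \<times> {0..<int N}) \<times> {0..<2}"
proof -
  interpret F: twisted_group X "poly_lt x" "\<phi> f" "\<psi> f" T N by (rule twisted[OF assms])
  show "group (group_of f)" unfolding group_of_def by (rule F.group_G)
  show "carrier (group_of f) = ((poly_lt x \<times> X \<times> X) \<times> {0..<int N}) \<times> {0..<2}"
    unfolding group_of_def by simp
qed

section \<open>Order and generators of the groups\<close>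

lemma card_X: "card X = 2 ^ (n * e)"
proof -
  let ?A = "{..<e} \<rightarrow>\<^sub>E poly_lt n"
  have bij: "bij_betw (\<lambda>c i. if i < e then c i else 0) ?A X"
  proof (rule bij_betw_byWitness[where f' = "\<lambda>b. restrict b {..<e}"])
    show "\<forall>b\<in>X. (\<lambda>i. if i < e then restrict b {..<e} i else 0) = b"
      by (auto simp: X_def fun_eq_iff)
    show "\<forall>c\<in>?A. restrict (\<lambda>i. if i < e then c i else 0) {..<e} = c"
      by (auto simp: fun_eq_iff PiE_def extensional_def)
    show "(\<lambda>c i. if i < e then c i else 0) ` ?A \<subseteq> X"
      by (intro image_subsetI) (auto simp: X_def dest: PiE_mem)
    show "(\<lambda>b. restrict b {..<e}) ` X \<subseteq> ?A"
      by (intro image_subsetI restrict_PiE_iff[THEN iffD2]) (simp add: X_def)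
  qed
  have "card X = card ?A" by (rule bij_betw_same_card[OF bij, symmetric])
  also have "\<dots> = 2 ^ (n * e)" using card_poly_lt[OF n] by (simp add: card_PiE power_mult)
  finally show ?thesis .
qed

lemma card_group_of: "parameter f \<Longrightarrow> card (carrier (group_of f)) = 2 ^ (x + 2 * e * n + J + 1)"
proof -
  assume "parameter f"
  then have "card (carrier (group_of f)) = 2 ^ x * (2 ^ (n * e)) ^ 2 * (2 * 2 ^ J)"
    using card_poly_lt[OF x] card_X
    by (simp add: carrier_group_of card_cartesian_product power2_eq_square)
  also have "\<dots> = 2 ^ (x + 2 * e * n + J + 1)"
    by (simp add: power_add power_mult[symmetric] mult_ac)
  finally show ?thesis .
qed

lemma involution_generating_S:
  assumes f: "parameter f"
  shows "involution_generating_set (group_of f) (e + 2) S"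
proof -
  interpret F: twisted_group X "poly_lt x" "\<phi> f" "\<psi> f" T N by (rule twisted[OF f])
  have ts: "F.gen_t \<otimes>\<^bsub>F.G\<^esub> F.gen_s = ts"
    using J J_pos by (simp add: F.gen_t_def F.gen_s_def ts_def)
  note f_pos = parameter_pos[OF f]
  have neq: "F.gen_s \<noteq> ts" "F.gen_s \<noteq> F.gen_a b" "ts \<noteq> F.gen_a b" for b
    by (simp_all add: F.gen_s_def ts_def F.gen_a_def F.embed_def)
  have a_inj: "inj_on (\<lambda>i. F.gen_a (\<delta> i)) {..<e}"
    by (auto simp: inj_on_def F.gen_a_def inj_\<delta>)
  have fin: "finite S" by (simp add: S_def)
  have "card S = e + 2"
  proof -
    have "card (F.gen_a ` \<delta> ` {..<e}) = e" unfolding image_image using a_inj by (simp add: card_image)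
    then show ?thesis unfolding S_def using neq by (subst card_Un_disjoint) auto
  qed
  moreover have inv: "involution F.G z" if z: "z \<in> S" for z
  proof -
    from z consider "z = F.gen_s" | "z = ts" | i where "i < e" "z = F.gen_a (\<delta> i)"
      unfolding S_def by auto
    then show ?thesis
    proof cases
      case 1
      then show ?thesis using F.gen_s_square F.gen_closed(1)
        by (simp add: involution_def F.gen_s_def del: F.G_simps) (simp add: F.gen_s_def)
    next
      case 2
      then show ?thesis using F.gen_ts_square F.gen_closed F.G.m_closed[OF F.gen_closed(2,1)] unfolding ts
        by (simp add: involution_def ts_def del: F.G_simps) (simp add: ts_def)
    next
      case 3
      have "\<delta> i \<noteq> 0" using \<delta>_apply[of i i] by auto
      then show ?thesis using 3 F.gen_a_square[OF \<delta>_X \<psi>_\<delta>_self, of i] F.gen_a_closed[OF \<delta>_X, of i]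
        by (simp add: involution_def F.gen_a_def flip: F.embed_one del: F.G_simps)
    qed
  qed
  moreover have "generate F.G S = carrier F.G"
  proof (rule F.generate_G[where D = "\<delta> ` {..<e}"])
    show "S \<subseteq> carrier F.G" using inv by (auto simp: involution_def simp del: F.G_simps)
    show "F.gen_s \<in> S" "F.gen_t \<otimes>\<^bsub>F.G\<^esub> F.gen_s \<in> S" unfolding ts by (auto simp: S_def)
    show "F.gen_a ` \<delta> ` {..<e} \<subseteq> S" by (auto simp: S_def)
    show "\<delta> ` {..<e} \<subseteq> X" by auto
    show "\<psi> f b b = 0" if "b \<in> \<delta> ` {..<e}" for b using that \<psi>_\<delta>_self by auto
    show "X \<subseteq> Y" if "0 \<in> Y" "\<And>x y. x \<in> Y \<Longrightarrow> y \<in> Y \<Longrightarrow> x + y \<in> Y"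
      "\<And>x k. x \<in> \<delta> ` {..<e} \<Longrightarrow> T (int k) x \<in> Y" for Y
      by (rule X_span) (use that in auto)
    show "poly_lt x \<subseteq> W" if W: "0 \<in> W" "\<And>x y. x \<in> W \<Longrightarrow> y \<in> W \<Longrightarrow> x + y \<in> W"
      "\<And>x y k. x \<in> \<delta> ` {..<e} \<Longrightarrow> y \<in> \<delta> ` {..<e} \<Longrightarrow> \<phi> f x (T (int k) y) \<in> W"
      "\<And>x y k. x \<in> \<delta> ` {..<e} \<Longrightarrow> y \<in> \<delta> ` {..<e} \<Longrightarrow>
        \<psi> f x (T (- int k) y) + \<psi> f (T (- int k) y) x \<in> W" for W
    proof
      \<comment> \<open>Every parameter is the value of a commutator word, through
        \<open>\<phi>\<close> if \<open>i \<le> j\<close> and through \<open>\<psi>\<close>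
        otherwise. Those at the places \<open>pos\<close> are the monomials spanning
        \<open>V\<close>.\<close>
      have fW: "f i j r \<in> W" if ij: "i < e" "j < e" "r < n" for i j r
      proof (cases "i \<le> j")
        case True
        then show ?thesis using W(3)[of "\<delta> i" "\<delta> j" r] \<phi>_\<delta>[OF ij] ij by simp
      next
        case False
        then show ?thesis using W(4)[of "\<delta> i" "\<delta> j" r] \<psi>_\<delta>[of j i r f] \<psi>_\<delta>_0(2)[of j i f] ij by simp
      qed
      fix p assume p: "p \<in> poly_lt x"
      show "p \<in> W"
      proof (rule poly_lt_span[where h = "\<lambda>p. p", OF p W(1,2)])
        fix k assume k: "k < x"
        obtain i j r where p: "pos k = (i, j, r)" by (cases "pos k")
        then have "(i, j, r) \<in> {..<e} \<times> {..<e} \<times> {e + 2..<n}" using pos k by (metis image_subset_iff lessThan_iff)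
        then show "monom 1 k \<in> W" using fW[of i j r] f_pos[OF k] p by simp
      qed auto
    qed
  qed
  ultimately show ?thesis using fin unfolding involution_generating_set_def group_of_def by blast
qed

section \<open>Rigidity of the family\<close>

lemma hom_word:
  assumes f: "parameter f" and f': "parameter f'" and \<alpha>: "\<alpha> \<in> hom (group_of f) (group_of f')"
    and c: "a \<in> carrier (group_of f)" "g \<in> carrier (group_of f)" "b \<in> carrier (group_of f)"
  shows "\<alpha> (twisted_group.word X (poly_lt x) (\<phi> f) (\<psi> f) T N a g b)
    = twisted_group.word X (poly_lt x) (\<phi> f') (\<psi> f') T N (\<alpha> a) (\<alpha> g) (\<alpha> b)"
proof -
  interpret F: twisted_group X "poly_lt x" "\<phi> f" "\<psi> f" T N by (rule twisted[OF f])
  interpret F': twisted_group X "poly_lt x" "\<phi> f'" "\<psi> f'" T N by (rule twisted[OF f'])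
  interpret \<alpha>: group_hom F.G F'.G \<alpha>
    using \<alpha> F.group_G F'.group_G unfolding group_of_def by (simp add: group_hom_def group_hom_axioms_def)
  show ?thesis
    using c unfolding F.word_def F'.word_def group_of_def by (simp add: \<alpha>.hom_nat_pow del: F.G_simps F'.G_simps)
qed

text \<open>An isomorphism carries a word in the generators to the same word in their images, and
  the values of words are parameters. So it suffices to see that zero and nonzero parameters pin
  down each generator; the common basis at \<open>pos\<close> then rules out a linear change of
  \<open>V\<close>.\<close>

lemma rigid:
  assumes f: "parameter f" and f': "parameter f'" and iso: "\<alpha> \<in> iso (group_of f) (group_of f')"
    and S: "\<alpha> ` S = S"
  shows "f = f' \<and> (\<forall>z\<in>S. \<alpha> z = z)"
proof -
  interpret F: twisted_group X "poly_lt x" "\<phi> f" "\<psi> f" T N by (rule twisted[OF f])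
  interpret F': twisted_group X "poly_lt x" "\<phi> f'" "\<psi> f'" T N by (rule twisted[OF f'])
  have bij: "bij_betw \<alpha> (carrier F.G) (carrier F'.G)" and hom: "\<alpha> \<in> hom F.G F'.G"
    using iso by (auto simp: iso_def group_of_def simp del: F.G_simps F'.G_simps)
  interpret \<alpha>: group_hom F.G F'.G \<alpha>
    using hom F.group_G F'.group_G by (simp add: group_hom_def group_hom_axioms_def)
  note nosimps = F.G_simps F'.G_simps
  have inj: "\<alpha> y = \<alpha> z \<longleftrightarrow> y = z" if "y \<in> carrier F.G" "z \<in> carrier F.G" for y z
    using bij that by (auto simp: bij_betw_def dest: inj_onD simp del: nosimps)
  have inj1: "\<alpha> z = \<one>\<^bsub>F'.G\<^esub> \<longleftrightarrow> z = \<one>\<^bsub>F.G\<^esub>" if "z \<in> carrier F.G" for z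
    using inj[OF that F.G.one_closed] by (simp del: nosimps)
  have ts: "F.gen_t \<otimes>\<^bsub>F.G\<^esub> F.gen_s = ts" "F'.gen_t \<otimes>\<^bsub>F'.G\<^esub> F'.gen_s = ts"
    using J J_pos by (simp_all add: F.gen_t_def F.gen_s_def ts_def)
  note f_lt = parameter_lt[OF f] parameter_lt[OF f']
  note f_0 = parameter_0[OF f] parameter_0[OF f']
  note f_diag = parameter_diag[OF f] parameter_diag[OF f']
  note f_pos = parameter_pos[OF f] parameter_pos[OF f']
  have Sc: "S \<subseteq> carrier F.G" "S \<subseteq> carrier F'.G"
    using involution_generating_S[OF f] involution_generating_S[OF f']
    unfolding involution_generating_set_def involution_def group_of_def by blast+
  have \<alpha>S: "\<alpha> z \<in> S" if "z \<in> S" for z using S that by blast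
  have S_cases: "z = F.gen_s \<or> z = ts \<or> (\<exists>i<e. z = F.gen_a (\<delta> i))" if "z \<in> S" for z
    using that unfolding S_def by auto
  have sS: "F.gen_s \<in> S" and tsS: "ts \<in> S" and aS: "\<And>i. i < e \<Longrightarrow> F.gen_a (\<delta> i) \<in> S"
    by (auto simp: S_def)
  have neq: "F.gen_s \<noteq> ts" "F.gen_s \<noteq> F.gen_a b" "ts \<noteq> F.gen_a b" for b
    by (simp_all add: F.gen_s_def ts_def F.gen_a_def F.embed_def)
  have a8: "(F'.gen_a (\<delta> i) \<otimes>\<^bsub>F'.G\<^esub> z) [^]\<^bsub>F'.G\<^esub> (8::nat) = \<one>\<^bsub>F'.G\<^esub>" if "i < e" "z \<in> S" for i z
  proof (rule F'.pow_8_a)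
    show "\<delta> i \<in> X" using that by simp
    show "z = F'.gen_s \<or> z = F'.gen_t \<otimes>\<^bsub>F'.G\<^esub> F'.gen_s \<or> (\<exists>y\<in>X. \<psi> f' y y = 0 \<and> z = F'.gen_a y)"
      using S_cases[OF that(2)] \<delta>_X \<psi>_\<delta>_self unfolding ts by metis
  qed
  \<comment> \<open>Eighth powers keep the reflections from being mapped to some \<open>a_i\<close>;
    by counting, the \<open>a_i\<close> are then permuted among themselves.\<close>
  have not_a: "\<alpha> z \<noteq> F.gen_a (\<delta> i)"
    if zy: "z \<in> S" "y \<in> S" "(z \<otimes>\<^bsub>F.G\<^esub> y) [^]\<^bsub>F.G\<^esub> (8::nat) \<noteq> \<one>\<^bsub>F.G\<^esub>" "i < e" for z y i
  proof
    assume "\<alpha> z = F.gen_a (\<delta> i)"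
    then have "(\<alpha> z \<otimes>\<^bsub>F'.G\<^esub> \<alpha> y) [^]\<^bsub>F'.G\<^esub> (8::nat) = \<one>\<^bsub>F'.G\<^esub>"
      using a8[OF zy(4) \<alpha>S[OF zy(2)]] by simp
    moreover have zyc: "z \<in> carrier F.G" "y \<in> carrier F.G" using zy Sc by auto
    ultimately have "\<alpha> ((z \<otimes>\<^bsub>F.G\<^esub> y) [^]\<^bsub>F.G\<^esub> (8::nat)) = \<one>\<^bsub>F'.G\<^esub>"
      by (simp add: \<alpha>.hom_nat_pow del: nosimps)
    then show False using zy(3) inj1 zyc by (simp del: nosimps)
  qed
  have \<alpha>s: "\<alpha> F.gen_s = F.gen_s \<or> \<alpha> F.gen_s = ts"
    using S_cases[OF \<alpha>S[OF sS]] not_a[OF sS tsS] F.pow_8_s(1) unfolding ts by blast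
  have \<alpha>ts: "\<alpha> ts = F.gen_s \<or> \<alpha> ts = ts"
    using S_cases[OF \<alpha>S[OF tsS]] not_a[OF tsS sS] F.pow_8_s(2) unfolding ts by blast
  have \<alpha>_neq: "\<alpha> y \<noteq> \<alpha> z" if "y \<in> S" "z \<in> S" "y \<noteq> z" for y z
    using inj[of y z] that Sc by blast
  have \<alpha>a: "\<exists>j<e. \<alpha> (F.gen_a (\<delta> i)) = F.gen_a (\<delta> j)" if i: "i < e" for i
  proof -
    have "\<alpha> (F.gen_a (\<delta> i)) \<noteq> \<alpha> F.gen_s" "\<alpha> (F.gen_a (\<delta> i)) \<noteq> \<alpha> ts" "\<alpha> F.gen_s \<noteq> \<alpha> ts"
      using \<alpha>_neq sS tsS aS[OF i] neq by metis+
    then show ?thesis using S_cases[OF \<alpha>S[OF aS[OF i]]] \<alpha>s \<alpha>ts by metis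
  qed
  \<comment> \<open>The conjugating element is chosen according to the form that stores the
    parameter, so that \<open>w i j r\<close> always has value \<open>f i j r\<close>.\<close>
  define w where "w i j r = F.word (F.gen_a (\<delta> i))
    (if i \<le> j then F.gen_t [^]\<^bsub>F.G\<^esub> r \<otimes>\<^bsub>F.G\<^esub> F.gen_s else F.gen_t [^]\<^bsub>F.G\<^esub> r) (F.gen_a (\<delta> j))" for i j and r :: nat
  define w' where "w' i j r = F'.word (F.gen_a (\<delta> i))
    (if i \<le> j then F.gen_t [^]\<^bsub>F'.G\<^esub> r \<otimes>\<^bsub>F'.G\<^esub> F.gen_s else F.gen_t [^]\<^bsub>F'.G\<^esub> r) (F.gen_a (\<delta> j))" for i j and r :: nat
  have w: "w i j r = F.embed (f i j r, 0, 0)" and w': "w' i j r = F.embed (f' i j r, 0, 0)"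
    if ij: "i < e" "j < e" "r < n" for i j r
  proof -
    have \<psi>: "\<psi> g (\<delta> i) (T (- int r) (\<delta> j)) + \<psi> g (T (- int r) (\<delta> j)) (\<delta> i) = g i j r" if "\<not> i \<le> j" for g
      using \<psi>_\<delta>[of j i r g] \<psi>_\<delta>_0(2)[of j i g] ij that by simp
    have \<phi>: "\<phi> g (\<delta> i) (T (int r) (\<delta> j)) = g i j r" if "i \<le> j" for g
      using \<phi>_\<delta>[OF ij, of g] that by simp
    note d = \<delta>_X[OF ij(1)] \<delta>_X[OF ij(2)] \<psi>_\<delta>_self \<psi>_\<delta>_self
    have "w i j r = F.embed (f i j r, 0, 0) \<and> w' i j r = F.embed (f' i j r, 0, 0)"
    proof (cases "i \<le> j")
      case True
      show ?thesis
        unfolding w_def w'_def if_P[OF True] F.word_ts[OF d] F'.word_ts[OF d] \<phi>[OF True] by simp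
    next
      case False
      show ?thesis
        unfolding w_def w'_def if_not_P[OF False] F.word_t[OF d] F'.word_t[OF d] \<psi>[OF False] by simp
    qed
    then show "w i j r = F.embed (f i j r, 0, 0)" "w' i j r = F.embed (f' i j r, 0, 0)" by blast+
  qed
  have ac: "F.gen_a (\<delta> i) \<in> carrier F.G" "F.gen_a (\<delta> i) \<in> carrier F'.G" if "i < e" for i
    using aS[OF that] Sc by auto
  have embed_c: "F.embed (v, 0, 0) \<in> carrier F.G" if "v \<in> poly_lt x" for v
    using that F.embed_closed[of "(v, 0, 0)"] by (simp del: nosimps)
  have hom_w: "\<alpha> (F.word a g b) = F'.word (\<alpha> a) (\<alpha> g) (\<alpha> b)"
    if "a \<in> carrier F.G" "g \<in> carrier F.G" "b \<in> carrier F.G" for a g b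
    using hom_word[OF f f' _] that hom unfolding group_of_def by blast
  \<comment> \<open>If \<open>s\<close> went to \<open>ts\<close>, the word with value
    \<open>f 0 0 0\<close>, which is nonzero, would go to one with value \<open>f' j j 1\<close>,
    which is zero because 1 is neither 0 nor \<open>j + 2\<close>.\<close>
  have fix_s: "\<alpha> F.gen_s = F.gen_s"
  proof (rule ccontr)
    assume "\<alpha> F.gen_s \<noteq> F.gen_s"
    then have \<alpha>s: "\<alpha> F.gen_s = ts" using \<alpha>s by blast
    obtain j where j: "j < e" "\<alpha> (F.gen_a (\<delta> 0)) = F.gen_a (\<delta> j)" using \<alpha>a[OF e] by blast
    have "w 0 0 0 = F.word (F.gen_a (\<delta> 0)) F.gen_s (F.gen_a (\<delta> 0))"
      unfolding w_def by (simp del: nosimps)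
    then have "\<alpha> (w 0 0 0) = F'.word (F.gen_a (\<delta> j)) ts (F.gen_a (\<delta> j))"
      using hom_w[OF ac(1)[OF e] F.gen_closed(1) ac(1)[OF e]] \<alpha>s j by simp
    also have "\<dots> = w' j j 1"
      unfolding w'_def ts(2)[symmetric] using F'.gen_closed by (simp del: nosimps)
    also have "\<dots> = F.embed (f' j j 1, 0, 0)" using w' j en by simp
    also have "f' j j 1 = 0" using f_diag(2)[OF j(1), of 1] en by auto
    also have "F.embed (0, 0, 0) = \<one>\<^bsub>F'.G\<^esub>" by (rule F'.embed_one)
    finally have "\<alpha> (w 0 0 0) = \<one>\<^bsub>F'.G\<^esub>" .
    moreover have w0: "w 0 0 0 = F.embed (f 0 0 0, 0, 0)" using w e n by simp
    ultimately have "F.embed (f 0 0 0, 0, 0) = F.embed (0, 0, 0)"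
      using inj1[OF embed_c[OF f_lt(1)[OF e e n]]] F.embed_one by simp
    then show False using f_diag(1)[OF e, of 0] by simp
  qed
  then have fix_ts: "\<alpha> ts = ts" using \<alpha>ts \<alpha>_neq[OF sS tsS neq(1)] by auto
  have t: "ts \<otimes>\<^bsub>F.G\<^esub> F.gen_s = F.gen_t"
    unfolding ts(1)[symmetric] using F.gen_closed by (simp add: F.G.m_assoc F.gen_s_square del: nosimps)
  have t': "ts \<otimes>\<^bsub>F'.G\<^esub> F.gen_s = F.gen_t"
    unfolding ts(2)[symmetric] using F'.gen_closed by (simp add: F'.G.m_assoc F'.gen_s_square del: nosimps)
  have fix_t: "\<alpha> F.gen_t = F.gen_t"
    using \<alpha>.hom_mult[OF subsetD[OF Sc(1) tsS] subsetD[OF Sc(1) sS]] fix_s fix_ts t t'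
    by (simp del: nosimps)
  have hw: "\<alpha> (w i j r) = F'.word (\<alpha> (F.gen_a (\<delta> i)))
    (if i \<le> j then F.gen_t [^]\<^bsub>F'.G\<^esub> r \<otimes>\<^bsub>F'.G\<^esub> F.gen_s else F.gen_t [^]\<^bsub>F'.G\<^esub> r) (\<alpha> (F.gen_a (\<delta> j)))"
    if "i < e" "j < e" for i j r
    unfolding w_def using hom_w[OF ac(1)[OF that(1)] _ ac(1)[OF that(2)]] F.gen_closed
    by (simp add: \<alpha>.hom_nat_pow fix_t fix_s del: nosimps)
  \<comment> \<open>Among the reserved exponents from 2 to \<open>e + 1\<close>, the diagonal
    parameter of index \<open>j\<close> is nonzero only at \<open>j + 2\<close>; evaluating at
    \<open>i + 2\<close> therefore forces \<open>j = i\<close>.\<close>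
  have fix_a: "\<alpha> (F.gen_a (\<delta> i)) = F.gen_a (\<delta> i)" if i: "i < e" for i
  proof -
    obtain j where j: "j < e" "\<alpha> (F.gen_a (\<delta> i)) = F.gen_a (\<delta> j)" using \<alpha>a[OF i] by blast
    have r: "i + 2 < n" "i + 2 < e + 2" using i en by auto
    have "\<alpha> (w i i (i + 2)) = w' j j (i + 2)" unfolding hw[OF i i] j(2) w'_def by simp
    then have "\<alpha> (F.embed (f i i (i + 2), 0, 0)) = F.embed (f' j j (i + 2), 0, 0)"
      using w[OF i i r(1)] w'[OF j(1) j(1) r(1)] by simp
    moreover have "F.embed (f i i (i + 2), 0, 0) \<noteq> F.embed (0, 0, 0)" using f_diag(1)[OF i r(2)] by simp
    then have "\<alpha> (F.embed (f i i (i + 2), 0, 0)) \<noteq> \<one>\<^bsub>F'.G\<^esub>"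
      using inj1[OF embed_c[OF f_lt(1)[OF i i r(1)]]] F.embed_one by simp
    ultimately have "f' j j (i + 2) \<noteq> 0" using F'.embed_one by auto
    then have "i = j" using f_diag(2)[OF j(1) r(2)] by auto
    then show ?thesis using j by simp
  qed
  have fix_f: "\<alpha> (F.embed (f i j r, 0, 0)) = F.embed (f' i j r, 0, 0)" if ij: "i < e" "j < e" "r < n" for i j r
  proof -
    have "\<alpha> (w i j r) = w' i j r"
      unfolding hw[OF ij(1,2)] fix_a[OF ij(1)] fix_a[OF ij(2)] w'_def ..
    then show ?thesis using w[OF ij] w'[OF ij] by simp
  qed
  \<comment> \<open>At the places \<open>pos\<close> both \<open>f\<close> and \<open>f'\<close>
    take the same basis vectors as values, so \<open>\<alpha>\<close> fixes a basis of
    \<open>V\<close>.\<close>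
  have fix_V: "p \<in> {v \<in> poly_lt x. \<alpha> (F.embed (v, 0, 0)) = F.embed (v, 0, 0)}" if p: "p \<in> poly_lt x" for p
  proof (rule poly_lt_span[where h = "\<lambda>p. p", OF p])
    show "0 \<in> {v \<in> poly_lt x. \<alpha> (F.embed (v, 0, 0)) = F.embed (v, 0, 0)}"
      using x \<alpha>.hom_one F.embed_one F'.embed_one by simp
    show "v + w \<in> {v \<in> poly_lt x. \<alpha> (F.embed (v, 0, 0)) = F.embed (v, 0, 0)}"
      if "v \<in> {v \<in> poly_lt x. \<alpha> (F.embed (v, 0, 0)) = F.embed (v, 0, 0)}"
        "w \<in> {v \<in> poly_lt x. \<alpha> (F.embed (v, 0, 0)) = F.embed (v, 0, 0)}" for v w
      using that \<alpha>.hom_mult[OF embed_c[of v] embed_c[of w]] F.embed_mult[of "(w, 0, 0)" "(v, 0, 0)"]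
        F'.embed_mult[of "(w, 0, 0)" "(v, 0, 0)"] by (simp del: nosimps)
    fix k assume k: "k < x"
    obtain i j r where p: "pos k = (i, j, r)" by (cases "pos k")
    then have "(i, j, r) \<in> {..<e} \<times> {..<e} \<times> {e + 2..<n}" using pos k by (metis image_subset_iff lessThan_iff)
    then show "monom 1 k \<in> {v \<in> poly_lt x. \<alpha> (F.embed (v, 0, 0)) = F.embed (v, 0, 0)}"
      using fix_f[of i j r] f_pos[OF k] f_lt(1)[of i j r] p by simp
  qed simp
  have "f i j r = f' i j r" for i j r
  proof (cases "i < e \<and> j < e \<and> r < n")
    case True
    then show ?thesis using fix_f[of i j r] fix_V[OF f_lt(1)[of i j r]] by simp
  qed (simp add: f_0)
  then show ?thesis using S_cases fix_s fix_ts fix_a by blast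
qed

section \<open>Counting the parameters\<close>

lemma finite_parameters: "finite {f. parameter f}"
proof (rule finite_imageD)
  let ?I = "{..<e} \<times> {..<e} \<times> {..<n}"
  let ?h = "\<lambda>f. restrict (\<lambda>(i, j, r). f i j r) ?I"
  show "inj_on ?h {f. parameter f}"
  proof (rule inj_onI)
    fix f g assume fg: "f \<in> {f. parameter f}" "g \<in> {f. parameter f}" "?h f = ?h g"
    have "f i j r = g i j r" for i j r
    proof (cases "i < e \<and> j < e \<and> r < n")
      case True
      then show ?thesis using fun_cong[OF fg(3), of "(i, j, r)"] by simp
    next
      case False
      then show ?thesis using fg(1,2) parameter_0[OF _ False, of f] parameter_0[OF _ False, of g] by simp
    qed
    then show "f = g" by (intro ext)
  qed
  have "?h ` {f. parameter f} \<subseteq> ?I \<rightarrow>\<^sub>E poly_lt x"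
  proof (intro image_subsetI PiE_I)
    fix f i assume "f \<in> {f. parameter f}" "i \<in> ?I"
    then show "?h f i \<in> poly_lt x" using parameter_lt by auto
  qed simp
  then show "finite (?h ` {f. parameter f})"
    by (rule finite_subset) (use card_poly_lt[OF x] in \<open>auto intro: finite_PiE\<close>)
qed

text \<open>Only places with exponent at least \<open>e + 2\<close> outside \<open>pos\<close> are
  left free. The reserved exponents cost \<open>e * e * (e + 2)\<close> vectors of \<open>V\<close>,
  a number independent of \<open>n\<close> and thus harmless.\<close>

lemma card_parameters: "2 ^ (x * (e * e * (n - (e + 2)) - x)) \<le> card {f. parameter f}"
proof -
  let ?I = "{..<e} \<times> {..<e} \<times> {e + 2..<n}"
  let ?free = "?I - pos ` {..<x}"
  have "card ?free = card ?I - card (pos ` {..<x})" by (rule card_Diff_subset) (use pos in auto)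
  then have cf: "card ?free = e * e * (n - (e + 2)) - x" by (simp add: card_image[OF inj_pos])
  \<comment> \<open>Off the free places the values are frozen: basis monomials at
    \<open>pos\<close>, the constant 1 at the reserved diagonal places 0 and \<open>i + 2\<close>,
    and 0 elsewhere.\<close>
  define fill where "fill g i j r = (if (i, j, r) \<in> ?free then g (i, j, r)
    else if (i, j, r) \<in> ?I then monom 1 (the_inv_into {..<x} pos (i, j, r))
    else if i < e \<and> j = i \<and> (r = 0 \<or> r = i + 2) then 1 else 0)"
    for g :: "nat \<times> nat \<times> nat \<Rightarrow> bit poly" and i j r
  have par: "parameter (fill g)" if g: "g \<in> ?free \<rightarrow>\<^sub>E poly_lt x" for g
    unfolding parameter_def
  proof (intro conjI allI impI)
    fix i j r
    have 1: "(1 :: bit poly) \<in> poly_lt x" using x by (simp add: poly_lt_def)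
    have m: "monom 1 (the_inv_into {..<x} pos (i, j, r)) \<in> poly_lt x" if "(i, j, r) \<in> pos ` {..<x}"
      using the_inv_into_into[OF inj_pos that subset_refl] by (simp add: poly_lt_def degree_monom_eq)
    show "if i < e \<and> j < e \<and> r < n then fill g i j r \<in> poly_lt x else fill g i j r = 0"
      using PiE_mem[OF g, of "(i, j, r)"] m 1 x en unfolding fill_def by auto
  next
    fix i r assume "i < e" "r < e + 2"
    then show "(fill g i i r \<noteq> 0) = (r = 0 \<or> r = i + 2)" unfolding fill_def by auto
  next
    fix k assume k: "k < x"
    obtain i j r where p: "pos k = (i, j, r)" by (cases "pos k")
    then have "(i, j, r) \<in> ?I" using pos k by (metis image_subset_iff lessThan_iff)
    moreover have "(i, j, r) \<notin> ?free" using p k by (metis DiffD2 imageI lessThan_iff)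
    moreover have "the_inv_into {..<x} pos (i, j, r) = k"
      using the_inv_into_f_f[OF inj_pos, of k] k p by simp
    ultimately show "case pos k of (i, j, r) \<Rightarrow> fill g i j r = monom 1 k"
      unfolding p fill_def by simp
  qed
  have "inj_on fill (?free \<rightarrow>\<^sub>E poly_lt x)"
  proof (rule inj_onI)
    fix g h assume g: "g \<in> ?free \<rightarrow>\<^sub>E poly_lt x" and h: "h \<in> ?free \<rightarrow>\<^sub>E poly_lt x" and eq: "fill g = fill h"
    show "g = h"
    proof (rule PiE_ext[OF g h])
      fix z assume z: "z \<in> ?free"
      obtain i j r where "z = (i, j, r)" by (cases z)
      then show "g z = h z" using fun_cong[OF fun_cong[OF fun_cong[OF eq, of i], of j], of r] z
        by (simp add: fill_def)
    qed
  qed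
  then have "card (?free \<rightarrow>\<^sub>E poly_lt x) = card (fill ` (?free \<rightarrow>\<^sub>E poly_lt x))" by (simp add: card_image)
  also have "\<dots> \<le> card {f. parameter f}" using par by (intro card_mono finite_parameters) auto
  finally show ?thesis using card_poly_lt[OF x] cf by (simp add: card_PiE power_mult)
qed

lemma class_bounds:
  assumes "m = x + 2 * e * n + J + 1"
  shows "2 ^ (x * (e * e * (n - (e + 2)) - x)) \<le> num_involution_generated_groups (e + 2) m * 2 ^ (m * (e + 2))"
    and "2 ^ (x * (e * e * (n - (e + 2)) - x)) \<le> num_involution_Cayley_graphs (e + 2) m"
proof -
  let ?C = "((poly_lt x \<times> X \<times> X) \<times> {0..<int N}) \<times> {0..<2 :: int}"
  have G: "group (group_of f)" and C: "carrier (group_of f) = ?C" 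
    and S: "involution_generating_set (group_of f) (e + 2) S" if "f \<in> {f. parameter f}" for f
    using that carrier_group_of involution_generating_S by auto
  have R: "f = f' \<and> (\<forall>z\<in>S. \<alpha> z = z)"
    if "f \<in> {f. parameter f}" "f' \<in> {f. parameter f}" "\<alpha> \<in> iso (group_of f) (group_of f')" "\<alpha> ` S = S" for f f' \<alpha>
    using rigid that by blast
  \<comment> \<open>The cardinality of the carrier is known through a parameter; the lower bound on
    their number provides one.\<close>
  have "(1::nat) \<le> 2 ^ (x * (e * e * (n - (e + 2)) - x))" by simp
  then have "card {f. parameter f} \<noteq> 0" using card_parameters by linarith
  then obtain f where "parameter f" by (metis card.empty empty_Collect_eq)
  then have cC: "card ?C = 2 ^ m" using card_group_of[of f] C[of f] assms by simp
  note bounds = rigid_family_bounds'[where H = group_of, OF finite_parameters G C cC S R]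
  show "2 ^ (x * (e * e * (n - (e + 2)) - x)) \<le> num_involution_generated_groups (e + 2) m * 2 ^ (m * (e + 2))"
    using card_parameters bounds(1) by linarith
  show "2 ^ (x * (e * e * (n - (e + 2)) - x)) \<le> num_involution_Cayley_graphs (e + 2) m"
    using card_parameters bounds(2) by linarith
qed

end

section \<open>Asymptotics\<close>

lemma ex_construction:
  assumes "e > 0" "e + 2 \<le> n" "n \<le> 2 ^ J" "8 < (2::nat) ^ J" "x > 0" "x \<le> e * e * (n - (e + 2))"
  shows "\<exists>pos. construction e n J x pos"
proof -
  let ?I = "{..<e} \<times> {..<e} \<times> {e + 2..<n}"
  have "card {..<x} \<le> card ?I" using assms(6) by (simp add: mult.assoc)
  then obtain pos where "pos ` {..<x} \<subseteq> ?I" "inj_on pos {..<x}"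
    using card_le_inj[of "{..<x}" ?I] by auto
  then have "construction e n J x pos" using assms by unfold_locales
  then show ?thesis by blast
qed

text \<open>
  The choice of \<open>n\<close> makes \<open>x * y\<close>, with \<open>x\<close> the dimension of \<open>V\<close> and \<open>y\<close> the number of
  free commutators, asymptotically maximal for groups of order \<open>2 ^ m\<close>.
\<close>

context
  fixes e :: nat
  assumes e: "e > 0"
begin

definition dim_n :: "nat \<Rightarrow> nat" where
  "dim_n m = (m * (e + 4)) div (4 * e * (e + 2))"

text \<open>Gives \<open>m + 16 \<le> 2 ^ J\<close>, which covers both \<open>n \<le> 2 ^ J\<close>
  and \<open>8 < 2 ^ J\<close>, while growing only logarithmically.\<close>

definition dim_J :: "nat \<Rightarrow> nat" where
  "dim_J m = nat \<lceil>log 2 (real m + 16)\<rceil>"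

text \<open>\<open>V\<close> absorbs what the other factors leave of the exponent, so every large
  \<open>m\<close> is attained exactly. The value is real to avoid truncated subtraction in the
  limits.\<close>

definition dim_x :: "nat \<Rightarrow> real" where
  "dim_x m = real m - 2 * real e * real (dim_n m) - real (dim_J m) - 1"

definition dim_y :: "nat \<Rightarrow> real" where
  "dim_y m = real e * real e * (real (dim_n m) - (real e + 2)) - dim_x m"

section \<open>Limits of the dimensions relative to \<open>m\<close>\<close>

lemma dim_n_lim: "(\<lambda>m. real (dim_n m) / real m) \<longlonglongrightarrow> (real e + 4) / (4 * real e * (real e + 2))"
proof -
  define a where "a = (real e + 4) / (4 * real e * (real e + 2))"
  have "a * real m = real (m * (e + 4)) / real (4 * e * (e + 2))" for m
    by (simp only: a_def of_nat_mult of_nat_add of_nat_numeral times_divide_eq_left mult.commute[of "real m"])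
  then have "\<lfloor>a * real m\<rfloor> = int (dim_n m)" for m by (simp only: floor_divide_of_nat_eq dim_n_def)
  then have up: "real (dim_n m) \<le> a * real m" and lo: "a * real m - 1 \<le> real (dim_n m)" for m
    by (metis of_int_floor_le of_int_of_nat_eq, metis of_int_of_nat_eq real_of_int_floor_ge_diff_one)
  have "(\<lambda>m. real (dim_n m) / real m) \<longlonglongrightarrow> a"
  proof (rule tendsto_sandwich)
    show "\<forall>\<^sub>F m in sequentially. a - 1 / real m \<le> real (dim_n m) / real m"
      using eventually_gt_at_top[of 0]
    proof eventually_elim
      case (elim m)
      have "(a * real m - 1) / real m \<le> real (dim_n m) / real m"
        using lo[of m] elim by (intro divide_right_mono) auto
      then show ?case using elim by (simp add: diff_divide_distrib)
    qed
    show "\<forall>\<^sub>F m in sequentially. real (dim_n m) / real m \<le> a"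
      using eventually_gt_at_top[of 0]
      by eventually_elim (use up in \<open>simp add: divide_le_eq\<close>)
    show "(\<lambda>m. a - 1 / real m) \<longlonglongrightarrow> a" by real_asymp
  qed simp
  then show ?thesis by (simp add: a_def)
qed

lemma dim_J_lim: "(\<lambda>m. real (dim_J m) / real m) \<longlonglongrightarrow> 0"
proof (rule tendsto_sandwich[where f = "\<lambda>_. 0"])
  have "real (dim_J m) \<le> log 2 (real m + 16) + 1" for m
  proof -
    have "0 \<le> log 2 (real m + 16)" by simp
    then show ?thesis unfolding dim_J_def by linarith
  qed
  then show "\<forall>\<^sub>F m in sequentially. real (dim_J m) / real m \<le> (log 2 (real m + 16) + 1) / real m"
    by (intro always_eventually allI divide_right_mono) auto
  show "(\<lambda>m. (log 2 (real m + 16) + 1) / real m) \<longlonglongrightarrow> 0" by real_asymp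
qed auto

lemma dim_x_lim: "(\<lambda>m. dim_x m / real m) \<longlonglongrightarrow> real e / (2 * (real e + 2))"
proof -
  have "(\<lambda>m. 1 - 2 * real e * (real (dim_n m) / real m) - real (dim_J m) / real m - 1 / real m)
    \<longlonglongrightarrow> 1 - 2 * real e * ((real e + 4) / (4 * real e * (real e + 2))) - 0 - 0"
    by (intro tendsto_diff tendsto_mult tendsto_const dim_n_lim dim_J_lim lim_1_over_n)
  also have "1 - 2 * real e * ((real e + 4) / (4 * real e * (real e + 2))) - 0 - 0 = real e / (2 * (real e + 2))"
    using e by (simp add: divide_simps)
  finally show ?thesis
  proof (rule Lim_transform_eventually)
    show "\<forall>\<^sub>F m in sequentially. 1 - 2 * real e * (real (dim_n m) / real m) - real (dim_J m) / real m - 1 / real m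
      = dim_x m / real m"
      using eventually_gt_at_top[of 0] by eventually_elim (simp add: dim_x_def field_simps)
  qed
qed

lemma dim_y_lim: "(\<lambda>m. dim_y m / real m) \<longlonglongrightarrow> real e / 4"
proof -
  have "(\<lambda>m. real e * real e * (real (dim_n m) / real m - (real e + 2) * (1 / real m)) - dim_x m / real m)
    \<longlonglongrightarrow> real e * real e * ((real e + 4) / (4 * real e * (real e + 2)) - (real e + 2) * 0) - real e / (2 * (real e + 2))"
    by (intro tendsto_diff tendsto_mult tendsto_const dim_n_lim dim_x_lim lim_1_over_n)
  also have "real e * real e * ((real e + 4) / (4 * real e * (real e + 2)) - (real e + 2) * 0) - real e / (2 * (real e + 2)) = real e / 4"
    using e by (simp add: divide_simps) (simp add: algebra_simps)
  finally show ?thesis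
  proof (rule Lim_transform_eventually)
    show "\<forall>\<^sub>F m in sequentially. real e * real e * (real (dim_n m) / real m - (real e + 2) * (1 / real m)) - dim_x m / real m
      = dim_y m / real m"
      using eventually_gt_at_top[of 0] by eventually_elim (simp add: dim_y_def field_simps)
  qed
qed

lemma eventually_pos:
  assumes "(\<lambda>m. g m / real m) \<longlonglongrightarrow> c" "c > 0"
  shows "\<forall>\<^sub>F m in sequentially. g m > 0"
  using order_tendstoD(1)[OF assms] eventually_gt_at_top[of 0]
  by eventually_elim (simp add: zero_less_divide_iff)

text \<open>Both dimensions grow linearly, so they are eventually positive. Positivity of
  \<open>dim_x\<close> turns the truncated difference defining \<open>x\<close> into a true one;
  positivity of \<open>dim_y\<close> gives \<open>e + 2 \<le> n\<close> and leaves room for the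
  \<open>x\<close> basis places.\<close>

lemma eventually_construction:
  "\<forall>\<^sub>F m in sequentially. \<exists>n J x pos. construction e n J x pos \<and> m = x + 2 * e * n + J + 1 \<and>
     dim_x m = real x \<and> dim_y m = real (e * e * (n - (e + 2)) - x)"
proof -
  have "\<forall>\<^sub>F m in sequentially. dim_x m > 0" "\<forall>\<^sub>F m in sequentially. dim_y m > 0"
    using eventually_pos[OF dim_x_lim] eventually_pos[OF dim_y_lim] e by simp_all
  then show ?thesis
  proof eventually_elim
    case (elim m)
    define n where "n = dim_n m"
    define J where "J = dim_J m"
    define x where "x = m - (2 * e * n + J + 1)"
    have "real (2 * e * n + J + 1) < real m"
      using elim(1) by (simp add: dim_x_def n_def J_def)
    then have lt: "2 * e * n + J + 1 < m" by (simp only: of_nat_less_iff)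
    then have m: "m = x + 2 * e * n + J + 1" and x: "x > 0" by (simp_all add: x_def)
    have xr: "dim_x m = real x"
      unfolding dim_x_def n_def[symmetric] J_def[symmetric] by (subst (1) m) simp
    have "real e * real e * (real n - (real e + 2)) > real x"
      using elim(2) unfolding dim_y_def xr n_def by simp
    moreover have "real x > 0" using x by simp
    ultimately have "real e * real e * (real n - (real e + 2)) > 0" by linarith
    then have "real n - (real e + 2) > 0" using e by (simp add: zero_less_mult_iff)
    then have n: "e + 2 \<le> n" by linarith
    have u: "real e * real e * (real n - (real e + 2)) = real (e * e * (n - (e + 2)))"
      using n by (simp add: of_nat_diff)
    then have "real x < real (e * e * (n - (e + 2)))"
      using \<open>real e * real e * (real n - (real e + 2)) > real x\<close> by (simp only:)
    then have xu: "x \<le> e * e * (n - (e + 2))" by (simp only: of_nat_less_iff)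
    have yr: "dim_y m = real (e * e * (n - (e + 2)) - x)"
      unfolding dim_y_def xr n_def[symmetric] u using xu by (simp add: of_nat_diff)
    have "real m + 16 = 2 powr log 2 (real m + 16)" by simp
    also have "\<dots> \<le> 2 powr real J"
    proof -
      have "log 2 (real m + 16) \<le> real J" unfolding J_def dim_J_def by linarith
      then show ?thesis by (intro powr_mono) auto
    qed
    also have "\<dots> = real (2 ^ J)" by (simp add: powr_realpow)
    finally have "real (m + 16) \<le> real (2 ^ J)" by simp
    then have J: "m + 16 \<le> 2 ^ J" by (simp only: of_nat_le_iff)
    have "2 * e * n \<ge> n" using e by simp
    then have "n \<le> m" using lt by linarith
    then have "n \<le> 2 ^ J" "8 < (2::nat) ^ J" using J by linarith+
    then obtain pos where "construction e n J x pos"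
      using ex_construction[OF e n _ _ x xu] by blast
    then show ?case using m xr yr by blast
  qed
qed

text \<open>The limits \<open>e / (2 (e + 2))\<close> and \<open>e / 4\<close> multiply to
  \<open>e^2 / (8 (e + 2))\<close>, the constant in question for \<open>d = e + 2\<close>. The loss
  \<open>m (e + 2)\<close> from choosing generators is linear in \<open>m\<close>.\<close>

lemma exponent_smallo:
  "(\<lambda>m. dim_x m * dim_y m - real m * (real e + 2) - real e ^ 2 / (8 * (real e + 2)) * real m ^ 2)
     \<in> o(\<lambda>m. real m ^ 2)"
proof (rule smalloI_tendsto)
  have "(\<lambda>m. (dim_x m / real m) * (dim_y m / real m) - (real e + 2) * (1 / real m)
      - real e ^ 2 / (8 * (real e + 2)))
    \<longlonglongrightarrow> real e / (2 * (real e + 2)) * (real e / 4) - (real e + 2) * 0 - real e ^ 2 / (8 * (real e + 2))"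
    by (intro tendsto_diff tendsto_mult tendsto_const dim_x_lim dim_y_lim lim_1_over_n)
  also have "real e / (2 * (real e + 2)) * (real e / 4) - (real e + 2) * 0 - real e ^ 2 / (8 * (real e + 2)) = 0"
    by (simp add: power2_eq_square)
  finally show "(\<lambda>m. (dim_x m * dim_y m - real m * (real e + 2)
      - real e ^ 2 / (8 * (real e + 2)) * real m ^ 2) / real m ^ 2) \<longlonglongrightarrow> 0"
  proof (rule Lim_transform_eventually)
    show "\<forall>\<^sub>F m in sequentially. (dim_x m / real m) * (dim_y m / real m) - (real e + 2) * (1 / real m)
      - real e ^ 2 / (8 * (real e + 2)) = (dim_x m * dim_y m - real m * (real e + 2)
      - real e ^ 2 / (8 * (real e + 2)) * real m ^ 2) / real m ^ 2"
      using eventually_gt_at_top[of 0]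
      by eventually_elim (simp add: diff_divide_distrib power2_eq_square)
  qed
  show "\<forall>\<^sub>F m in sequentially. real m ^ 2 \<noteq> 0"
    using eventually_gt_at_top[of 0] by eventually_elim simp
qed

lemma eventually_bounds:
  "\<forall>\<^sub>F m in sequentially.
     2 powr (dim_x m * dim_y m - real m * (real e + 2)) \<le> real (num_involution_generated_groups (e + 2) m) \<and>
     2 powr (dim_x m * dim_y m - real m * (real e + 2)) \<le> real (num_involution_Cayley_graphs (e + 2) m)"
  using eventually_construction
proof eventually_elim
  case (elim m)
  then obtain n J x pos where c: "construction e n J x pos" and m: "m = x + 2 * e * n + J + 1"
    and xy: "dim_x m = real x" "dim_y m = real (e * e * (n - (e + 2)) - x)" by blast
  let ?k = "x * (e * e * (n - (e + 2)) - x)"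
  have k: "2 powr (dim_x m * dim_y m) = real (2 ^ ?k)"
    unfolding xy by (simp add: powr_realpow flip: of_nat_mult)
  have mm: "2 powr (real m * (real e + 2)) = real (2 ^ (m * (e + 2)))"
  proof -
    have "real m * (real e + 2) = real (m * (e + 2))" by (simp add: algebra_simps)
    then show ?thesis using powr_realpow[of 2 "m * (e + 2)"] by (simp only: of_nat_power of_nat_numeral)
  qed
  have "real (2 ^ ?k) \<le> real (num_involution_generated_groups (e + 2) m * 2 ^ (m * (e + 2)))"
    using construction.class_bounds(1)[OF c m] by (simp only: of_nat_le_iff)
  then have "2 powr (dim_x m * dim_y m)
      \<le> real (num_involution_generated_groups (e + 2) m) * 2 powr (real m * (real e + 2))"
    unfolding k mm by simp
  then have 1: "2 powr (dim_x m * dim_y m - real m * (real e + 2)) \<le> real (num_involution_generated_groups (e + 2) m)"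
    by (simp add: powr_diff divide_le_eq)
  \<comment> \<open>For graphs the bound comes without the loss; it is weakened so that one error
    term serves both counts.\<close>
  have "2 powr (dim_x m * dim_y m - real m * (real e + 2)) \<le> 2 powr (dim_x m * dim_y m)"
    by (rule powr_mono) auto
  also have "\<dots> \<le> real (num_involution_Cayley_graphs (e + 2) m)"
    unfolding k using construction.class_bounds(2)[OF c m] by (simp only: of_nat_le_iff)
  finally show ?case using 1 by blast
qed

end

theorem theorem5p6:
  fixes d :: nat
  assumes "d \<ge> 3"
  shows "(\<exists>\<epsilon> :: nat \<Rightarrow> real. \<epsilon> \<in> o(\<lambda>m. real m ^ 2) \<and>
            (\<forall>\<^sub>F m in sequentially.
               real (num_involution_generated_groups d m)
                 \<ge> 2 powr ((real d - 2) ^ 2 / (8 * real d) * real m ^ 2 + \<epsilon> m))) \<and>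
         (\<exists>\<epsilon> :: nat \<Rightarrow> real. \<epsilon> \<in> o(\<lambda>m. real m ^ 2) \<and>
            (\<forall>\<^sub>F m in sequentially.
               real (num_involution_Cayley_graphs d m)
                 \<ge> 2 powr ((real d - 2) ^ 2 / (8 * real d) * real m ^ 2 + \<epsilon> m)))"
proof -
  define e where "e = d - 2"
  have e: "e > 0" and d: "d = e + 2" using assms by (simp_all add: e_def)
  let ?\<epsilon> = "\<lambda>m. dim_x e m * dim_y e m - real m * (real e + 2) - real e ^ 2 / (8 * (real e + 2)) * real m ^ 2"
  have exp: "(real d - 2) ^ 2 / (8 * real d) * real m ^ 2 + ?\<epsilon> m = dim_x e m * dim_y e m - real m * (real e + 2)" for m
    by (simp add: d)
  have "?\<epsilon> \<in> o(\<lambda>m. real m ^ 2)" by (rule exponent_smallo[OF e])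
  moreover have "\<forall>\<^sub>F m in sequentially. real (num_involution_generated_groups d m)
      \<ge> 2 powr ((real d - 2) ^ 2 / (8 * real d) * real m ^ 2 + ?\<epsilon> m)"
    and "\<forall>\<^sub>F m in sequentially. real (num_involution_Cayley_graphs d m)
      \<ge> 2 powr ((real d - 2) ^ 2 / (8 * real d) * real m ^ 2 + ?\<epsilon> m)"
    unfolding exp using eventually_bounds[OF e] unfolding d by (auto elim: eventually_mono)
  ultimately show ?thesis by blast
qed

end
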